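(* Let $a,b>-1$ with $\alpha:=a+b>-1$, and let $n\ge0$ be an integer. For $z\in\mathbb C\setminus[0,\infty)$ the auxiliary functions of the first kind have the Meijer $G$-function representation $$p_n^{(1)}(z):=\int_0^\infty\frac{p_n(x)\,x^ae^{-x}\,dx}{z-x}=e^{-z}(-1)^{n+1}\pi_n\;G^{2,1}_{2,3}\!\left(\left.{-n-b,\ a+n+1\atop 0,\ a,\ -b}\;\right|-z\right).$$ A similar expression holds for $q_n^{(1)}(z):=\int_0^\infty\frac{q_n(y)\,y^be^{-y}\,dy}{z-y}$ by interchanging $a\leftrightarrow b$ and $\pi_n\leftrightarrow\eta_n$.
   Context: $p_n,q_n$ are the polynomials of exact degree $n$ with identical positive leading coefficients such that $\int_0^\infty\!\int_0^\infty\frac{x^ay^be^{-x-y}}{x+y}p_\ell(x)q_m(y)\,dx\,dy=\delta_{\ell m}$. The constants are $$\pi_n=\sqrt{2n+\alpha+1}\,\sqrt{\frac{\Gamma(a+n+1)}{\Gamma(b+n+1)}},\qquad \eta_n=\sqrt{2n+\alpha+1}\,\sqrt{\frac{\Gamma(b+n+1)}{\Gamma(a+n+1)}}.$$ The Meijer $G$-function (for $p\le q$, $0\le m\le q$, $0\le n\le p$) is $$G^{m,n}_{p,q}\!\left(\left.{a_1,\dots,a_p\atop b_1,\dots,b_q}\right|z\right)=\int_\gamma\frac{du}{2\pi i}\,\frac{\prod_{j=1}^m\Gamma(b_j+u)\prod_{j=1}^n\Gamma(1-a_j-u)}{\prod_{j=m+1}^q\Gamma(1-b_j-u)\prod_{j=n+1}^p\Gamma(a_j+u)}\,z^{-u},$$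 where $\gamma$ originates at $-\infty$ in the lower half-plane, returns to $-\infty$ in the upper half-plane, encircles all poles of the $\Gamma(b_j+u)$, $j\le m$, and none of the poles of the $\Gamma(1-a_j-u)$, $j\le n$; $z^{-u}$ is the principal branch, with cut along $z<0$. *)

theory Defs
  imports "HOL-Complex_Analysis.Complex_Analysis" "HOL-Computational_Algebra.Polynomial"
begin


definition cauchy_laguerre_pairing :: "real \<Rightarrow> real \<Rightarrow> real poly \<Rightarrow> real poly \<Rightarrow> real" where
  "cauchy_laguerre_pairing a b P Q =
     (LINT x:{0<..}|lborel. LINT y:{0<..}|lborel.
        x powr a * y powr b * exp (- x - y) / (x + y) * poly P x * poly Q y)"

definition cauchy_laguerre_biorthonormal ::
    "real \<Rightarrow> real \<Rightarrow> (nat \<Rightarrow> real poly) \<Rightarrow> (nat \<Rightarrow> real poly) \<Rightarrow> bool" where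
  "cauchy_laguerre_biorthonormal a b p q \<longleftrightarrow>
     (\<forall>n. degree (p n) = n \<and> degree (q n) = n \<and>
          lead_coeff (p n) = lead_coeff (q n) \<and> lead_coeff (p n) > 0) \<and>
     (\<forall>l m. cauchy_laguerre_pairing a b (p l) (q m) = (if l = m then 1 else 0))"

definition cl_pi :: "real \<Rightarrow> real \<Rightarrow> nat \<Rightarrow> real" where
  "cl_pi a b n = sqrt (2 * real n + (a + b) + 1) *
     sqrt (Gamma (a + real n + 1) / Gamma (b + real n + 1))"

definition cl_eta :: "real \<Rightarrow> real \<Rightarrow> nat \<Rightarrow> real" where
  "cl_eta a b n = sqrt (2 * real n + (a + b) + 1) *
     sqrt (Gamma (b + real n + 1) / Gamma (a + real n + 1))"

definition first_kind_integrand :: "real \<Rightarrow> real poly \<Rightarrow> complex \<Rightarrow> real \<Rightarrow> complex" where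
  "first_kind_integrand c P z x =
     complex_of_real (poly P x * x powr c * exp (- x)) / (z - complex_of_real x)"

text \<open>With \<open>c = a\<close>, \<open>P = p n\<close> this is \<open>p\<^sub>n\<close> of the first kind;
  with \<open>c = b\<close>, \<open>P = q n\<close> it is \<open>q\<^sub>n\<close> of the first kind.\<close>

definition first_kind_aux :: "real \<Rightarrow> real poly \<Rightarrow> complex \<Rightarrow> complex" where
  "first_kind_aux c P z = (LINT x:{0<..}|lborel. first_kind_integrand c P z x)"



text \<open>The parameter lists are 0-indexed: \<open>as ! j\<close> is the mathematical \<open>a\<close> with index
  \<open>j + 1\<close>, and \<open>p = length as\<close>, \<open>q = length bs\<close>.
  Since \<^const>\<open>Gamma\<close> is 0 at its poles and division by 0 gives 0, the quotient below is also
  correct where a denominator factor has a pole, i.e. \<open>1 / Gamma\<close> is read as the entire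
  reciprocal Gamma function.\<close>

definition meijer_integrand ::
    "nat \<Rightarrow> nat \<Rightarrow> complex list \<Rightarrow> complex list \<Rightarrow> complex \<Rightarrow> complex \<Rightarrow> complex" where
  "meijer_integrand m n as bs z u =
     ((\<Prod>j<m. Gamma (bs ! j + u)) * (\<Prod>j<n. Gamma (1 - as ! j - u))) /
     ((\<Prod>j=m..<length bs. Gamma (1 - bs ! j - u)) * (\<Prod>j=n..<length as. Gamma (as ! j + u))) *
     z powr (- u)"

definition meijer_b_poles :: "nat \<Rightarrow> complex list \<Rightarrow> complex set" where
  "meijer_b_poles m bs = {u. \<exists>j<m. bs ! j + u \<in> \<int>\<^sub>\<le>\<^sub>0}"

definition meijer_a_poles :: "nat \<Rightarrow> complex list \<Rightarrow> complex set" where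
  "meijer_a_poles n as = {u. \<exists>j<n. 1 - as ! j - u \<in> \<int>\<^sub>\<le>\<^sub>0}"

text \<open>A loop from \<open>-\<infinity>\<close> to \<open>-\<infinity>\<close> is represented by a piecewise continuously differentiable
  core \<open>g\<close>. The loop comes in from \<open>-\<infinity>\<close> along the horizontal ray ending in
  \<^term>\<open>pathstart g\<close> (in the lower half-plane), follows \<open>g\<close>, and goes back to \<open>-\<infinity>\<close>
  along the horizontal ray issuing from \<^term>\<open>pathfinish g\<close> (in the upper half-plane).\<close>

definition left_ray :: "complex \<Rightarrow> complex set" where
  "left_ray c = {c - complex_of_real t | t. t \<ge> 0}"

definition loop_image :: "(real \<Rightarrow> complex) \<Rightarrow> complex set" where
  "loop_image g = left_ray (pathstart g) \<union> path_image g \<union> left_ray (pathfinish g)"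

text \<open>The loop cut off at real part \<open>-R\<close> and closed there by a vertical segment.\<close>

definition closed_loop :: "(real \<Rightarrow> complex) \<Rightarrow> real \<Rightarrow> real \<Rightarrow> complex" where
  "closed_loop g R =
     linepath (Complex (- R) (Im (pathstart g))) (pathstart g) +++ g +++
     linepath (pathfinish g) (Complex (- R) (Im (pathfinish g))) +++
     linepath (Complex (- R) (Im (pathfinish g))) (Complex (- R) (Im (pathstart g)))"

text \<open>The loop encircles a point (once, counterclockwise) if the winding number of the closed
  loop is eventually 1, and it does not encircle it if that winding number is eventually 0.\<close>

definition meijer_loop ::
    "nat \<Rightarrow> nat \<Rightarrow> complex list \<Rightarrow> complex list \<Rightarrow> (real \<Rightarrow> complex) \<Rightarrow> bool" where
  "meijer_loop m n as bs g \<longleftrightarrow>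
     valid_path g \<and> Im (pathstart g) < 0 \<and> Im (pathfinish g) > 0 \<and>
     (\<forall>w \<in> meijer_b_poles m bs. w \<notin> loop_image g \<and>
        (\<forall>\<^sub>F R in at_top. winding_number (closed_loop g R) w = 1)) \<and>
     (\<forall>w \<in> meijer_a_poles n as. w \<notin> loop_image g \<and>
        (\<forall>\<^sub>F R in at_top. winding_number (closed_loop g R) w = 0))"

definition loop_integrable :: "(real \<Rightarrow> complex) \<Rightarrow> (complex \<Rightarrow> complex) \<Rightarrow> bool" where
  "loop_integrable g f \<longleftrightarrow>
     set_integrable lborel {0..} (\<lambda>t. f (pathstart g - complex_of_real t)) \<and>
     f contour_integrable_on g \<and>
     set_integrable lborel {0..} (\<lambda>t. f (pathfinish g - complex_of_real t))"

definition loop_integral :: "(real \<Rightarrow> complex) \<Rightarrow> (complex \<Rightarrow> complex) \<Rightarrow> complex" where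
  "loop_integral g f =
     (LINT t:{0..}|lborel. f (pathstart g - complex_of_real t)) +
     contour_integral g f -
     (LINT t:{0..}|lborel. f (pathfinish g - complex_of_real t))"

text \<open>\<open>w\<close> is the value of the G-function at \<open>z\<close>: an admissible loop exists, and along every
  admissible loop the integral converges and has the value \<open>w\<close>. Such a \<open>w\<close> is unique.\<close>

definition has_meijer_G ::
    "nat \<Rightarrow> nat \<Rightarrow> complex list \<Rightarrow> complex list \<Rightarrow> complex \<Rightarrow> complex \<Rightarrow> bool" where
  "has_meijer_G m n as bs z w \<longleftrightarrow>
     length as \<le> length bs \<and> m \<le> length bs \<and> n \<le> length as \<and>
     (\<exists>g. meijer_loop m n as bs g) \<and>
     (\<forall>g. meijer_loop m n as bs g \<longrightarrow>
        loop_integrable g (meijer_integrand m n as bs z) \<and>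
        loop_integral g (meijer_integrand m n as bs z) / (2 * of_real pi * \<i>) = w)"

definition meijer_G ::
    "nat \<Rightarrow> nat \<Rightarrow> complex list \<Rightarrow> complex list \<Rightarrow> complex \<Rightarrow> complex" where
  "meijer_G m n as bs z = (THE w. has_meijer_G m n as bs z w)"

lemma meijer_G_eqI: "has_meijer_G m n as bs z w \<Longrightarrow> meijer_G m n as bs z = w"
  unfolding meijer_G_def by (rule the_equality) (auto simp: has_meijer_G_def)

end

theory Submission
  imports Defs
begin

text \<open>Put \<open>w = - z\<close>. On every admissible loop the Gamma quotients in the integrand of the
\<open>G\<close>-function collapse to \<open>(1 + b - u)\<^sub>n / (a + u)\<^sub>n\<^sub>+\<^sub>1\<close> with Pochhammer symbols, and the
integrand becomes
\<open>\<Gamma>(u) w\<^sup>-\<^sup>u (1 + b - u)\<^sub>n / (a + u)\<^sub>n\<^sub>+\<^sub>1\<close>. Expanding the rational factor into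
partial fractions (\<open>partial_fractions\<close>, \<open>meijer_integrand_eq\<close>) reduces the \<open>G\<close>-function to
the loop integrals of \<open>\<Gamma>(u) w\<^sup>-\<^sup>u / (u + c - 1)\<close> with \<open>c = a + j + 1\<close>, \<open>j \<le> n\<close>.

The same partial fractions describe \<open>p n\<close>. Since
\<open>e\<^sup>-\<^sup>s / s = \<integral>\<^sub>1\<^sup>\<infinity> e\<^sup>-\<^sup>s\<^sup>t dt\<close>, the bimoments of the Cauchy weight are
\<open>\<Gamma>(a + i + 1) \<Gamma>(b + j + 1) / (a + b + i + j + 1)\<close>: up to diagonal factors they form a Cauchy
matrix, so the biorthogonal polynomials are Jacobi polynomials on \<open>[0, 1]\<close> with rescaled
coefficients. Up to a common factor these coefficients are the residues of the rational function above,
divided by \<open>\<Gamma>(a + j + 1)\<close>, because pairing the polynomial with \<open>y\<^sup>m\<close> evaluates that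
rational function at \<open>b + m + 1\<close>, where the numerator vanishes for \<open>m < n\<close>
(\<open>pairing_cl_poly_monom\<close>, \<open>cl_poly_unique\<close>).

Both sides are therefore linear combinations over \<open>j\<close> with the same coefficients, and the
theorem follows from one identity (\<open>loop_integral_kernel\<close>), for \<open>c > 0\<close> and \<open>w\<close> off the negative axis:
the loop integral of \<open>\<Gamma>(u) w\<^sup>-\<^sup>u / (u + c - 1)\<close>, divided by \<open>2\<pi>i\<close>, equals
\<open>e\<^sup>-\<^sup>w / \<Gamma>(c) \<integral>\<^sub>0\<^sup>\<infinity> x\<^sup>c\<^sup>-\<^sup>1 e\<^sup>-\<^sup>x / (x + w) dx\<close>, which is
\<open>w\<^sup>c\<^sup>-\<^sup>1 \<Gamma>(1 - c, w)\<close>.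

For \<open>c\<close> not an integer all poles are simple, and closing the loop at abscissae
\<open>- N - 1/2\<close> turns the integral into the sum of all residues
(\<open>kernel_residue_sums\<close>): a power term and an entire series. The Stieltjes integral has the same
expansion (\<open>series_stieltjes\<close>), first for \<open>0 < c < 1\<close> and \<open>w > 0\<close>, then by analytic
continuation in \<open>w\<close> and by a recurrence in \<open>c\<close>. For integral \<open>c\<close> a pole is double;
instead of computing its residue, one lets \<open>c\<close> be a limit of nonintegers on a fixed loop, on which both
sides are continuous in \<open>c\<close>. The statement about \<open>q n\<close> follows by exchanging the roles of
\<open>x\<close> and \<open>y\<close>.\<close>

section \<open>Decay of the Gamma function to the left\<close>

text \<open>The Gamma function decays faster than every exponential to the left, as long as one keeps away from its
poles. The bound holds on a bounded part of the strip by compactness, and it propagates to the left by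
\<open>\<Gamma>(u) = \<Gamma>(u + 1) / u\<close>: once \<open>\<bar>u\<bar> \<ge> r\<close>, each unit step gains a factor \<open>1 / r\<close>.\<close>
lemma Gamma_decay_left:
  fixes r X Y d :: real
  assumes r: "r > 0" and d: "d > 0" and X: "X \<ge> 0"
  obtains C where "C \<ge> 0"
    "\<And>u::complex. Re u \<le> X \<Longrightarrow> \<bar>Im u\<bar> \<le> Y \<Longrightarrow> (\<And>k::nat. d \<le> norm (u + of_nat k)) \<Longrightarrow>
        norm (Gamma u) \<le> C * r powr (Re u)"
proof -
  \<comment> \<open>The compact part of the region, reaching one unit beyond abscissa \<open>- r\<close>.\<close>
  define S where "S = cbox (Complex (- r - 1) (- Y)) (Complex X Y) \<inter> (\<Inter>k::nat. {u. d \<le> norm (u + of_nat k)})"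
  have cS: "compact S" unfolding S_def
    by (intro compact_Int_closed compact_cbox closed_INT ballI closed_Collect_le continuous_intros)
  have notin: "u \<notin> \<int>\<^sub>\<le>\<^sub>0" if "\<And>k::nat. d \<le> norm (u + of_nat k)" for u :: complex
  proof
    assume "u \<in> \<int>\<^sub>\<le>\<^sub>0"
    then obtain k where "u = - of_nat k" by (auto elim: nonpos_Ints_cases')
    with that[of k] d show False by simp
  qed
  have "u \<notin> \<int>\<^sub>\<le>\<^sub>0" if "u \<in> S" for u
    using that by (intro notin) (simp add: S_def)
  then have "continuous_on S (\<lambda>u::complex. norm (Gamma u) / r powr (Re u))"
    using r by (intro continuous_intros) (simp_all, fast?)
  then have "compact ((\<lambda>u::complex. norm (Gamma u) / r powr (Re u)) ` S)"
    by (rule compact_continuous_image[OF _ cS])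
  then have "bounded ((\<lambda>u::complex. norm (Gamma u) / r powr (Re u)) ` S)"
    by (rule compact_imp_bounded)
  then obtain C where C0: "C > 0"
      "\<forall>y\<in>(\<lambda>u::complex. norm (Gamma u) / r powr (Re u)) ` S. norm y \<le> C"
    unfolding bounded_pos by (elim exE conjE)
  have base: "norm (Gamma u) \<le> C * r powr (Re u)" if "u \<in> S" for u
    using bspec[OF C0(2) imageI[OF that]] r by (simp add: divide_le_eq)
  have main: "norm (Gamma u) \<le> C * r powr (Re u)"
    if "Re u \<le> X" "\<bar>Im u\<bar> \<le> Y" "\<And>k::nat. d \<le> norm (u + of_nat k)" "Re u \<ge> - r - 1 - real N" for u N
    using that
  proof (induction N arbitrary: u)
    case 0
    then have "u \<in> S"
      by (auto simp: S_def in_cbox_complex_iff)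
    then show ?case by (rule base)
  next
    case (Suc N)
    show ?case
    proof (cases "Re u \<ge> - r - 1")
      case True
      with Suc.prems have "u \<in> S" by (auto simp: S_def in_cbox_complex_iff)
      then show ?thesis by (rule base)
    next
      case False
      have nu: "r \<le> norm u" using False abs_Re_le_cmod[of u] by linarith
      have IH: "norm (Gamma (u + 1)) \<le> C * r powr (Re (u + 1))"
      proof (rule Suc.IH)
        show "d \<le> norm (u + 1 + of_nat k)" for k
          using Suc.prems(3)[of "Suc k"] by (simp add: add_ac)
      qed (use Suc.prems(2,4) False r X in auto)
      have "norm u * norm (Gamma u) = norm (Gamma (u + 1))"
        using notin[OF Suc.prems(3)] by (simp add: Gamma_plus1 norm_mult)
      also have "\<dots> \<le> r * (C * r powr (Re u))"
        using IH r by (simp add: powr_add mult_ac)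
      finally have "norm u * norm (Gamma u) \<le> r * (C * r powr (Re u))" .
      moreover have "r * norm (Gamma u) \<le> norm u * norm (Gamma u)"
        by (intro mult_right_mono nu) auto
      ultimately show ?thesis
        using r by (meson mult_le_cancel_left_pos order_trans)
    qed
  qed
  show ?thesis
  proof (rule that[of C])
    fix u :: complex
    assume u: "Re u \<le> X" "\<bar>Im u\<bar> \<le> Y" "\<And>k::nat. d \<le> norm (u + of_nat k)"
    obtain N :: nat where "- r - 1 - Re u \<le> real N" using real_arch_simple by blast
    then show "norm (Gamma u) \<le> C * r powr (Re u)"
      by (intro main[OF u, of N]) auto
  qed (use C0(1) in auto)
qed

text \<open>Choosing \<open>r = e \<bar>w\<bar>\<close> in the previous lemma absorbs the growth of \<open>w\<^sup>-\<^sup>u\<close> and still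
leaves an exponential decay, which makes the integrals along the rays converge and the closing edges
negligible.\<close>
lemma kernel_decay_left:
  fixes d X Y :: real and w :: complex
  assumes w: "w \<noteq> 0" and d: "d > 0" and X: "X \<ge> 0"
  obtains C where "C \<ge> 0"
    "\<And>u::complex. Re u \<le> X \<Longrightarrow> \<bar>Im u\<bar> \<le> Y \<Longrightarrow> (\<And>k::nat. d \<le> norm (u + of_nat k)) \<Longrightarrow>
        norm (Gamma u * w powr (- u)) \<le> C * exp (Re u)"
proof -
  define r where "r = exp 1 * norm w"
  have r: "r > 0" using w by (simp add: r_def)
  obtain C where C: "C \<ge> 0"
    "\<And>u::complex. Re u \<le> X \<Longrightarrow> \<bar>Im u\<bar> \<le> Y \<Longrightarrow> (\<And>k::nat. d \<le> norm (u + of_nat k)) \<Longrightarrow>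
        norm (Gamma u) \<le> C * r powr (Re u)"
    using Gamma_decay_left[OF r d X, of Y] by blast
  show ?thesis
  proof (rule that[of "C * exp (Y * pi)"])
    fix u :: complex
    assume u: "Re u \<le> X" "\<bar>Im u\<bar> \<le> Y" "\<And>k::nat. d \<le> norm (u + of_nat k)"
    have "Im u * Arg w \<le> \<bar>Im u\<bar> * \<bar>Arg w\<bar>" by (metis abs_ge_self abs_mult)
    also have "\<dots> \<le> Y * pi"
      using u(2) Arg_bounded[of w] by (intro mult_mono) auto
    finally have arg: "exp (Im u * Arg w) \<le> exp (Y * pi)" by simp
    have "norm (Gamma u * w powr (- u)) = norm (Gamma u) * (norm w powr (- Re u) * exp (Im u * Arg w))"
      by (simp add: norm_mult norm_powr_complex)
    also have "\<dots> \<le> (C * r powr (Re u)) * (norm w powr (- Re u) * exp (Y * pi))"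
      using C(1) by (intro mult_mono C(2)[OF u] arg mult_nonneg_nonneg) auto
    also have "r powr (Re u) = exp (Re u) * norm w powr (Re u)"
      using w by (simp add: r_def powr_mult exp_powr_real)
    also have "(C * (exp (Re u) * norm w powr (Re u))) * (norm w powr (- Re u) * exp (Y * pi)) =
               C * exp (Y * pi) * exp (Re u) * (norm w powr (Re u) * norm w powr (- Re u))"
      by (simp only: mult_ac)
    also have "norm w powr (Re u) * norm w powr (- Re u) = 1"
      using w by (simp flip: powr_add)
    finally show "norm (Gamma u * w powr (- u)) \<le> C * exp (Y * pi) * exp (Re u)" by simp
  qed (use C(1) in auto)
qed

section \<open>Integrals over loops from minus infinity\<close>

lemma closed_loop_simps [simp]:
  "pathstart (closed_loop g R) = Complex (- R) (Im (pathstart g))"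
  "pathfinish (closed_loop g R) = Complex (- R) (Im (pathstart g))"
  by (simp_all add: closed_loop_def)

lemma valid_path_closed_loop [simp]: "valid_path g \<Longrightarrow> valid_path (closed_loop g R)"
  by (simp add: closed_loop_def valid_path_join)

lemma left_segment_subset_left_ray:
  assumes "- R \<le> Re c"
  shows "closed_segment (Complex (- R) (Im c)) c \<subseteq> left_ray c \<inter> {u. - R \<le> Re u}"
proof
  fix u assume "u \<in> closed_segment (Complex (- R) (Im c)) c"
  then have *: "Im u = Im c" "- R \<le> Re u" "Re u \<le> Re c"
    using assms by (auto simp: closed_segment_same_Im closed_segment_eq_real_ivl)
  then have "u = c - complex_of_real (Re c - Re u)"
    by (simp add: complex_eq_iff)
  with * show "u \<in> left_ray c \<inter> {u. - R \<le> Re u}"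
    unfolding left_ray_def by (auto intro!: exI[of _ "Re c - Re u"])
qed

text \<open>The closed loop cut off at \<open>- R\<close> lies in the half plane \<open>Re u \<ge> - R\<close> only if the cut is to
the left of the whole core; any \<open>R\<close> beyond this bound is far enough.\<close>
definition core_bound :: "(real \<Rightarrow> complex) \<Rightarrow> real" where
  "core_bound g = (SOME B. \<forall>u\<in>path_image g. - B < Re u)"

lemma core_bound:
  assumes "valid_path g" "u \<in> path_image g"
  shows "- core_bound g < Re u"
proof -
  have "bounded (path_image g)"
    using assms by (simp add: bounded_path_image valid_path_imp_path)
  then obtain B where B: "\<And>u. u \<in> path_image g \<Longrightarrow> norm u \<le> B"
    unfolding bounded_iff by blast
  have "\<forall>u\<in>path_image g. - (B + 1) < Re u"
  proof
    fix u assume "u \<in> path_image g"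
    then show "- (B + 1) < Re u" using B[of u] abs_Re_le_cmod[of u] by linarith
  qed
  then have "\<forall>u\<in>path_image g. - core_bound g < Re u"
    unfolding core_bound_def by (rule someI)
  with assms show ?thesis by blast
qed

abbreviation far_edge :: "(real \<Rightarrow> complex) \<Rightarrow> real \<Rightarrow> complex set" where
  "far_edge g R \<equiv> closed_segment (Complex (- R) (Im (pathfinish g))) (Complex (- R) (Im (pathstart g)))"

lemma path_image_closed_loop:
  assumes "valid_path g" "R \<ge> core_bound g"
  shows "path_image (closed_loop g R) \<subseteq> loop_image g \<union> far_edge g R"
    and "path_image (closed_loop g R) \<subseteq> {u. - R \<le> Re u}"
proof -
  have R: "- R \<le> Re (pathstart g)" "- R \<le> Re (pathfinish g)"
    using core_bound[OF assms(1) pathstart_in_path_image]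
      core_bound[OF assms(1) pathfinish_in_path_image] assms(2) by linarith+
  have eq: "path_image (closed_loop g R) =
      closed_segment (Complex (- R) (Im (pathstart g))) (pathstart g) \<union> path_image g \<union>
      closed_segment (Complex (- R) (Im (pathfinish g))) (pathfinish g) \<union> far_edge g R"
    by (simp add: closed_loop_def path_image_join closed_segment_commute Un_assoc)
  show "path_image (closed_loop g R) \<subseteq> loop_image g \<union> far_edge g R"
    unfolding eq loop_image_def using left_segment_subset_left_ray[OF R(1)]
      left_segment_subset_left_ray[OF R(2)] by blast
  have "path_image g \<subseteq> {u. - R \<le> Re u}"
    using core_bound[OF assms(1)] assms(2) by force
  moreover have "far_edge g R \<subseteq> {u. - R \<le> Re u}"
    by (auto simp: closed_segment_same_Re)
  ultimately show "path_image (closed_loop g R) \<subseteq> {u. - R \<le> Re u}"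
    unfolding eq using left_segment_subset_left_ray[OF R(1)]
      left_segment_subset_left_ray[OF R(2)] by blast
qed

lemma closed_loop_sides_subset:
  assumes "valid_path g"  "R \<ge> core_bound g"
  shows "closed_segment (Complex (- R) (Im (pathstart g))) (pathstart g) \<subseteq> loop_image g"
    "closed_segment (pathfinish g) (Complex (- R) (Im (pathfinish g))) \<subseteq> loop_image g"
    "path_image g \<subseteq> loop_image g"
proof -
  have R: "- R \<le> Re (pathstart g)" "- R \<le> Re (pathfinish g)"
    using core_bound[OF assms(1) pathstart_in_path_image]
      core_bound[OF assms(1) pathfinish_in_path_image] assms(2) by linarith+
  show "closed_segment (Complex (- R) (Im (pathstart g))) (pathstart g) \<subseteq> loop_image g"
    "closed_segment (pathfinish g) (Complex (- R) (Im (pathfinish g))) \<subseteq> loop_image g"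
    "path_image g \<subseteq> loop_image g"
    unfolding loop_image_def 
    using left_segment_subset_left_ray[OF R(1)] left_segment_subset_left_ray[OF R(2)] 
    by (auto simp: closed_segment_commute)
qed

lemma contour_integral_closed_loop:
  assumes g: "valid_path g" "R \<ge> core_bound g" and S: "open S" "f holomorphic_on S"
    and sub: "loop_image g \<subseteq> S" "far_edge g R \<subseteq> S"
  shows "contour_integral (closed_loop g R) f =
    contour_integral (linepath (Complex (- R) (Im (pathstart g))) (pathstart g)) f +
    contour_integral g f +
    contour_integral (linepath (pathfinish g) (Complex (- R) (Im (pathfinish g)))) f +
    contour_integral (linepath (Complex (- R) (Im (pathfinish g))) (Complex (- R) (Im (pathstart g)))) f"
proof -
  have "f contour_integrable_on h" if "valid_path h" "path_image h \<subseteq> S" for h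
    using that S by (intro contour_integrable_holomorphic_simple)
  note this [simp]
  have "path_image g \<subseteq> S" using closed_loop_sides_subset(3)[OF g] sub(1) by blast
  moreover have "closed_segment (Complex (- R) (Im (pathstart g))) (pathstart g) \<subseteq> S"
     "closed_segment (pathfinish g) (Complex (- R) (Im (pathfinish g))) \<subseteq> S"
    using closed_loop_sides_subset(1,2)[OF g] sub(1) by blast+
  ultimately show ?thesis
    using g sub(2) unfolding closed_loop_def
    by (simp add: valid_path_join path_image_join)
qed

text \<open>Moving the closing edge from \<open>- R\<close> to \<open>- R'\<close> attaches a rectangle on which \<open>1 / (u - p)\<close>
is holomorphic, since it lies to the left of \<open>p\<close>. The point of this is uniformity: an admissible loop
winds around each pole for all large \<open>R\<close>, where "large" may depend on the pole, while the residue
theorem for a single \<open>R\<close> needs the winding numbers of all enclosed poles at once.\<close>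
lemma winding_number_closed_loop_cong:
  assumes g: "valid_path g" "R \<ge> core_bound g" "R' \<ge> R" and p: "p \<notin> loop_image g" "- R < Re p"
  shows "winding_number (closed_loop g R) p = winding_number (closed_loop g R') p"
proof -
  define f where "f = (\<lambda>u. 1 / (u - p))"
  define A where "A = Complex (- R) (Im (pathstart g))"
  define A' where "A' = Complex (- R') (Im (pathstart g))"
  define B where "B = Complex (- R) (Im (pathfinish g))"
  define B' where "B' = Complex (- R') (Im (pathfinish g))"
  have g': "R' \<ge> core_bound g" using g by simp
  have R: "- R \<le> Re (pathstart g)" "- R \<le> Re (pathfinish g)"
    using core_bound[OF g(1) pathstart_in_path_image]
      core_bound[OF g(1) pathfinish_in_path_image] g(2) by linarith+
  have S: "open (- {p})" "f holomorphic_on (- {p})"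
    unfolding f_def by (auto intro!: holomorphic_intros)
  have edge: "far_edge g R \<subseteq> - {p}" "far_edge g R' \<subseteq> - {p}"
    using p g by (auto simp: closed_segment_same_Re)
  have loop: "loop_image g \<subseteq> - {p}" using p by auto
  have wn: "winding_number (closed_loop g r) p = 1 / (2 * pi * \<i>) * contour_integral (closed_loop g r) f"
    if "r \<ge> core_bound g" "far_edge g r \<subseteq> - {p}" for r
  proof -
    have "p \<notin> path_image (closed_loop g r)"
      using path_image_closed_loop(1)[OF g(1) that(1)] that(2) p by blast
    then show ?thesis using g(1) unfolding f_def
      by (subst winding_number_valid_path) simp_all
  qed
  have cont: "continuous_on T f" if "p \<notin> T" for T
    unfolding f_def using that by (intro continuous_intros) auto
  have p1: "p \<notin> closed_segment A' (pathstart g)" "p \<notin> closed_segment (pathfinish g) B'"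
    using closed_loop_sides_subset(1,2)[OF g(1) g'] loop unfolding A'_def B'_def by blast+
  have s1: "contour_integral (linepath A' (pathstart g)) f =
        contour_integral (linepath A' A) f + contour_integral (linepath A (pathstart g)) f"
    using R g(3) by (intro contour_integral_split_linepath cont p1)
       (auto simp: A_def A'_def closed_segment_same_Im closed_segment_eq_real_ivl)
  have s2: "contour_integral (linepath (pathfinish g) B') f =
        contour_integral (linepath (pathfinish g) B) f + contour_integral (linepath B B') f"
    using R g(3) by (intro contour_integral_split_linepath cont p1)
       (auto simp: B_def B'_def closed_segment_same_Im closed_segment_eq_real_ivl)
  \<comment> \<open>The rectangle between the two cuts lies in a convex domain of holomorphy.\<close>
  define H where "H = {u. Re u < Re p}"
  have H: "f holomorphic_on H" "convex H"
    unfolding f_def H_def by (auto intro!: holomorphic_intros convex_halfspace_Re_lt)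
  have in_H: "A \<in> H" "A' \<in> H" "B \<in> H" "B' \<in> H"
    using p g(3) by (auto simp: H_def A_def A'_def B_def B'_def)
  have seg: "closed_segment x y \<subseteq> H" if "x \<in> H" "y \<in> H" for x y
    using H(2) that by (simp add: closed_segment_subset)
  have int: "f contour_integrable_on linepath x y" if "x \<in> H" "y \<in> H" for x y
    using seg[OF that] by (intro contour_integrable_continuous_linepath cont) (auto simp: H_def)
  have "(f has_contour_integral 0) (linepath A' A +++ linepath A B +++ linepath B B' +++ linepath B' A')"
    using in_H seg by (intro Cauchy_theorem_convex_simple[OF H])
      (auto simp: path_image_join valid_path_join)
  then have "contour_integral (linepath A' A +++ linepath A B +++ linepath B B' +++ linepath B' A') f = 0"
    by (rule contour_integral_unique)
  then have "contour_integral (linepath A' A) f + contour_integral (linepath A B) f +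
      contour_integral (linepath B B') f + contour_integral (linepath B' A') f = 0"
    using in_H by (simp add: int valid_path_join add.assoc)
  moreover have "contour_integral (linepath A B) f = - contour_integral (linepath B A) f"
    using contour_integral_reversepath[of "linepath B A" f] by simp
  ultimately have "contour_integral (closed_loop g R) f = contour_integral (closed_loop g R') f"
    using contour_integral_closed_loop[OF g(1,2) S loop edge(1)]
      contour_integral_closed_loop[OF g(1) g' S loop edge(2)] s1 s2
    unfolding A_def [symmetric] A'_def [symmetric] B_def [symmetric] B'_def [symmetric]
    by (simp add: algebra_simps)
  then show ?thesis using wn[OF g(2) edge(1)] wn[OF g' edge(2)] by simp
qed

text \<open>The requirement that an admissible loop has to satisfy for the poles it encloses, separated from the
particular parameters of a \<open>G\<close>-function.\<close>
definition encircles :: "(real \<Rightarrow> complex) \<Rightarrow> complex set \<Rightarrow> bool" where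
  "encircles g P \<longleftrightarrow> (\<forall>p\<in>P. p \<notin> loop_image g \<and> (\<forall>\<^sub>F R in at_top. winding_number (closed_loop g R) p = 1))"

lemma encircles_winding_number:
  assumes g: "valid_path g" "R \<ge> core_bound g" and P: "encircles g P" "p \<in> P" "- R < Re p"
  shows "winding_number (closed_loop g R) p = 1"
proof -
  from P have p: "p \<notin> loop_image g" "\<forall>\<^sub>F R in at_top. winding_number (closed_loop g R) p = 1"
    by (auto simp: encircles_def)
  from p(2) obtain R0 where "\<And>R. R \<ge> R0 \<Longrightarrow> winding_number (closed_loop g R) p = 1"
    by (auto simp: eventually_at_top_linorder)
  then have "winding_number (closed_loop g (max R R0)) p = 1" by simp
  then show ?thesis using winding_number_closed_loop_cong[OF g, of "max R R0" p] p(1) P(3) by simp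
qed

text \<open>The right-hand side does not mention \<open>g\<close>, so two loops around the same poles have the same
truncated integrals. The poles in the strip just to the left of the cut belong to the domain of the residue
theorem but have winding number \<open>0\<close>.\<close>
lemma contour_integral_closed_loop_residues:
  assumes g: "valid_path g" "R \<ge> core_bound g" and P: "encircles g P"
    and f: "f holomorphic_on - P" and fin: "\<And>X. finite {p\<in>P. X < Re p}"
    and off: "\<And>p. p \<in> P \<Longrightarrow> Re p \<noteq> - R"
  shows "contour_integral (closed_loop g R) f =
           2 * pi * \<i> * (\<Sum>p\<in>{p\<in>P. - R < Re p}. residue f p)"
proof -
  define S where "S = {u. - R - 1 < Re u}"
  define pts where "pts = {p\<in>P. - R - 1 < Re p}"
  have "contour_integral (closed_loop g R) f =
      2 * pi * \<i> * (\<Sum>p\<in>pts. winding_number (closed_loop g R) p * residue f p)"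
  proof (rule Residue_theorem)
    show "open S" "connected S"
      by (auto simp: S_def open_halfspace_Re_gt intro!: convex_connected convex_halfspace_Re_gt)
    show "finite pts" using fin[of "- R - 1"] by (simp add: pts_def)
    show "f holomorphic_on S - pts"
      by (rule holomorphic_on_subset[OF f]) (auto simp: S_def pts_def)
    have "path_image (closed_loop g R) \<inter> P = {}"
      using path_image_closed_loop(1)[OF g] off P by (auto simp: encircles_def closed_segment_same_Re)
    moreover have "path_image (closed_loop g R) \<subseteq> S"
      using path_image_closed_loop(2)[OF g] by (force simp: S_def)
    ultimately show "path_image (closed_loop g R) \<subseteq> S - pts" by (auto simp: pts_def)
    show "\<forall>z. z \<notin> S \<longrightarrow> winding_number (closed_loop g R) z = 0"
    proof (intro allI impI)
      fix z assume "z \<notin> S"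
      then show "winding_number (closed_loop g R) z = 0"
        using path_image_closed_loop(2)[OF g] g(1)
        by (intro winding_number_zero_outside[of _ "{u. - R \<le> Re u}"])
          (auto simp: S_def valid_path_imp_path convex_halfspace_Re_ge)
    qed
  qed (use g in auto)
  also have "(\<Sum>p\<in>pts. winding_number (closed_loop g R) p * residue f p) =
             (\<Sum>p\<in>{p\<in>P. - R < Re p}. residue f p)"
  proof (rule sum.mono_neutral_cong_right)
    show "finite pts" using fin[of "- R - 1"] by (simp add: pts_def)
    show "\<forall>p\<in>pts - {p \<in> P. - R < Re p}. winding_number (closed_loop g R) p * residue f p = 0"
    proof
      fix p assume "p \<in> pts - {p \<in> P. - R < Re p}"
      then have "\<not> - R \<le> Re p" using off[of p] by (auto simp: pts_def)
      then have "winding_number (closed_loop g R) p = 0"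
        using path_image_closed_loop(2)[OF g] g(1)
        by (intro winding_number_zero_outside[of _ "{u. - R \<le> Re u}"])
          (auto simp: valid_path_imp_path convex_halfspace_Re_ge)
      then show "winding_number (closed_loop g R) p * residue f p = 0" by simp
    qed
  qed (auto simp: pts_def encircles_winding_number[OF g P])
  finally show ?thesis .
qed

lemma set_integrable_exp_minus: "set_integrable lborel {0..} (\<lambda>t::real. exp (- t))"
proof -
  have "(\<integral>\<^sup>+t. ennreal (exp (- t)) * indicator {0..} t \<partial>lborel) = ennreal (0 - (- exp (- 0 :: real)))"
  proof (intro nn_integral_FTC_atLeast)
    have "((\<lambda>t::real. exp (- t)) \<longlongrightarrow> 0) at_top"
      by (rule filterlim_compose[OF exp_at_bot filterlim_uminus_at_bot_at_top])
    then show "((\<lambda>t::real. - exp (- t)) \<longlongrightarrow> 0) at_top"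
      using tendsto_minus by fastforce
  qed (auto intro!: derivative_eq_intros)
  also have "(\<integral>\<^sup>+t. ennreal (exp (- t)) * indicator {0..} t \<partial>lborel) =
      (\<integral>\<^sup>+t. ennreal (norm (indicator {0..} t *\<^sub>R exp (- t :: real))) \<partial>lborel)"
    by (intro nn_integral_cong) (auto simp: indicator_def)
  finally show ?thesis
    unfolding set_integrable_def by (intro integrableI_bounded) auto
qed

lemma ray_set_integrable:
  fixes f :: "complex \<Rightarrow> complex"
  assumes cont: "continuous_on (left_ray c) f" and bd: "\<And>u. u \<in> left_ray c \<Longrightarrow> norm (f u) \<le> C * exp (Re u)"
  shows "set_integrable lborel {0..} (\<lambda>t. f (c - complex_of_real t))"
proof (rule set_integrable_bound)
  show "set_integrable lborel {0..} (\<lambda>t::real. (C * exp (Re c)) * exp (- t))"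
    by (intro set_integrable_mult_right impI set_integrable_exp_minus)
  have "continuous_on {0..} (\<lambda>t. f (c - complex_of_real t))"
    by (intro continuous_on_compose2[OF cont] continuous_intros) (auto simp: left_ray_def)
  then have "set_borel_measurable borel {0..} (\<lambda>t. f (c - complex_of_real t))"
    by (intro set_measurable_continuous_on) auto
  then show "set_borel_measurable lborel {0..} (\<lambda>t. f (c - complex_of_real t))"
    by (simp add: set_borel_measurable_def)
  have "norm (f (c - complex_of_real t)) \<le> norm (C * exp (Re c) * exp (- t))" if "t \<ge> 0" for t
  proof -
    have "norm (f (c - complex_of_real t)) \<le> C * exp (Re (c - complex_of_real t))"
      using that by (intro bd) (auto simp: left_ray_def)
    also have "\<dots> = C * exp (Re c) * exp (- t)" by (simp add: exp_diff exp_minus field_simps)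
    finally show ?thesis by (simp add: order_trans[OF _ abs_ge_self])
  qed
  then show "AE t in lborel. t \<in> {0..} \<longrightarrow> norm (f (c - complex_of_real t)) \<le> norm (C * exp (Re c) * exp (- t))"
    by auto
qed

lemma contour_integral_left_segment:
  assumes cont: "continuous_on (left_ray c) f" and R: "- R < Re c"
  shows "contour_integral (linepath (Complex (- R) (Im c)) c) f =
         (LINT t:{0..Re c + R}|lborel. f (c - complex_of_real t))"
proof -
  define T where "T = Re c + R"
  have T: "T > 0" and eq: "Complex (- R) (Im c) = c - of_real T"
    using R by (auto simp: T_def complex_eq_iff)
  have "continuous_on {0..} (\<lambda>t. f (c - complex_of_real t))"
    by (intro continuous_on_compose2[OF cont] continuous_intros) (auto simp: left_ray_def)
  then have cont': "continuous_on {0..T} (\<lambda>t. f (c - complex_of_real t))"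
    by (rule continuous_on_subset) auto
  then have "set_integrable lborel {0..T} (\<lambda>t. f (c - complex_of_real t))"
    unfolding set_integrable_def by (intro borel_integrable_compact) auto
  from set_borel_integral_eq_integral[OF this]
  have "((\<lambda>t. f (c - complex_of_real t)) has_integral (LINT t:{0..T}|lborel. f (c - complex_of_real t))) (cbox 0 T)"
    by (simp add: has_integral_iff)
  from has_integral_affinity[OF this, of "- T" T] T
  have "((\<lambda>x. f (c - complex_of_real (- T * x + T))) has_integral
          (1 / T) *\<^sub>R (LINT t:{0..T}|lborel. f (c - complex_of_real t))) ((\<lambda>x. 1 - x / T) ` {0..T})"
    by (simp add: divide_simps)
  also have "(\<lambda>x. 1 - x / T) ` {0..T} = {0..1}"
  proof (intro equalityI subsetI)
    fix y :: real assume "y \<in> {0..1}"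
    then show "y \<in> (\<lambda>x. 1 - x / T) ` {0..T}"
      using T by (intro image_eqI[of _ _ "T * (1 - y)"]) (auto simp: mult_left_le)
  qed (use T in \<open>auto simp: field_simps\<close>)
  finally have "((\<lambda>x. f (c - complex_of_real (- T * x + T)) * T) has_integral
          (1 / T) *\<^sub>R (LINT t:{0..T}|lborel. f (c - complex_of_real t)) * T) {0..1}"
    by (rule has_integral_mult_left)
  moreover have "linepath (c - of_real T) c x = c - complex_of_real (- T * x + T)" for x
    by (simp add: linepath_def algebra_simps scaleR_conv_of_real)
  ultimately have "(f has_contour_integral (LINT t:{0..T}|lborel. f (c - complex_of_real t))) (linepath (c - of_real T) c)"
    using T by (simp add: has_contour_integral_linepath scaleR_conv_of_real)
  then show ?thesis unfolding eq by (simp add: contour_integral_unique T_def)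
qed

text \<open>The cut-offs may run through any sequence tending to infinity, which leaves room for closing
the loop between consecutive poles.\<close>
lemma contour_integral_closed_loop_tendsto:
  fixes f :: "complex \<Rightarrow> complex" and R :: "nat \<Rightarrow> real"
  assumes g: "valid_path g" and S: "open S" "f holomorphic_on S"
    and sub: "loop_image g \<subseteq> S" and R: "filterlim R at_top sequentially"
    and edge: "\<And>i. far_edge g (R i) \<subseteq> S"
    and bd1: "\<And>u. u \<in> left_ray (pathstart g) \<Longrightarrow> norm (f u) \<le> C * exp (Re u)"
    and bd2: "\<And>u. u \<in> left_ray (pathfinish g) \<Longrightarrow> norm (f u) \<le> C * exp (Re u)"
    and bd3: "\<And>i u. u \<in> far_edge g (R i) \<Longrightarrow> norm (f u) \<le> C * exp (Re u)"
  shows "loop_integrable g f"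
    and "(\<lambda>i. contour_integral (closed_loop g (R i)) f) \<longlonglongrightarrow> loop_integral g f"
proof -
  have cont: "continuous_on T f" if "T \<subseteq> S" for T
    using S(2) that by (meson continuous_on_subset holomorphic_on_imp_continuous_on)
  have cont1: "continuous_on (left_ray (pathstart g)) f" "continuous_on (left_ray (pathfinish g)) f"
    using sub by (auto intro!: cont simp: loop_image_def)
  have int: "set_integrable lborel {0..} (\<lambda>t. f (pathstart g - complex_of_real t))"
    "set_integrable lborel {0..} (\<lambda>t. f (pathfinish g - complex_of_real t))"
    by (intro ray_set_integrable[OF cont1(1) bd1] ray_set_integrable[OF cont1(2) bd2]; assumption)+
  moreover have "f contour_integrable_on g"
    using g S sub by (intro contour_integrable_holomorphic_simple) (auto simp: loop_image_def)
  ultimately show "loop_integrable g f" by (simp add: loop_integrable_def)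
  have ray: "(\<lambda>i. contour_integral (linepath (Complex (- R i) (Im c)) c) f)
      \<longlonglongrightarrow> (LINT t:{0..}|lborel. f (c - complex_of_real t))"
    if "continuous_on (left_ray c) f" "set_integrable lborel {0..} (\<lambda>t. f (c - complex_of_real t))" for c
  proof (rule Lim_transform_eventually)
    have "filterlim (\<lambda>i. Re c + R i) at_top sequentially"
      using filterlim_tendsto_add_at_top[OF tendsto_const R] .
    moreover have "((\<lambda>b. LINT t:{0..b}|lborel. f (c - complex_of_real t))
        \<longlongrightarrow> (LINT t:{0..}|lborel. f (c - complex_of_real t))) at_top"
      by (rule tendsto_set_lebesgue_integral_at_top[OF _ that(2)]) auto
    ultimately show "(\<lambda>i. LINT t:{0..Re c + R i}|lborel. f (c - complex_of_real t))
        \<longlonglongrightarrow> (LINT t:{0..}|lborel. f (c - complex_of_real t))"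
      by (rule filterlim_compose[rotated])
    have "\<forall>\<^sub>F i in sequentially. R i > - Re c"
      using R by (simp add: filterlim_at_top_dense)
    then show "\<forall>\<^sub>F i in sequentially. (LINT t:{0..Re c + R i}|lborel. f (c - complex_of_real t)) =
        contour_integral (linepath (Complex (- R i) (Im c)) c) f"
      by eventually_elim (simp add: contour_integral_left_segment[OF that(1)])
  qed
  have "(\<lambda>i. contour_integral (linepath (Complex (- R i) (Im (pathfinish g)))
            (Complex (- R i) (Im (pathstart g)))) f) \<longlonglongrightarrow> 0"
  proof (rule Lim_null_comparison)
    have "C * exp (Re (pathstart g)) \<ge> 0"
      using bd1[of "pathstart g"] by (force simp: left_ray_def intro: order_trans[OF norm_ge_zero])
    then have C: "C \<ge> 0" by (simp add: zero_le_mult_iff)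
    show "\<forall>\<^sub>F i in sequentially. norm (contour_integral (linepath (Complex (- R i) (Im (pathfinish g)))
            (Complex (- R i) (Im (pathstart g)))) f) \<le>
          C * exp (- R i) * norm (Complex 0 (Im (pathstart g)) - Complex 0 (Im (pathfinish g)))"
    proof (intro always_eventually allI)
      fix i
      have "norm (contour_integral (linepath (Complex (- R i) (Im (pathfinish g)))
              (Complex (- R i) (Im (pathstart g)))) f) \<le>
            C * exp (- R i) * norm (Complex (- R i) (Im (pathstart g)) - Complex (- R i) (Im (pathfinish g)))"
      proof (rule contour_integral_bound_linepath)
        show "f contour_integrable_on linepath (Complex (- R i) (Im (pathfinish g))) (Complex (- R i) (Im (pathstart g)))"
          by (intro contour_integrable_continuous_linepath cont edge)
        show "norm (f x) \<le> C * exp (- R i)" if "x \<in> far_edge g (R i)" for x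
          using bd3[OF that] that by (simp add: closed_segment_same_Re)
      qed (use C in auto)
      then show "norm (contour_integral (linepath (Complex (- R i) (Im (pathfinish g)))
            (Complex (- R i) (Im (pathstart g)))) f) \<le>
          C * exp (- R i) * norm (Complex 0 (Im (pathstart g)) - Complex 0 (Im (pathfinish g)))"
        by (simp add: complex_diff)
    qed
    have "(\<lambda>i. exp (- R i)) \<longlonglongrightarrow> 0"
      using R by (intro filterlim_compose[OF exp_at_bot]) (simp add: filterlim_uminus_at_bot)
    then show "(\<lambda>i. C * exp (- R i) * norm (Complex 0 (Im (pathstart g)) - Complex 0 (Im (pathfinish g)))) \<longlonglongrightarrow> 0"
      by (intro tendsto_mult_left_zero tendsto_mult_right_zero)
  qed
  with ray[OF cont1(1) int(1)] ray[OF cont1(2) int(2)]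
  have "(\<lambda>i. contour_integral (linepath (Complex (- R i) (Im (pathstart g))) (pathstart g)) f +
      contour_integral g f -
      contour_integral (linepath (Complex (- R i) (Im (pathfinish g))) (pathfinish g)) f +
      contour_integral (linepath (Complex (- R i) (Im (pathfinish g))) (Complex (- R i) (Im (pathstart g)))) f)
      \<longlonglongrightarrow> loop_integral g f + 0"
    unfolding loop_integral_def by (intro tendsto_intros)
  then have lim: "(\<lambda>i. contour_integral (linepath (Complex (- R i) (Im (pathstart g))) (pathstart g)) f +
      contour_integral g f -
      contour_integral (linepath (Complex (- R i) (Im (pathfinish g))) (pathfinish g)) f +
      contour_integral (linepath (Complex (- R i) (Im (pathfinish g))) (Complex (- R i) (Im (pathstart g)))) f)
      \<longlonglongrightarrow> loop_integral g f" by simp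
  show "(\<lambda>i. contour_integral (closed_loop g (R i)) f) \<longlonglongrightarrow> loop_integral g f"
  proof (rule Lim_transform_eventually[OF lim])
    have "\<forall>\<^sub>F i in sequentially. R i \<ge> core_bound g"
      using R by (simp add: filterlim_at_top)
    then show "\<forall>\<^sub>F i in sequentially. contour_integral (linepath (Complex (- R i) (Im (pathstart g))) (pathstart g)) f +
      contour_integral g f -
      contour_integral (linepath (Complex (- R i) (Im (pathfinish g))) (pathfinish g)) f +
      contour_integral (linepath (Complex (- R i) (Im (pathfinish g))) (Complex (- R i) (Im (pathstart g)))) f =
      contour_integral (closed_loop g (R i)) f"
    proof eventually_elim
      case (elim i)
      have "contour_integral (linepath (pathfinish g) (Complex (- R i) (Im (pathfinish g)))) f =
          - contour_integral (linepath (Complex (- R i) (Im (pathfinish g))) (pathfinish g)) f"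
        using contour_integral_reversepath[of "linepath (Complex (- R i) (Im (pathfinish g))) (pathfinish g)" f]
        by simp
      then show ?case
        by (simp add: contour_integral_closed_loop[OF g elim S sub edge])
    qed
  qed
qed

section \<open>Residues of the integrand with one shifted pole\<close>

text \<open>One partial fraction of the integrand of the \<open>G\<close>-function. The pole at \<open>1 - c\<close> is
simple unless \<open>c\<close> is a positive integer; then it coincides with a pole of \<open>\<Gamma>\<close>.\<close>
definition kernel :: "complex \<Rightarrow> real \<Rightarrow> complex \<Rightarrow> complex" where
  "kernel w c u = Gamma u * w powr (- u) / (u + of_real c - 1)"

definition kernel_poles :: "real \<Rightarrow> complex set" where
  "kernel_poles c = \<int>\<^sub>\<le>\<^sub>0 \<union> {1 - of_real c}"

lemma kernel_holomorphic [holomorphic_intros]: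
  "w \<noteq> 0 \<Longrightarrow> kernel w c holomorphic_on - kernel_poles c"
  unfolding kernel_def [abs_def] kernel_poles_def
  by (auto intro!: holomorphic_intros simp: algebra_simps)

lemma closed_kernel_poles_minus: "closed (kernel_poles c - T)"
proof -
  have "kernel_poles c - T = (\<int>\<^sub>\<le>\<^sub>0 - T) \<union> ({1 - of_real c} - T)"
    by (auto simp: kernel_poles_def)
  moreover have "closed (\<int>\<^sub>\<le>\<^sub>0 - T :: complex set)"
    by (rule closed_subset_Ints) auto
  ultimately show ?thesis by (simp add: closed_Un finite_imp_closed)
qed

lemma kernel_poles_halfplane:
  assumes "c \<le> real N"
  shows "{p\<in>kernel_poles c. - (real N + 1 / 2) < Re p} = insert (1 - of_real c) ((\<lambda>k. - of_nat k) ` {..N})"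
proof (intro equalityI subsetI)
  fix p assume p: "p \<in> {p\<in>kernel_poles c. - (real N + 1 / 2) < Re p}"
  show "p \<in> insert (1 - of_real c) ((\<lambda>k. - of_nat k) ` {..N})"
  proof (cases "p \<in> \<int>\<^sub>\<le>\<^sub>0")
    case True
    then obtain k where k: "p = - of_nat k" by (auto elim: nonpos_Ints_cases')
    with p have "real k < real N + 1 / 2" by simp
    then have "k \<le> N" by linarith
    with k show ?thesis by auto
  qed (use p in \<open>auto simp: kernel_poles_def\<close>)
next
  fix p :: complex assume "p \<in> insert (1 - of_real c) ((\<lambda>k. - of_nat k) ` {..N})"
  then show "p \<in> {p\<in>kernel_poles c. - (real N + 1 / 2) < Re p}"
    using assms by (auto simp: kernel_poles_def)
qed

lemma finite_kernel_poles_halfplane: "finite {p\<in>kernel_poles c. X < Re p}"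
proof -
  obtain N where N: "max c (- X) \<le> real N" using real_arch_simple by blast
  have "{p\<in>kernel_poles c. X < Re p} \<subseteq> {p\<in>kernel_poles c. - (real N + 1 / 2) < Re p}"
    using N by auto
  moreover have "finite \<dots>" using N by (subst kernel_poles_halfplane) auto
  ultimately show ?thesis by (rule finite_subset)
qed

definition hankel_loop :: "(real \<Rightarrow> complex) \<Rightarrow> bool" where
  "hankel_loop g \<longleftrightarrow> valid_path g \<and> Im (pathstart g) < 0 \<and> Im (pathfinish g) > 0"

text \<open>The loop is closed at \<open>- (i + N) - 1/2\<close>, at distance at least \<open>1/2\<close> from all poles:
\<open>c \<le> N\<close> ensures that \<open>1 - c\<close> is already enclosed. On the rays the distance
to the poles is at least the height of the ray.\<close>
lemma kernel_loop:
  assumes g: "hankel_loop g" and P: "encircles g (kernel_poles c)" and w: "w \<noteq> 0" and N: "c \<le> real N"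
  shows "loop_integrable g (kernel w c)"
    and "(\<lambda>i. 2 * pi * \<i> * (\<Sum>p\<in>insert (1 - of_real c) ((\<lambda>k. - of_nat k) ` {..i + N}). residue (kernel w c) p))
           \<longlonglongrightarrow> loop_integral g (kernel w c)"
proof -
  define X where "X = max 0 (max (Re (pathstart g)) (Re (pathfinish g)))"
  define Y where "Y = max \<bar>Im (pathstart g)\<bar> \<bar>Im (pathfinish g)\<bar>"
  define d where "d = min (1 / 2) (min \<bar>Im (pathstart g)\<bar> \<bar>Im (pathfinish g)\<bar>)"
  define R where "R = (\<lambda>i. real (i + N) + 1 / 2)"
  have d: "d > 0" and X: "X \<ge> 0" using g by (auto simp: d_def X_def hankel_loop_def)
  obtain C where C: "C \<ge> 0"
    "\<And>u::complex. Re u \<le> X \<Longrightarrow> \<bar>Im u\<bar> \<le> Y \<Longrightarrow> (\<And>k::nat. d \<le> norm (u + of_nat k)) \<Longrightarrow>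
        norm (Gamma u * w powr (- u)) \<le> C * exp (Re u)"
    using kernel_decay_left[OF w d X, of Y] by blast
  have bd: "norm (kernel w c u) \<le> C / d * exp (Re u)"
    if "Re u \<le> X" "\<bar>Im u\<bar> \<le> Y" "\<And>k::nat. d \<le> norm (u + of_nat k)" "d \<le> norm (u + of_real c - 1)" for u
  proof -
    have "norm (kernel w c u) = norm (Gamma u * w powr (- u)) / norm (u + of_real c - 1)"
      by (simp add: kernel_def norm_divide)
    also have "\<dots> \<le> C * exp (Re u) / d"
      using d that(4) by (intro frac_le C(2)[OF that(1-3)] mult_nonneg_nonneg C(1)) auto
    finally show ?thesis by simp
  qed
  have im: "d \<le> norm (u + of_nat k)" "d \<le> norm (u + of_real c - 1)"
    if "d \<le> \<bar>Im u\<bar>" for u and k :: nat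
    using that abs_Im_le_cmod[of "u + of_nat k"] abs_Im_le_cmod[of "u + of_real c - 1"] by simp_all
  have bd1: "norm (kernel w c u) \<le> C / d * exp (Re u)" if "u \<in> left_ray (pathstart g)" for u
    using that by (intro bd im) (auto simp: left_ray_def X_def Y_def d_def)
  have bd2: "norm (kernel w c u) \<le> C / d * exp (Re u)" if "u \<in> left_ray (pathfinish g)" for u
    using that by (intro bd im) (auto simp: left_ray_def X_def Y_def d_def)
  have edge: "Re u = - R i \<and> \<bar>Im u\<bar> \<le> Y \<and> (\<forall>k. 1 / 2 \<le> norm (u + of_nat k)) \<and> 1 / 2 \<le> norm (u + of_real c - 1)"
    if "u \<in> far_edge g (R i)" for u i
  proof (intro conjI allI)
    show re: "Re u = - R i" using that by (auto simp: closed_segment_same_Re)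
    have "Im u \<in> closed_segment (Im (pathfinish g)) (Im (pathstart g))"
      using that by (auto simp: closed_segment_same_Re)
    then show "\<bar>Im u\<bar> \<le> Y" using g
      by (auto simp: Y_def closed_segment_eq_real_ivl hankel_loop_def split: if_splits)
    show "1 / 2 \<le> norm (u + of_nat k)" for k
    proof -
      have "1 / 2 \<le> \<bar>real k - real (i + N) - 1 / 2\<bar>"
        by (cases "k \<le> i + N") (auto simp: not_le Suc_le_eq [symmetric] simp flip: of_nat_Suc)
      also have "\<dots> = \<bar>Re (u + of_nat k)\<bar>" by (simp add: re R_def)
      finally show ?thesis using abs_Re_le_cmod[of "u + of_nat k"] by linarith
    qed
    show "1 / 2 \<le> norm (u + of_real c - 1)"
      using abs_Re_le_cmod[of "u + of_real c - 1"] N by (simp add: re R_def)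
  qed
  have bd3: "norm (kernel w c u) \<le> C / d * exp (Re u)" if "u \<in> far_edge g (R i)" for u i
  proof (rule bd)
    have "d \<le> 1 / 2" by (simp add: d_def)
    then show "d \<le> norm (u + of_nat k)" "d \<le> norm (u + of_real c - 1)" for k
      using edge[OF that] by (meson order_trans)+
    show "Re u \<le> X" using edge[OF that] X by (simp add: R_def)
    show "\<bar>Im u\<bar> \<le> Y" using edge[OF that] by simp
  qed
  have notin: "u \<notin> kernel_poles c" if "u \<in> far_edge g (R i)" for u i
  proof
    assume "u \<in> kernel_poles c"
    then consider k where "u = - of_nat k" | "u = 1 - of_real c"
      by (auto simp: kernel_poles_def elim: nonpos_Ints_cases')
    then show False
    proof cases
      case (1 k)
      have "1 / 2 \<le> norm (u + of_nat k)" using edge[OF that] by blast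
      with 1 show False by simp
    next
      case 2
      have "1 / 2 \<le> norm (u + of_real c - 1)" using edge[OF that] by blast
      with 2 show False by simp
    qed
  qed
  have R: "filterlim R at_top sequentially"
  proof -
    have "filterlim (\<lambda>i. (real N + 1 / 2) + real i) at_top sequentially"
      by (rule filterlim_tendsto_add_at_top[OF tendsto_const filterlim_real_sequentially])
    then show ?thesis by (simp add: R_def algebra_simps)
  qed
  have g': "valid_path g" using g by (simp add: hankel_loop_def)
  have hol: "kernel w c holomorphic_on - kernel_poles c" using w by (rule kernel_holomorphic)
  have loop: "loop_image g \<subseteq> - kernel_poles c" using P by (auto simp: encircles_def)
  have edge': "far_edge g (R i) \<subseteq> - kernel_poles c" for i using notin by blast
  have op: "open (- kernel_poles c)" using closed_kernel_poles_minus[of c "{}"] by (simp add: open_Compl)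
  note * = contour_integral_closed_loop_tendsto[OF g' op hol loop R edge' bd1 bd2 bd3]
  show "loop_integrable g (kernel w c)" by (rule *(1))
  show "(\<lambda>i. 2 * pi * \<i> * (\<Sum>p\<in>insert (1 - of_real c) ((\<lambda>k. - of_nat k) ` {..i + N}). residue (kernel w c) p))
           \<longlonglongrightarrow> loop_integral g (kernel w c)"
  proof (rule Lim_transform_eventually[OF *(2)])
    have "\<forall>\<^sub>F i in sequentially. R i \<ge> core_bound g"
      using R by (simp add: filterlim_at_top)
    then show "\<forall>\<^sub>F i in sequentially. contour_integral (closed_loop g (R i)) (kernel w c) =
       2 * pi * \<i> * (\<Sum>p\<in>insert (1 - of_real c) ((\<lambda>k. - of_nat k) ` {..i + N}). residue (kernel w c) p)"
    proof eventually_elim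
      case (elim i)
      have "Re p \<noteq> - R i" if "p \<in> kernel_poles c" for p
      proof -
        have "1 / 2 \<le> \<bar>real k - real (i + N) - 1 / 2\<bar>" for k
          by (cases "k \<le> i + N") (auto simp: not_le Suc_le_eq [symmetric] simp flip: of_nat_Suc)
        then have "real k \<noteq> R i" for k
          by (smt (verit) R_def field_sum_of_halves)
        then have "- real k \<noteq> - R i" for k by (simp only: neg_equal_iff_equal not_False_eq_True)
        moreover have "1 - c \<noteq> - R i" using N by (simp add: R_def)
        ultimately show ?thesis using that
          by (auto simp: kernel_poles_def elim!: nonpos_Ints_cases')
      qed
      from contour_integral_closed_loop_residues[OF g' elim P hol finite_kernel_poles_halfplane this]
      show ?case using kernel_poles_halfplane[of c "i + N"] N by (simp add: R_def)
    qed
  qed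
qed

lemma loop_integral_kernel_cong:
  assumes "hankel_loop g" "encircles g (kernel_poles c)" "hankel_loop h" "encircles h (kernel_poles c)" "w \<noteq> 0"
  shows "loop_integral g (kernel w c) = loop_integral h (kernel w c)"
proof -
  obtain N where "c \<le> real N" using real_arch_simple by blast
  then show ?thesis
    using LIMSEQ_unique[OF kernel_loop(2)[OF assms(1,2,5)] kernel_loop(2)[OF assms(3,4,5)]] by blast
qed

lemma tendsto_powr_right:
  fixes w :: complex
  assumes "w \<noteq> 0" "(f \<longlongrightarrow> p) F"
  shows "((\<lambda>u. w powr f u) \<longlongrightarrow> w powr p) F"
  unfolding powr_def using assms by (auto intro!: tendsto_intros)

lemma residue_kernel_nonpos_Int:
  assumes c: "of_real c \<noteq> (1 + of_nat k :: complex)" and w: "w \<noteq> 0"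
  shows "residue (kernel w c) (- of_nat k) = (- w) ^ k / (fact k * (of_real c - 1 - of_nat k))"
proof (rule residue_simple')
  let ?S = "- (kernel_poles c - {- of_nat k})"
  show "open ?S" using closed_kernel_poles_minus by (rule open_Compl)
  show "- of_nat k \<in> ?S" by simp
  show "kernel w c holomorphic_on ?S - {- of_nat k}"
    by (rule holomorphic_on_subset[OF kernel_holomorphic[OF w]]) auto
  have "((\<lambda>u. Gamma u * (u + of_nat k) * (w powr (- u) / (u + of_real c - 1))) \<longlongrightarrow>
      (- 1) ^ k / fact k * (w powr (- (- of_nat k)) / (- of_nat k + of_real c - 1))) (at (- of_nat k))"
    using c w by (intro tendsto_intros tendsto_powr_right Gamma_residues) (auto simp: algebra_simps)
  also have "(- 1) ^ k / fact k * (w powr (- (- of_nat k)) / (- of_nat k + of_real c - 1)) =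
      (- w) ^ k / (fact k * (of_real c - 1 - of_nat k))"
    using w by (simp add: powr_nat power_minus[of w] algebra_simps)
  finally show "((\<lambda>u. kernel w c u * (u - - of_nat k)) \<longlongrightarrow>
      (- w) ^ k / (fact k * (of_real c - 1 - of_nat k))) (at (- of_nat k))"
    by (simp add: kernel_def mult_ac)
qed

lemma residue_kernel_shifted:
  assumes c: "1 - of_real c \<notin> (\<int>\<^sub>\<le>\<^sub>0 :: complex set)" and w: "w \<noteq> 0"
  shows "residue (kernel w c) (1 - of_real c) = Gamma (1 - of_real c) * w powr (of_real c - 1)"
proof -
  have "residue (\<lambda>u. (Gamma u * w powr (- u)) / (u - (1 - of_real c))) (1 - of_real c) =
      Gamma (1 - of_real c) * w powr (- (1 - of_real c))"
    by (rule residue_simple[of "- \<int>\<^sub>\<le>\<^sub>0"]) (use c w in \<open>auto intro!: holomorphic_intros\<close>)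
  then show ?thesis by (simp add: kernel_def [abs_def] algebra_simps)
qed

text \<open>For \<open>c\<close> not an integer every pole is simple; the residue at \<open>1 - c\<close> is separated from
those of \<open>\<Gamma>\<close>, which form a series with infinite radius of convergence.\<close>
lemma kernel_residue_sums:
  assumes g: "hankel_loop g" and P: "encircles g (kernel_poles c)" and w: "w \<noteq> 0"
    and c: "c \<notin> \<int>"
  shows "(\<lambda>k. (- w) ^ k / (fact k * (of_real c - 1 - of_nat k))) sums
    (loop_integral g (kernel w c) / (2 * pi * \<i>) - Gamma (1 - of_real c) * w powr (of_real c - 1))"
proof -
  obtain N where N: "c \<le> real N" using real_arch_simple by blast
  have c1: "of_real c \<noteq> (1 + of_nat k :: complex)" for k
  proof
    assume "of_real c = (1 + of_nat k :: complex)"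
    then have "complex_of_real c = complex_of_real (1 + real k)" by simp
    then have "c = 1 + real k" by (simp only: of_real_eq_iff)
    with c show False by auto
  qed
  have c2: "1 - of_real c \<notin> (\<int>\<^sub>\<le>\<^sub>0 :: complex set)"
  proof
    assume "1 - of_real c \<in> (\<int>\<^sub>\<le>\<^sub>0 :: complex set)"
    then obtain k where "1 - of_real c = (- of_nat k :: complex)" by (auto elim: nonpos_Ints_cases')
    with c1[of k] show False by (simp add: algebra_simps)
  qed
  define a where "a = (\<lambda>k. (- w) ^ k / (fact k * (of_real c - 1 - of_nat k)))"
  have "(\<Sum>p\<in>insert (1 - of_real c) ((\<lambda>k. - of_nat k) ` {..i}). residue (kernel w c) p) =
      Gamma (1 - of_real c) * w powr (of_real c - 1) + (\<Sum>k\<le>i. a k)" for i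
  proof (subst sum.insert)
    show "1 - complex_of_real c \<notin> (\<lambda>k. - of_nat k) ` {..i}" using c2 by auto
    show "residue (kernel w c) (1 - of_real c) + (\<Sum>p\<in>(\<lambda>k. - of_nat k) ` {..i}. residue (kernel w c) p) =
      Gamma (1 - of_real c) * w powr (of_real c - 1) + (\<Sum>k\<le>i. a k)"
      by (subst sum.reindex)
        (auto simp: inj_on_def a_def residue_kernel_shifted[OF c2 w] residue_kernel_nonpos_Int[OF c1 w])
  qed auto
  with kernel_loop(2)[OF g P w N]
  have "(\<lambda>i. (2 * pi * \<i> * (Gamma (1 - of_real c) * w powr (of_real c - 1) + (\<Sum>k\<le>i + N. a k))) / (2 * pi * \<i>)
      - Gamma (1 - of_real c) * w powr (of_real c - 1)) \<longlonglongrightarrow>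
      loop_integral g (kernel w c) / (2 * pi * \<i>) - Gamma (1 - of_real c) * w powr (of_real c - 1)"
    by (intro tendsto_intros) simp_all
  then have "(\<lambda>i. (\<Sum>k\<le>i + N. a k)) \<longlonglongrightarrow>
      loop_integral g (kernel w c) / (2 * pi * \<i>) - Gamma (1 - of_real c) * w powr (of_real c - 1)"
    by simp
  then have "(\<lambda>i. (\<Sum>k\<le>i. a k)) \<longlonglongrightarrow>
      loop_integral g (kernel w c) / (2 * pi * \<i>) - Gamma (1 - of_real c) * w powr (of_real c - 1)"
    by (rule LIMSEQ_offset)
  then show ?thesis unfolding a_def sums_def_le .
qed

section \<open>Gamma and Stieltjes integrals\<close>

lemma nn_integral_powr_exp:
  fixes c t :: real
  assumes c: "c > 0" and t: "t > 0"
  shows "(\<integral>\<^sup>+x. ennreal (x powr (c - 1) * exp (- t * x)) * indicator {0<..} x \<partial>lborel) =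
         ennreal (Gamma c * t powr (- c))"
proof -
  have "(\<integral>\<^sup>+x. ennreal (x powr (c - 1) * exp (- t * x)) * indicator {0<..} x \<partial>lborel) =
     ennreal (1 / t) * (\<integral>\<^sup>+x. ennreal ((0 + (1/t) * x) powr (c - 1) * exp (- t * (0 + (1/t) * x))) * indicator {0<..} (0 + (1/t) * x) \<partial>lborel)"
    using t by (subst nn_integral_real_affine[of _ "1 / t" 0]) auto
  also have "(\<integral>\<^sup>+x. ennreal ((0 + (1/t) * x) powr (c - 1) * exp (- t * (0 + (1/t) * x))) * indicator {0<..} (0 + (1/t) * x) \<partial>lborel) =
     (\<integral>\<^sup>+x. ennreal (t powr (1 - c)) * ennreal (indicator {0..} x * x powr (c - 1) / exp x) \<partial>lborel)"
  proof (intro nn_integral_cong)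
    fix x :: real
    have "((1/t) * x) powr (c - 1) = t powr (1 - c) * x powr (c - 1)" if "x > 0"
      using that t by (simp add: powr_divide powr_diff field_simps)
    then show "ennreal ((0 + (1/t) * x) powr (c - 1) * exp (- t * (0 + (1/t) * x))) * indicator {0<..} (0 + (1/t) * x) =
         ennreal (t powr (1 - c)) * ennreal (indicator {0..} x * x powr (c - 1) / exp x)"
      using t by (cases "x > 0"; cases "x = 0") (simp_all add: indicator_def exp_minus field_simps flip: ennreal_mult'')
  qed
  also have "\<dots> = ennreal (t powr (1 - c)) * ennreal (Gamma c)"
    using Gamma_conv_nn_integral_real[OF c] by (subst nn_integral_cmult) auto
  also have "ennreal (1 / t) * (ennreal (t powr (1 - c)) * ennreal (Gamma c)) = ennreal (Gamma c * t powr (- c))"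
  proof -
    have "1 / t * (t powr (1 - c) * Gamma c) = Gamma c * t powr (- c)"
      using t by (simp add: powr_diff powr_minus field_simps)
    then show ?thesis using t c
      by (simp add: Gamma_real_nonneg flip: ennreal_mult')
  qed
  finally show ?thesis .
qed

lemma nn_integral_exp_tail:
  fixes s :: real
  assumes s: "s > 0"
  shows "(\<integral>\<^sup>+t. ennreal (exp (- t * s)) * indicator {1..} t \<partial>lborel) = ennreal (exp (- s) / s)"
proof -
  have "(\<integral>\<^sup>+t. ennreal (exp (- t * s)) * indicator {1..} t \<partial>lborel) = ennreal (0 - (- exp (- 1 * s) / s))"
  proof (intro nn_integral_FTC_atLeast)
    have "((\<lambda>t::real. exp (- (t * s))) \<longlongrightarrow> 0) at_top"
      using s by (intro filterlim_compose[OF exp_at_bot] filterlim_compose[OF filterlim_uminus_at_bot_at_top]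
         filterlim_at_top_mult_tendsto_pos[OF tendsto_const] filterlim_ident)
    then have "((\<lambda>t::real. - exp (- (t * s)) / s) \<longlongrightarrow> - 0 / s) at_top"
      using s by (intro tendsto_intros) auto
    then show "((\<lambda>t::real. - exp (- t * s) / s) \<longlongrightarrow> 0) at_top" by simp
  qed (use s in \<open>auto intro!: derivative_eq_intros\<close>)
  then show ?thesis by simp
qed

text \<open>Tonelli's theorem after writing the denominator as
\<open>e\<^sup>-\<^sup>(\<^sup>x\<^sup>+\<^sup>w\<^sup>) / (x + w) = \<integral>\<^sub>1\<^sup>\<infinity> e\<^sup>-\<^sup>(\<^sup>x\<^sup>+\<^sup>w\<^sup>)\<^sup>t dt\<close>; the inner integral is then a
Gamma integral. This serves both the Stieltjes integral at \<open>w > 0\<close> and, with \<open>w\<close> as the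
second integration variable, the bimoments.\<close>
lemma nn_integral_stieltjes:
  fixes c w :: real
  assumes c: "c > 0" and w: "w > 0"
  shows "(\<integral>\<^sup>+x. ennreal (x powr (c - 1) * exp (- x - w) / (x + w)) * indicator {0<..} x \<partial>lborel) =
         ennreal (Gamma c) * (\<integral>\<^sup>+t. ennreal (t powr (- c) * exp (- t * w)) * indicator {1..} t \<partial>lborel)"
proof -
  have "(\<integral>\<^sup>+x. ennreal (x powr (c - 1) * exp (- x - w) / (x + w)) * indicator {0<..} x \<partial>lborel) =
     (\<integral>\<^sup>+x. (\<integral>\<^sup>+t. ennreal (x powr (c - 1)) * indicator {0<..} x * (ennreal (exp (- t * (x + w))) * indicator {1..} t) \<partial>lborel) \<partial>lborel)"
  proof (intro nn_integral_cong)
    fix x :: real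
    show "ennreal (x powr (c - 1) * exp (- x - w) / (x + w)) * indicator {0<..} x =
      (\<integral>\<^sup>+t. ennreal (x powr (c - 1)) * indicator {0<..} x * (ennreal (exp (- t * (x + w))) * indicator {1..} t) \<partial>lborel)"
    proof (cases "x > 0")
      case True
      then have "(\<integral>\<^sup>+t. ennreal (exp (- t * (x + w))) * indicator {1..} t \<partial>lborel) = ennreal (exp (- (x + w)) / (x + w))"
        using w by (intro nn_integral_exp_tail) simp
      with True w show ?thesis
        by (subst nn_integral_cmult) (simp_all flip: ennreal_mult')
    qed simp
  qed
  also have "\<dots> = (\<integral>\<^sup>+t. (\<integral>\<^sup>+x. ennreal (x powr (c - 1)) * indicator {0<..} x * (ennreal (exp (- t * (x + w))) * indicator {1..} t) \<partial>lborel) \<partial>lborel)"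
    by (rule lborel_pair.Fubini') (simp add: split_beta)
  also have "\<dots> = (\<integral>\<^sup>+t. ennreal (Gamma c) * (ennreal (t powr (- c) * exp (- t * w)) * indicator {1..} t) \<partial>lborel)"
  proof (intro nn_integral_cong)
    fix t :: real
    show "(\<integral>\<^sup>+x. ennreal (x powr (c - 1)) * indicator {0<..} x * (ennreal (exp (- t * (x + w))) * indicator {1..} t) \<partial>lborel) =
      ennreal (Gamma c) * (ennreal (t powr (- c) * exp (- t * w)) * indicator {1..} t)"
    proof (cases "t \<ge> 1")
      case True
      have "(\<integral>\<^sup>+x. ennreal (x powr (c - 1)) * indicator {0<..} x * (ennreal (exp (- t * (x + w))) * indicator {1..} t) \<partial>lborel) =
        (\<integral>\<^sup>+x. ennreal (exp (- t * w)) * (ennreal (x powr (c - 1) * exp (- t * x)) * indicator {0<..} x) \<partial>lborel)"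
      proof (intro nn_integral_cong)
        fix x :: real
        have "exp (- t * (x + w)) = exp (- t * w) * exp (- t * x)"
          by (simp add: algebra_simps flip: exp_add)
        then show "ennreal (x powr (c - 1)) * indicator {0<..} x * (ennreal (exp (- t * (x + w))) * indicator {1..} t) =
          ennreal (exp (- t * w)) * (ennreal (x powr (c - 1) * exp (- t * x)) * indicator {0<..} x)"
          using True by (auto simp: indicator_def mult_ac simp flip: ennreal_mult')
      qed
      also have "\<dots> = ennreal (exp (- t * w)) * ennreal (Gamma c * t powr (- c))"
        using nn_integral_powr_exp[OF c, of t] True by (subst nn_integral_cmult) auto
      finally show ?thesis using True c
        by (simp add: Gamma_real_nonneg mult_ac flip: ennreal_mult')
    qed simp
  qed
  also have "\<dots> = ennreal (Gamma c) * (\<integral>\<^sup>+t. ennreal (t powr (- c) * exp (- t * w)) * indicator {1..} t \<partial>lborel)"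
    by (subst nn_integral_cmult) auto
  finally show ?thesis .
qed

text \<open>The same device decouples the two variables completely: for fixed \<open>t\<close> both integrals are Gamma
integrals, and \<open>t\<^sup>-\<^sup>A\<^sup>-\<^sup>B\<close> integrates over \<open>t \<ge> 1\<close> to \<open>1 / (A + B - 1)\<close>.\<close>
lemma nn_integral_bimoment:
  fixes A B :: real
  assumes A: "A > 0" and B: "B > 0" and AB: "A + B > 1"
  shows "(\<integral>\<^sup>+x. (\<integral>\<^sup>+y. ennreal (x powr (A - 1) * y powr (B - 1) * exp (- x - y) / (x + y)) * indicator {0<..} y \<partial>lborel) * indicator {0<..} x \<partial>lborel) =
         ennreal (Gamma A * Gamma B / (A + B - 1))"
proof -
  have "(\<integral>\<^sup>+x. (\<integral>\<^sup>+y. ennreal (x powr (A - 1) * y powr (B - 1) * exp (- x - y) / (x + y)) * indicator {0<..} y \<partial>lborel) * indicator {0<..} x \<partial>lborel) =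
    (\<integral>\<^sup>+x. (\<integral>\<^sup>+t. ennreal (Gamma B) * (ennreal (x powr (A - 1)) * indicator {0<..} x * (ennreal (t powr (- B) * exp (- t * x)) * indicator {1..} t)) \<partial>lborel) \<partial>lborel)"
  proof (intro nn_integral_cong)
    fix x :: real
    show "(\<integral>\<^sup>+y. ennreal (x powr (A - 1) * y powr (B - 1) * exp (- x - y) / (x + y)) * indicator {0<..} y \<partial>lborel) * indicator {0<..} x =
      (\<integral>\<^sup>+t. ennreal (Gamma B) * (ennreal (x powr (A - 1)) * indicator {0<..} x * (ennreal (t powr (- B) * exp (- t * x)) * indicator {1..} t)) \<partial>lborel)"
    proof (cases "x > 0")
      case True
      have "(\<integral>\<^sup>+y. ennreal (x powr (A - 1) * y powr (B - 1) * exp (- x - y) / (x + y)) * indicator {0<..} y \<partial>lborel) =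
        (\<integral>\<^sup>+y. ennreal (x powr (A - 1)) * (ennreal (y powr (B - 1) * exp (- y - x) / (y + x)) * indicator {0<..} y) \<partial>lborel)"
      proof (intro nn_integral_cong)
        fix y :: real
        have "x powr (A - 1) * y powr (B - 1) * exp (- x - y) / (x + y) = x powr (A - 1) * (y powr (B - 1) * exp (- y - x) / (y + x))"
          by (simp add: add.commute diff_commute)
        then show "ennreal (x powr (A - 1) * y powr (B - 1) * exp (- x - y) / (x + y)) * indicator {0<..} y =
          ennreal (x powr (A - 1)) * (ennreal (y powr (B - 1) * exp (- y - x) / (y + x)) * indicator {0<..} y)"
          using True by (cases "y > 0") (simp_all only: ennreal_mult' powr_ge_zero indicator_simps mult_1_right greaterThan_iff, simp_all)
      qed
      also have "\<dots> = ennreal (x powr (A - 1)) * (ennreal (Gamma B) *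
            (\<integral>\<^sup>+t. ennreal (t powr (- B) * exp (- t * x)) * indicator {1..} t \<partial>lborel))"
        using nn_integral_stieltjes[OF B True] by (subst nn_integral_cmult) auto
      also have "\<dots> = (\<integral>\<^sup>+t. (ennreal (Gamma B) * ennreal (x powr (A - 1))) *
           (ennreal (t powr (- B) * exp (- t * x)) * indicator {1..} t) \<partial>lborel)"
        by (subst nn_integral_cmult) (auto simp: mult_ac)
      finally show ?thesis using True by (simp add: mult.assoc)
    qed simp
  qed
  also have "\<dots> = (\<integral>\<^sup>+t. (\<integral>\<^sup>+x. ennreal (Gamma B) * (ennreal (x powr (A - 1)) * indicator {0<..} x * (ennreal (t powr (- B) * exp (- t * x)) * indicator {1..} t)) \<partial>lborel) \<partial>lborel)"
    by (rule lborel_pair.Fubini') (simp add: split_beta)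
  also have "\<dots> = (\<integral>\<^sup>+t. ennreal (Gamma A * Gamma B) * (ennreal (t powr (- A - B)) * indicator {1..} t) \<partial>lborel)"
  proof (intro nn_integral_cong)
    fix t :: real
    show "(\<integral>\<^sup>+x. ennreal (Gamma B) * (ennreal (x powr (A - 1)) * indicator {0<..} x * (ennreal (t powr (- B) * exp (- t * x)) * indicator {1..} t)) \<partial>lborel) =
      ennreal (Gamma A * Gamma B) * (ennreal (t powr (- A - B)) * indicator {1..} t)"
    proof (cases "t \<ge> 1")
      case True
      have "(\<integral>\<^sup>+x. ennreal (Gamma B) * (ennreal (x powr (A - 1)) * indicator {0<..} x * (ennreal (t powr (- B) * exp (- t * x)) * indicator {1..} t)) \<partial>lborel) =
        (\<integral>\<^sup>+x. ennreal (Gamma B * t powr (- B)) * (ennreal (x powr (A - 1) * exp (- t * x)) * indicator {0<..} x) \<partial>lborel)"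
      proof (intro nn_integral_cong)
        fix x :: real
        have "Gamma B \<ge> 0" using B by (simp add: Gamma_real_nonneg)
        then show "ennreal (Gamma B) * (ennreal (x powr (A - 1)) * indicator {0<..} x * (ennreal (t powr (- B) * exp (- t * x)) * indicator {1..} t)) =
          ennreal (Gamma B * t powr (- B)) * (ennreal (x powr (A - 1) * exp (- t * x)) * indicator {0<..} x)"
          using True by (cases "x > 0") (simp_all add: ennreal_mult' mult_ac)
      qed
      also have "\<dots> = ennreal (Gamma B * t powr (- B)) * ennreal (Gamma A * t powr (- A))"
        using nn_integral_powr_exp[OF A, of t] True by (subst nn_integral_cmult) auto
      also have "\<dots> = ennreal ((Gamma A * Gamma B) * t powr (- A - B))"
        using A B True
        by (simp add: powr_add Gamma_real_nonneg mult_ac powr_diff powr_minus divide_simps flip: ennreal_mult')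
      finally show ?thesis using True A B
        by (simp add: ennreal_mult' Gamma_real_nonneg)
    qed simp
  qed
  also have "\<dots> = ennreal (Gamma A * Gamma B) * (\<integral>\<^sup>+t. ennreal (t powr (- A - B)) * indicator {1..} t \<partial>lborel)"
    by (subst nn_integral_cmult) auto
  also have "(\<integral>\<^sup>+t. ennreal (t powr (- A - B)) * indicator {1..} t \<partial>lborel) = ennreal (0 - (1 powr (1 - A - B) / (1 - A - B)))"
  proof (rule nn_integral_FTC_atLeast[where F = "\<lambda>t. t powr (1 - A - B) / (1 - A - B)"])
    have "((\<lambda>t::real. t powr (- (A + B - 1))) \<longlongrightarrow> 0) at_top"
      using AB by (intro tendsto_neg_powr filterlim_ident) auto
    then have "((\<lambda>t::real. t powr (- (A + B - 1)) / (1 - A - B)) \<longlongrightarrow> 0 / (1 - A - B)) at_top"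
      using AB by (intro tendsto_intros) auto
    then show "((\<lambda>t::real. t powr (1 - A - B) / (1 - A - B)) \<longlongrightarrow> 0) at_top"
      by (simp add: algebra_simps)
    show "((\<lambda>t. t powr (1 - A - B) / (1 - A - B)) has_real_derivative x powr (- A - B)) (at x)" if "1 \<le> x" for x
    proof -
      have "((\<lambda>t. t powr (1 - A - B) / (1 - A - B)) has_real_derivative
          ((1 - A - B) * x powr (1 - A - B - 1)) / (1 - A - B)) (at x)"
        using that by (intro DERIV_cdivide has_real_derivative_powr) auto
      then show ?thesis using AB by simp
    qed
  qed auto
  also have "ennreal (Gamma A * Gamma B) * \<dots> = ennreal (Gamma A * Gamma B / (A + B - 1))"
  proof -
    have "- (1 / (1 - A - B)) = 1 / (A + B - 1)" using AB by (simp add: divide_simps)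
    then show ?thesis using A B AB
      by (simp add: Gamma_real_nonneg flip: ennreal_mult')
  qed
  finally show ?thesis .
qed

text \<open>Passage from Tonelli computations with extended nonnegative integrals to Bochner integrals.\<close>
lemma nonneg_set_integral_eqI:
  fixes f :: "real \<Rightarrow> real"
  assumes "f \<in> borel_measurable borel" "A \<in> sets borel" "\<And>x. x \<in> A \<Longrightarrow> 0 \<le> f x" "0 \<le> I"
    and "(\<integral>\<^sup>+x. ennreal (f x) * indicator A x \<partial>lborel) = ennreal I"
  shows "set_integrable lborel A f" "(LINT x:A|lborel. f x) = I"
proof -
  have "(\<integral>\<^sup>+x. ennreal (indicator A x *\<^sub>R f x) \<partial>lborel) = ennreal I"
    unfolding assms(5)[symmetric] by (intro nn_integral_cong) (auto simp: indicator_def)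
  moreover have "(\<lambda>x. indicator A x *\<^sub>R f x) \<in> borel_measurable lborel"
    using assms(1,2) by measurable
  moreover have "AE x in lborel. 0 \<le> indicator A x *\<^sub>R f x"
    using assms(3) by (auto simp: indicator_def)
  ultimately have "integrable lborel (\<lambda>x. indicator A x *\<^sub>R f x) \<and> integral\<^sup>L lborel (\<lambda>x. indicator A x *\<^sub>R f x) = I"
    using assms(4) by (subst nn_integral_eq_integrable [symmetric]) auto
  then show "set_integrable lborel A f" "(LINT x:A|lborel. f x) = I"
    by (auto simp: set_integrable_def set_lebesgue_integral_def)
qed

lemma set_integral_powr_exp:
  fixes c t :: real
  assumes c: "c > 0" and t: "t > 0"
  shows "set_integrable lborel {0<..} (\<lambda>x. x powr (c - 1) * exp (- t * x))"
    and "(LINT x:{0<..}|lborel. x powr (c - 1) * exp (- t * x)) = Gamma c * t powr (- c)"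
  using nonneg_set_integral_eqI[OF _ _ _ _ nn_integral_powr_exp[OF c t]] assms
  by (auto simp: Gamma_real_nonneg)

lemma set_integral_Gamma:
  fixes c :: real
  assumes c: "c > 0"
  shows "set_integrable lborel {0<..} (\<lambda>x. x powr (c - 1) * exp (- x))"
    and "(LINT x:{0<..}|lborel. x powr (c - 1) * exp (- x)) = Gamma c"
  using set_integral_powr_exp[OF c, of 1] by simp_all

definition stieltjes :: "real \<Rightarrow> complex \<Rightarrow> complex" where
  "stieltjes c w = (LINT x:{0<..}|lborel. of_real (x powr (c - 1) * exp (- x)) / (of_real x + w))"

text \<open>Off the negative axis the denominators \<open>x + w\<close> are bounded away from \<open>0\<close>, which is what
makes all integrals below converge and depend smoothly on \<open>w\<close>.\<close>
lemma dist_pos_reals: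
  fixes w :: complex
  assumes "w \<notin> \<real>\<^sub>\<le>\<^sub>0"
  obtains d where "d > 0" "\<And>x::real. x \<ge> 0 \<Longrightarrow> d \<le> norm (of_real x + w)"
proof -
  have "- w \<notin> \<real>\<^sub>\<ge>\<^sub>0" using assms by (auto simp: complex_nonneg_Reals_iff complex_nonpos_Reals_iff)
  then obtain d where "d > 0" and d: "\<forall>y\<in>\<real>\<^sub>\<ge>\<^sub>0. d \<le> dist (- w) y"
    using separate_point_closed[OF closed_nonneg_Reals_complex] by blast
  have "d \<le> norm (of_real x + w)" if "x \<ge> 0" for x :: real
  proof -
    have "d \<le> dist (- w) (of_real x)" using d that by auto
    also have "\<dots> = norm (of_real x + w)" by (metis dist_norm dist_commute diff_minus_eq_add)
    finally show ?thesis .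
  qed
  with \<open>d > 0\<close> show ?thesis by (rule that)
qed

lemma weighted_integrable:
  fixes h :: "real \<Rightarrow> complex"
  assumes c: "c > 0" and h: "h \<in> borel_measurable borel" and bd: "\<And>x. x > 0 \<Longrightarrow> norm (h x) \<le> B"
  shows "set_integrable lborel {0<..} (\<lambda>x. of_real (x powr (c - 1) * exp (- x)) * h x)"
    and "norm (LINT x:{0<..}|lborel. of_real (x powr (c - 1) * exp (- x)) * h x) \<le> B * Gamma c"
proof -
  have int: "set_integrable lborel {0<..} (\<lambda>x. B * (x powr (c - 1) * exp (- x)))"
    using set_integral_Gamma(1)[OF c] by simp
  have le: "norm (of_real (x powr (c - 1) * exp (- x)) * h x) \<le> B * (x powr (c - 1) * exp (- x))" if "x > 0" for x
  proof -
    have "norm (of_real (x powr (c - 1) * exp (- x)) * h x) = (x powr (c - 1) * exp (- x)) * norm (h x)"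
      by (simp add: norm_mult)
    also have "\<dots> \<le> (x powr (c - 1) * exp (- x)) * B" by (intro mult_left_mono bd that) auto
    finally show ?thesis by (simp add: mult_ac)
  qed
  show int': "set_integrable lborel {0<..} (\<lambda>x. of_real (x powr (c - 1) * exp (- x)) * h x)"
  proof (rule set_integrable_bound[OF int])
    show "set_borel_measurable lborel {0<..} (\<lambda>x. of_real (x powr (c - 1) * exp (- x)) * h x)"
      using h unfolding set_borel_measurable_def by measurable
    show "AE x in lborel. x \<in> {0<..} \<longrightarrow> norm (of_real (x powr (c - 1) * exp (- x)) * h x) \<le>
        norm (B * (x powr (c - 1) * exp (- x)))"
      using le by (intro AE_I2) (force intro: order_trans[OF _ abs_ge_self])
  qed
  have "norm (LINT x:{0<..}|lborel. of_real (x powr (c - 1) * exp (- x)) * h x) \<le>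
      (LINT x:{0<..}|lborel. norm (of_real (x powr (c - 1) * exp (- x)) * h x))"
    by (rule set_integral_norm_bound[OF int'])
  also have "\<dots> \<le> (LINT x:{0<..}|lborel. B * (x powr (c - 1) * exp (- x)))"
    by (intro set_integral_mono set_integrable_norm int int') (use le in auto)
  also have "\<dots> = B * Gamma c" using set_integral_Gamma(2)[OF c] by simp
  finally show "norm (LINT x:{0<..}|lborel. of_real (x powr (c - 1) * exp (- x)) * h x) \<le> B * Gamma c" .
qed

lemma norm_recip_le: "0 < d \<Longrightarrow> d \<le> norm y \<Longrightarrow> norm (1 / y) \<le> 1 / d" for y :: complex
  by (simp add: norm_divide frac_le)

lemma stieltjes_integrable:
  fixes w :: complex
  assumes c: "c > 0" and w: "w \<notin> \<real>\<^sub>\<le>\<^sub>0"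
  shows "set_integrable lborel {0<..} (\<lambda>x. of_real (x powr (c - 1) * exp (- x)) / (of_real x + w))"
proof -
  obtain d where d: "d > 0" "\<And>x::real. x \<ge> 0 \<Longrightarrow> d \<le> norm (of_real x + w)"
    using dist_pos_reals[OF w] by blast
  have "set_integrable lborel {0<..} (\<lambda>x. of_real (x powr (c - 1) * exp (- x)) * (1 / (of_real x + w)))"
    using d by (intro weighted_integrable(1)[OF c, of _ "1 / d"] norm_recip_le) auto
  then show ?thesis by simp
qed

text \<open>Divide \<open>x\<close> by \<open>x + w\<close> with remainder: \<open>x = (x + w) - w\<close>.\<close>
lemma stieltjes_recurrence:
  assumes c: "c > 1" and w: "w \<notin> \<real>\<^sub>\<le>\<^sub>0"
  shows "stieltjes c w = of_real (Gamma (c - 1)) - w * stieltjes (c - 1) w"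
proof -
  have "stieltjes c w = (LINT x:{0<..}|lborel. of_real (x powr (c - 1 - 1) * exp (- x)) -
          w * (of_real (x powr (c - 1 - 1) * exp (- x)) / (of_real x + w)))"
    unfolding stieltjes_def
  proof (intro set_lebesgue_integral_cong allI impI)
    fix x :: real assume "x \<in> {0<..}"
    then have x: "x > 0" by simp
    have "of_real x + w \<noteq> 0"
    proof
      assume "of_real x + w = 0"
      then have "w = of_real (- x)" by (simp add: add_eq_0_iff)
      with x w show False by (auto simp: complex_nonpos_Reals_iff)
    qed
    moreover have "x powr (c - 1) = x * x powr (c - 1 - 1)" using x by (simp add: powr_mult_base)
    ultimately show "of_real (x powr (c - 1) * exp (- x)) / (of_real x + w) = of_real (x powr (c - 1 - 1) * exp (- x)) -
          w * (of_real (x powr (c - 1 - 1) * exp (- x)) / (of_real x + w))"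
      by (simp add: divide_simps) (simp add: algebra_simps)
  qed auto
  also have "\<dots> = (LINT x:{0<..}|lborel. complex_of_real (x powr (c - 1 - 1) * exp (- x))) - w * stieltjes (c - 1) w"
    unfolding stieltjes_def
    using c weighted_integrable(1)[of "c - 1" "\<lambda>_. 1" 1] stieltjes_integrable[of "c - 1", OF _ w]
    by (subst set_integral_diff(2))
      (simp_all only: set_integral_mult_right set_integrable_mult_right diff_gt_0_iff_gt
         borel_measurable_const norm_one order_refl mult_1_right simp_thms)
  also have "(LINT x:{0<..}|lborel. complex_of_real (x powr (c - 1 - 1) * exp (- x))) = of_real (Gamma (c - 1))"
    using set_integral_Gamma(2)[of "c - 1"] c by (subst set_integral_complex_of_real) simp
  finally show ?thesis .
qed

text \<open>The difference quotient differs from its expected limit by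
\<open>(w - w\<^sub>0) \<integral> \<rho>(x) / ((x + w) (x + w\<^sub>0)\<^sup>2) dx\<close> with the weight \<open>\<rho>\<close>, and the integral stays
bounded for \<open>w\<close> near \<open>w\<^sub>0\<close>.\<close>
lemma stieltjes_holomorphic:
  assumes c: "c > 0"
  shows "stieltjes c holomorphic_on - \<real>\<^sub>\<le>\<^sub>0"
proof (subst holomorphic_on_open)
  show "open (- \<real>\<^sub>\<le>\<^sub>0 :: complex set)" by (rule open_Compl) simp
  show "\<forall>w\<in>- \<real>\<^sub>\<le>\<^sub>0. \<exists>f'. (stieltjes c has_field_derivative f') (at w)"
  proof
    fix w0 :: complex assume w0: "w0 \<in> - \<real>\<^sub>\<le>\<^sub>0"
    obtain d where d: "d > 0" "\<And>x::real. x \<ge> 0 \<Longrightarrow> d \<le> norm (of_real x + w0)"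
      using dist_pos_reals[of w0] w0 by auto
    define \<rho> where "\<rho> = (\<lambda>x::real. complex_of_real (x powr (c - 1) * exp (- x)))"
    define D where "D = (LINT x:{0<..}|lborel. \<rho> x * (- 1 / (of_real x + w0) ^ 2))"
    have int0: "set_integrable lborel {0<..} (\<lambda>x. \<rho> x * (1 / (of_real x + w0)))"
      unfolding \<rho>_def using d
      by (intro weighted_integrable(1)[OF c, of _ "1 / d"] norm_recip_le) auto
    have intD: "set_integrable lborel {0<..} (\<lambda>x. \<rho> x * (- 1 / (of_real x + w0) ^ 2))"
      unfolding \<rho>_def using d
      by (intro weighted_integrable(1)[OF c, of _ "1 / d ^ 2"])
        (auto simp: norm_divide norm_power intro!: frac_le power_mono)
    have st: "stieltjes c v = (LINT x:{0<..}|lborel. \<rho> x * (1 / (of_real x + v)))" for v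
      by (simp add: stieltjes_def \<rho>_def)
    define M where "M = 1 / (d / 2 * d ^ 2) * Gamma c"
    have bound: "norm ((stieltjes c w - stieltjes c w0) / (w - w0) - D) \<le> M * norm (w - w0)"
      if w: "w \<noteq> w0" "norm (w - w0) < d / 2" for w
    proof -
      have dw: "d / 2 \<le> norm (of_real x + w)" if "x \<ge> 0" for x :: real
      proof -
        have "norm (of_real x + w0) \<le> norm (of_real x + w) + norm (w - w0)"
          using norm_triangle_ineq4[of "of_real x + w" "w - w0"] by simp
        with d(2)[OF that] w(2) show ?thesis by linarith
      qed
      have nz: "of_real x + w \<noteq> 0" "of_real x + w0 \<noteq> 0" if "x \<ge> 0" for x :: real
        using dw[OF that] d(2)[OF that] d(1) by auto
      have int: "set_integrable lborel {0<..} (\<lambda>x. \<rho> x * (1 / (of_real x + w)))"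
        unfolding \<rho>_def using d(1) dw
        by (intro weighted_integrable(1)[OF c, of _ "1 / (d / 2)"] norm_recip_le) auto
      have "(stieltjes c w - stieltjes c w0) / (w - w0) - D =
        (LINT x:{0<..}|lborel. (\<rho> x * (1 / (of_real x + w)) - \<rho> x * (1 / (of_real x + w0))) / (w - w0) -
            \<rho> x * (- 1 / (of_real x + w0) ^ 2))"
        by (subst set_integral_diff(2)[OF set_integrable_divide[OF set_integral_diff(1)[OF int int0]] intD])
          (simp_all only: set_integral_divide_zero set_integral_diff(2)[OF int int0] st D_def w(1) right_minus_eq simp_thms)
      also have "\<dots> = (LINT x:{0<..}|lborel. (w - w0) * (\<rho> x * (1 / ((of_real x + w) * (of_real x + w0) ^ 2))))"
      proof (intro set_lebesgue_integral_cong allI impI)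
        fix x :: real assume "x \<in> {0<..}"
        then have "x \<ge> 0" by simp
        note nz = nz[OF this]
        define A where "A = of_real x + w"
        define B where "B = of_real x + w0"
        have eq: "w - w0 = A - B" by (simp add: A_def B_def)
        have "A \<noteq> 0" "B \<noteq> 0" "A - B \<noteq> 0" using nz w(1) by (auto simp: A_def B_def)
        then have "(\<rho> x * (1 / A) - \<rho> x * (1 / B)) / (A - B) - \<rho> x * (- 1 / B ^ 2) =
          (A - B) * (\<rho> x * (1 / (A * B ^ 2)))"
          by (simp add: divide_simps) (simp add: algebra_simps power2_eq_square power3_eq_cube)
        then show "(\<rho> x * (1 / (of_real x + w)) - \<rho> x * (1 / (of_real x + w0))) / (w - w0) -
            \<rho> x * (- 1 / (of_real x + w0) ^ 2) = (w - w0) * (\<rho> x * (1 / ((of_real x + w) * (of_real x + w0) ^ 2)))"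
          unfolding eq by (simp only: A_def B_def)
      qed auto
      also have "\<dots> = (w - w0) * (LINT x:{0<..}|lborel. \<rho> x * (1 / ((of_real x + w) * (of_real x + w0) ^ 2)))"
        by (rule set_integral_mult_right)
      also have "norm \<dots> \<le> norm (w - w0) * (1 / (d / 2 * d ^ 2) * Gamma c)"
        unfolding norm_mult \<rho>_def
      proof (intro mult_left_mono weighted_integrable(2)[OF c])
        fix x :: real assume "x > 0"
        then show "norm (1 / ((of_real x + w) * (of_real x + w0) ^ 2)) \<le> 1 / (d / 2 * d ^ 2)"
          unfolding norm_divide norm_mult norm_power norm_one using d dw[of x] nz[of x]
          by (intro divide_left_mono mult_mono power_mono mult_pos_pos zero_less_power) auto
      qed auto
      finally show ?thesis by (simp add: M_def mult.commute)
    qed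
    have "((\<lambda>w. (stieltjes c w - stieltjes c w0) / (w - w0) - D) \<longlongrightarrow> 0) (at w0)"
    proof (rule Lim_null_comparison)
      show "\<forall>\<^sub>F w in at w0. norm ((stieltjes c w - stieltjes c w0) / (w - w0) - D) \<le> M * norm (w - w0)"
        using d(1) bound by (auto simp: eventually_at dist_norm intro!: exI[of _ "d / 2"])
      have "((\<lambda>w. M * norm (w - w0)) \<longlongrightarrow> M * norm (w0 - w0)) (at w0)"
        by (intro tendsto_intros)
      then show "((\<lambda>w. M * norm (w - w0)) \<longlongrightarrow> 0) (at w0)" by simp
    qed
    then have "((\<lambda>w. (stieltjes c w - stieltjes c w0) / (w - w0)) \<longlongrightarrow> D) (at w0)"
      by (simp add: LIM_zero_iff)
    then show "\<exists>f'. (stieltjes c has_field_derivative f') (at w0)"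
      by (auto simp: has_field_derivative_iff)
  qed
qed

section \<open>The residue expansion of the Stieltjes integral\<close>

text \<open>Termwise integration of the exponential series, justified by absolute convergence: each integral over the
unit interval is at most \<open>1 / (1 - c)\<close> times the corresponding term of \<open>e\<^sup>w\<close> with \<open>w\<close>
replaced by its absolute value.\<close>
lemma exp_integral_series:
  fixes c w :: real
  assumes c: "c < 1"
  shows "(\<lambda>k. (- w) ^ k / (fact k * (real k + 1 - c))) sums (LINT t:{0<..1}|lborel. t powr (- c) * exp (- t * w))"
proof -
  define f where "f = (\<lambda>k t. indicator {0<..1::real} t *\<^sub>R ((- w) ^ k / fact k * t powr (real k - c)))"
  have pw: "set_integrable lborel {0<..1} (\<lambda>t. t powr (real k - c))"
      "(LINT t:{0<..1}|lborel. t powr (real k - c)) = 1 / (real k + 1 - c)" for k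
  proof -
    have "(\<integral>\<^sup>+t. ennreal (t powr (real k - c)) * indicator {0<..1} t \<partial>lborel) =
      (\<integral>\<^sup>+t. ennreal (t powr (real k - c)) * indicator {0..1} t \<partial>lborel)"
      by (intro nn_integral_cong) (auto simp: indicator_def)
    also have "\<dots> = ennreal (1 / (real k + 1 - c))"
    proof (subst nn_integral_has_integral_lebesgue'[where I = "1 / (real k + 1 - c)"])
      show "((\<lambda>t. t powr (real k - c)) has_integral 1 / (real k + 1 - c)) {0..1}"
        using has_integral_powr_from_0[of "real k - c" 1] c by (simp add: algebra_simps)
    qed auto
    finally have "(\<integral>\<^sup>+t. ennreal (t powr (real k - c)) * indicator {0<..1} t \<partial>lborel) = ennreal (1 / (real k + 1 - c))" .
    from nonneg_set_integral_eqI[OF _ _ _ _ this] c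
    show "set_integrable lborel {0<..1} (\<lambda>t. t powr (real k - c))"
      "(LINT t:{0<..1}|lborel. t powr (real k - c)) = 1 / (real k + 1 - c)" by auto
  qed
  have int: "integrable lborel (f k)" for k
    using set_integrable_mult_right[of "(- w) ^ k / fact k", OF pw(1)[of k]]
    unfolding f_def set_integrable_def by simp
  have val: "integral\<^sup>L lborel (f k) = (- w) ^ k / (fact k * (real k + 1 - c))" for k
  proof -
    have "integral\<^sup>L lborel (f k) = (LINT t:{0<..1}|lborel. (- w) ^ k / fact k * t powr (real k - c))"
      unfolding f_def set_lebesgue_integral_def ..
    also have "\<dots> = (- w) ^ k / fact k * (1 / (real k + 1 - c))"
      by (simp only: set_integral_mult_right pw)
    finally show ?thesis by simp
  qed
  \<comment> \<open>Each term has constant sign on the interval, so the integral of the absolute value is explicit.\<close>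
  have nval: "(\<integral>t. norm (f k t) \<partial>lborel) = \<bar>w\<bar> ^ k / (fact k * (real k + 1 - c))" for k
  proof -
    have "(\<integral>t. norm (f k t) \<partial>lborel) = (LINT t:{0<..1}|lborel. \<bar>w\<bar> ^ k / fact k * t powr (real k - c))"
      unfolding set_lebesgue_integral_def f_def
      by (intro Bochner_Integration.integral_cong) (auto simp: abs_mult power_abs)
    also have "\<dots> = \<bar>w\<bar> ^ k / fact k * (1 / (real k + 1 - c))"
      by (simp only: set_integral_mult_right pw)
    finally show ?thesis by simp
  qed
  have sum: "f k t = indicator {0<..1} t * t powr (- c) * ((- t * w) ^ k /\<^sub>R fact k)" for k t
  proof (cases "t \<in> {0<..1}")
    case True
    then have "t powr (real k - c) = t ^ k * t powr (- c)"
      by (simp add: powr_diff powr_minus powr_realpow divide_inverse)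
    then show ?thesis using True by (simp add: f_def power_mult_distrib divide_inverse power_minus[of w] power_minus[of "t * w"])
  qed (simp add: f_def)
  have fsums: "(\<lambda>k. f k t) sums (indicator {0<..1} t * t powr (- c) * exp (- t * w))" for t
    unfolding sum by (intro sums_mult exp_converges)
  have s1: "AE t in lborel. summable (\<lambda>k. norm (f k t))"
  proof (intro AE_I2)
    fix t :: real
    show "summable (\<lambda>k. norm (f k t))"
      unfolding sum norm_mult by (intro summable_mult summable_norm_exp)
  qed
  have s2: "summable (\<lambda>k. \<integral>t. norm (f k t) \<partial>lborel)"
    unfolding nval
  proof (rule summable_comparison_test')
    show "summable (\<lambda>k. 1 / (1 - c) * (\<bar>w\<bar> ^ k /\<^sub>R fact k))"
      by (intro summable_mult summable_exp_generic)
    fix k :: nat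
    have "\<bar>w\<bar> ^ k / (fact k * (real k + 1 - c)) \<le> \<bar>w\<bar> ^ k / (fact k * (1 - c))"
      using c by (intro divide_left_mono mult_left_mono mult_pos_pos) auto
    then show "norm (\<bar>w\<bar> ^ k / (fact k * (real k + 1 - c))) \<le> 1 / (1 - c) * (\<bar>w\<bar> ^ k /\<^sub>R fact k)"
      using c by (simp add: divide_inverse abs_mult mult_ac)
  qed
  have lim: "(\<Sum>k. f k t) = indicator {0<..1} t *\<^sub>R (t powr (- c) * exp (- t * w))" for t
    using sums_unique[OF fsums[of t]] by (simp add: mult.assoc)
  show "(\<lambda>k. (- w) ^ k / (fact k * (real k + 1 - c))) sums (LINT t:{0<..1}|lborel. t powr (- c) * exp (- t * w))"
    using sums_integral[OF int s1 s2] unfolding lim val set_lebesgue_integral_def .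
qed

text \<open>For \<open>w > 0\<close> the Stieltjes integral is \<open>\<Gamma>(c) e\<^sup>w\<close> times the integral of
\<open>t\<^sup>-\<^sup>c e\<^sup>-\<^sup>t\<^sup>w\<close> over \<open>t \<ge> 1\<close>. For \<open>c < 1\<close> this is the complete integral, a Gamma
value, minus the integral over the unit interval, which expands into the series.\<close>
lemma series_stieltjes_pos_real:
  fixes c w :: real
  assumes c: "0 < c" "c < 1" and w: "w > 0"
  shows "(\<lambda>k. (- w) ^ k / (fact k * (c - 1 - real k))) sums
    (exp (- w) / Gamma c * (LINT x:{0<..}|lborel. x powr (c - 1) * exp (- x) / (x + w)) - Gamma (1 - c) * w powr (c - 1))"
proof -
  define h where "h = (\<lambda>t. t powr (- c) * exp (- t * w))"
  have full: "set_integrable lborel {0<..} h" "(LINT t:{0<..}|lborel. h t) = Gamma (1 - c) * w powr (c - 1)"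
    using set_integral_powr_exp[of "1 - c" w] c w by (simp_all add: h_def mult.commute)
  have tail: "set_integrable lborel {1<..} h"
    by (rule set_integrable_subset[OF full(1)]) auto
  have unit: "set_integrable lborel {0<..1} h"
    by (rule set_integrable_subset[OF full(1)]) auto
  have "{0<..} = {0<..1} \<union> {1::real<..}" by auto
  then have split: "Gamma (1 - c) * w powr (c - 1) = (LINT t:{0<..1}|lborel. h t) + (LINT t:{1<..}|lborel. h t)"
    using full(2) set_integral_Un[OF _ unit tail] by (metis disjoint_iff greaterThanAtMost_iff greaterThan_iff linorder_not_less)
  have "(\<integral>\<^sup>+t. ennreal (t powr (- c) * exp (- t * w)) * indicator {1..} t \<partial>lborel) =
      (\<integral>\<^sup>+t. ennreal (h t) * indicator {1<..} t \<partial>lborel)"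
    by (intro nn_integral_cong_AE AE_I[where N = "{1}"]) (auto simp: indicator_def h_def split: if_splits)
  also have "\<dots> = (\<integral>\<^sup>+t. ennreal (indicator {1<..} t *\<^sub>R h t) \<partial>lborel)"
    by (intro nn_integral_cong) (auto simp: indicator_def)
  also have "\<dots> = ennreal (LINT t:{1<..}|lborel. h t)"
    unfolding set_lebesgue_integral_def using tail
    by (intro nn_integral_eq_integral) (auto simp: set_integrable_def h_def)
  finally have nn: "(\<integral>\<^sup>+t. ennreal (t powr (- c) * exp (- t * w)) * indicator {1..} t \<partial>lborel) = \<dots>" .
  have pos: "(LINT t:{1<..}|lborel. h t) \<ge> 0"
    unfolding set_lebesgue_integral_def by (intro integral_nonneg_AE AE_I2) (auto simp: h_def)
  have "(\<integral>\<^sup>+x. ennreal (x powr (c - 1) * exp (- x - w) / (x + w)) * indicator {0<..} x \<partial>lborel) =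
      ennreal (Gamma c * (LINT t:{1<..}|lborel. h t))"
    unfolding nn_integral_stieltjes[OF c(1) w] nn using c pos by (simp add: Gamma_real_nonneg ennreal_mult')
  from nonneg_set_integral_eqI(2)[OF _ _ _ _ this] c pos w
  have "(LINT x:{0<..}|lborel. x powr (c - 1) * exp (- x - w) / (x + w)) = Gamma c * (LINT t:{1<..}|lborel. h t)"
    by (auto simp: Gamma_real_nonneg)
  moreover have "(LINT x:{0<..}|lborel. x powr (c - 1) * exp (- x - w) / (x + w)) =
      exp (- w) * (LINT x:{0<..}|lborel. x powr (c - 1) * exp (- x) / (x + w))"
    by (subst set_integral_mult_right [symmetric]) (simp add: exp_diff exp_minus divide_inverse mult_ac)
  ultimately have "exp (- w) / Gamma c * (LINT x:{0<..}|lborel. x powr (c - 1) * exp (- x) / (x + w)) =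
      (LINT t:{1<..}|lborel. h t)"
    using Gamma_real_pos[OF c(1)] by (simp add: field_simps)
  with split have "exp (- w) / Gamma c * (LINT x:{0<..}|lborel. x powr (c - 1) * exp (- x) / (x + w)) -
      Gamma (1 - c) * w powr (c - 1) = - (LINT t:{0<..1}|lborel. h t)" by simp
  moreover have "(\<lambda>k. - ((- w) ^ k / (fact k * (real k + 1 - c)))) sums - (LINT t:{0<..1}|lborel. h t)"
    unfolding h_def using exp_integral_series[OF c(2)] by (rule sums_minus)
  moreover have "- ((- w) ^ k / (fact k * (real k + 1 - c))) = (- w) ^ k / (fact k * (c - 1 - real k))" for k
  proof -
    have "fact k * (c - 1 - real k) = - (fact k * (real k + 1 - c))" by (simp add: algebra_simps)
    then show ?thesis by simp
  qed
  ultimately show ?thesis by simp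
qed

text \<open>This is \<open>w\<^sup>c\<^sup>-\<^sup>1 \<Gamma>(1 - c, w)\<close> with the upper incomplete Gamma function.\<close>
definition incomplete_gamma_term :: "real \<Rightarrow> complex \<Rightarrow> complex" where
  "incomplete_gamma_term c w = exp (- w) / of_real (Gamma c) * stieltjes c w"

text \<open>Both sides are holomorphic off the negative axis and agree for \<open>w > 0\<close>.\<close>
lemma series_stieltjes_unit:
  fixes w :: complex
  assumes c: "0 < c" "c < 1" and w: "w \<notin> \<real>\<^sub>\<le>\<^sub>0"
  shows "(\<lambda>k. (- w) ^ k / (fact k * (of_real c - 1 - of_nat k))) sums
    (incomplete_gamma_term c w - Gamma (1 - of_real c) * w powr (of_real c - 1))"
proof -
  define a :: "nat \<Rightarrow> complex" where "a = (\<lambda>k. (- 1) ^ k / (fact k * (of_real c - 1 - of_nat k)))"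
  have term_eq: "(- y) ^ k / (fact k * (of_real c - 1 - of_nat k)) = a k * y ^ k" for y k
    by (simp add: a_def power_minus[of y])
  have summ: "summable (\<lambda>k. a k * y ^ k)" for y
  proof (rule summable_comparison_test')
    show "summable (\<lambda>k. 1 / (1 - c) * norm (y ^ k /\<^sub>R fact k))"
      by (intro summable_mult summable_norm_exp)
    fix k :: nat
    have "1 - c \<le> norm (of_real c - 1 - of_nat k :: complex)"
      using abs_Re_le_cmod[of "of_real c - 1 - of_nat k"] c by simp
    then have "norm (a k) \<le> 1 / (fact k * (1 - c))"
      unfolding a_def norm_divide norm_mult norm_power using c
      by (intro frac_le) (auto intro!: mult_pos_pos)
    then have "norm (a k) * norm (y ^ k) \<le> 1 / (fact k * (1 - c)) * norm (y ^ k)"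
      by (rule mult_right_mono) simp
    then show "norm (a k * y ^ k) \<le> 1 / (1 - c) * norm (y ^ k /\<^sub>R fact k)"
      using c by (simp add: norm_mult divide_inverse mult_ac)
  qed
  define F where "F = (\<lambda>y. incomplete_gamma_term c y - Gamma (1 - of_real c) * y powr (of_real c - 1) - (\<Sum>k. a k * y ^ k))"
  have "(\<lambda>y. \<Sum>k. a k * y ^ k) holomorphic_on - \<real>\<^sub>\<le>\<^sub>0"
    using termdiffs_strong_converges_everywhere[OF summ]
    by (meson closed_nonpos_Reals_complex holomorphic_on_open open_Compl)
  moreover have "incomplete_gamma_term c holomorphic_on - \<real>\<^sub>\<le>\<^sub>0"
    unfolding incomplete_gamma_term_def [abs_def]
    by (intro holomorphic_intros stieltjes_holomorphic) (use c Gamma_real_pos[OF c(1)] in auto)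
  ultimately have hol: "F holomorphic_on - \<real>\<^sub>\<le>\<^sub>0"
    unfolding F_def by (intro holomorphic_intros) auto
  have real: "F (of_real y) = 0" if y: "y > 0" for y :: real
  proof -
    have "stieltjes c (of_real y) = of_real (LINT x:{0<..}|lborel. x powr (c - 1) * exp (- x) / (x + y))"
      unfolding stieltjes_def by (subst set_integral_complex_of_real [symmetric]) simp
    moreover have "of_real y powr (of_real c - 1) = complex_of_real (y powr (c - 1))"
      using y by (simp flip: powr_of_real)
    moreover have "Gamma (1 - of_real c) = complex_of_real (Gamma (1 - c))"
      by (simp flip: Gamma_complex_of_real)
    ultimately have "incomplete_gamma_term c (of_real y) - Gamma (1 - of_real c) * of_real y powr (of_real c - 1) =
      of_real (exp (- y) / Gamma c * (LINT x:{0<..}|lborel. x powr (c - 1) * exp (- x) / (x + y)) -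
         Gamma (1 - c) * y powr (c - 1))"
      by (simp add: incomplete_gamma_term_def flip: exp_of_real)
    moreover have "(\<lambda>k. complex_of_real ((- y) ^ k / (fact k * (c - 1 - real k)))) sums
      of_real (exp (- y) / Gamma c * (LINT x:{0<..}|lborel. x powr (c - 1) * exp (- x) / (x + y)) -
         Gamma (1 - c) * y powr (c - 1))"
      using series_stieltjes_pos_real[OF c y] by (rule sums_of_real)
    moreover have "(\<lambda>k. complex_of_real ((- y) ^ k / (fact k * (c - 1 - real k)))) = (\<lambda>k. a k * of_real y ^ k)"
      unfolding term_eq [symmetric] by simp
    ultimately show ?thesis
      using sums_unique by (fastforce simp: F_def)
  qed
  have "F w = 0"
  proof (rule analytic_continuation[OF hol])
    show "open (- \<real>\<^sub>\<le>\<^sub>0 :: complex set)" by (rule open_Compl) simp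
    have "(\<real>\<^sub>\<le>\<^sub>0 :: complex set) = complex_of_real ` {..0}"
      by (auto simp: nonpos_Reals_def)
    then show "connected (- \<real>\<^sub>\<le>\<^sub>0 :: complex set)"
      using starlike_imp_connected[OF starlike_slotted_complex_plane_left[of 0]] by simp
    show "complex_of_real ` {0<..} \<subseteq> - \<real>\<^sub>\<le>\<^sub>0" by auto
    show "1 \<in> - (\<real>\<^sub>\<le>\<^sub>0 :: complex set)" by (auto simp: complex_nonpos_Reals_iff)
    show "(1::complex) islimpt complex_of_real ` {0<..}"
    proof -
      have "(1::real) islimpt {0<..}" by (rule open_imp_islimpt) auto
      then have "\<exists>f. (\<forall>n. f n \<in> {0<..} - {1::real}) \<and> f \<longlonglongrightarrow> 1"
        by (simp add: islimpt_sequential)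
      then obtain f where f: "\<And>n. f n \<in> {0<..} - {1::real}" "f \<longlonglongrightarrow> 1" by blast
      have "(\<lambda>n. complex_of_real (f n)) \<longlonglongrightarrow> of_real 1"
        using f(2) by (rule tendsto_of_real)
      moreover have "complex_of_real (f n) \<in> complex_of_real ` {0<..} - {1}" for n
        using f(1)[of n] by auto
      ultimately show ?thesis
        unfolding islimpt_sequential by (intro exI[of _ "\<lambda>n. complex_of_real (f n)"]) auto
    qed
    show "F z = 0" if "z \<in> complex_of_real ` {0<..}" for z
      using that real by auto
    show "w \<in> - \<real>\<^sub>\<le>\<^sub>0" using w by simp
  qed
  then have "(\<Sum>k. a k * w ^ k) = incomplete_gamma_term c w - Gamma (1 - of_real c) * w powr (of_real c - 1)"
    by (simp add: F_def)
  then show ?thesis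
    unfolding term_eq using summable_sums[OF summ[of w]] by simp
qed

lemma incomplete_gamma_term_recurrence:
  assumes c: "c > 1" and w: "w \<notin> \<real>\<^sub>\<le>\<^sub>0"
  shows "(1 - of_real c) * incomplete_gamma_term c w = w * incomplete_gamma_term (c - 1) w - exp (- w)"
proof -
  have G: "Gamma c = (c - 1) * Gamma (c - 1)"
  proof -
    have "c - 1 \<notin> \<int>\<^sub>\<le>\<^sub>0" using c by (auto elim!: nonpos_Ints_cases')
    from Gamma_plus1[OF this] show ?thesis by simp
  qed
  have "Gamma (c - 1) > 0" using c by (intro Gamma_real_pos) simp
  then have nz: "of_real (Gamma (c - 1)) \<noteq> (0::complex)" by simp
  have nz': "of_real c - 1 \<noteq> (0::complex)" using c by simp
  have eq: "incomplete_gamma_term c w = exp (- w) / ((of_real c - 1) * of_real (Gamma (c - 1))) *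
      (of_real (Gamma (c - 1)) - w * stieltjes (c - 1) w)"
    unfolding incomplete_gamma_term_def stieltjes_recurrence[OF c w] G by simp
  show ?thesis
    unfolding eq using nz nz' by (simp add: incomplete_gamma_term_def field_simps)
qed

text \<open>The expansion propagates from \<open>c - 1\<close> to \<open>c\<close> because the series, the power term and the
Stieltjes integral satisfy the same recurrence. The step divides by \<open>1 - c\<close>, so
it breaks down at \<open>c = 1\<close>, and no integral value of \<open>c\<close> is reached.\<close>
lemma series_stieltjes:
  fixes w :: complex
  assumes c: "c > 0" "c \<notin> \<int>" and w: "w \<notin> \<real>\<^sub>\<le>\<^sub>0"
  shows "(\<lambda>k. (- w) ^ k / (fact k * (of_real c - 1 - of_nat k))) sums
    (incomplete_gamma_term c w - Gamma (1 - of_real c) * w powr (of_real c - 1))"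
proof -
  have "(\<lambda>k. (- w) ^ k / (fact k * (of_real c - 1 - of_nat k))) sums
    (incomplete_gamma_term c w - Gamma (1 - of_real c) * w powr (of_real c - 1))"
    if "c > 0" "c \<notin> \<int>" "c < real n" for n c
    using that
  proof (induction n arbitrary: c)
    case (Suc n)
    show ?case
    proof (cases "c < 1")
      case True
      with Suc.prems show ?thesis by (intro series_stieltjes_unit w)
    next
      case False
      then have c1: "c > 1" using Suc.prems by (cases "c = 1") auto
      have "c - 1 \<notin> \<int>" using Suc.prems(2) by (metis Ints_1 Ints_add diff_add_cancel)
      with Suc c1 have IH: "(\<lambda>k. (- w) ^ k / (fact k * (of_real (c - 1) - 1 - of_nat k))) sums
        (incomplete_gamma_term (c - 1) w - Gamma (1 - of_real (c - 1)) * w powr (of_real (c - 1) - 1))"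
        by (intro Suc.IH) auto
      have nz: "of_real c - 1 - of_nat k \<noteq> (0::complex)" for k
      proof
        assume "of_real c - 1 - of_nat k = (0::complex)"
        then have "complex_of_real c = complex_of_real (1 + real k)" by (simp add: algebra_simps)
        then have "c = 1 + real k" by (simp only: of_real_eq_iff)
        with Suc.prems(2) show False by auto
      qed
      define g where "g = (\<lambda>k. (1 - of_real c) * ((- w) ^ k / (fact k * (of_real c - 1 - of_nat k))) + (- w) ^ k /\<^sub>R fact k)"
      have g0: "g 0 = 0" using nz[of 0] by (simp add: g_def field_simps)
      have gSuc: "g (Suc k) = w * ((- w) ^ k / (fact k * (of_real (c - 1) - 1 - of_nat k)))" for k
      proof -
        define q :: complex where "q = of_real c - 1 - of_nat (Suc k)"
        have q: "q \<noteq> 0" using nz[of "Suc k"] by (simp add: q_def)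
        have e: "1 - of_real c = - q - of_nat (Suc k)" "of_real (c - 1) - 1 - of_nat k = q"
          by (simp_all add: q_def)
        define A where "A = (- w) ^ Suc k"
        define F :: complex where "F = fact (Suc k)"
        have "F \<noteq> 0" by (simp add: F_def del: fact_Suc)
        have "g (Suc k) = (1 - of_real c) * (A / (F * q)) + A / F"
          unfolding g_def A_def F_def q_def scaleR_conv_of_real
          by (simp only: divide_inverse mult.commute of_real_inverse of_real_fact)
        also have "\<dots> = A / F * ((1 - of_real c) / q + 1)"
          using q \<open>F \<noteq> 0\<close> by (simp add: field_simps)
        finally have "g (Suc k) = (- w) ^ Suc k / fact (Suc k) * ((1 - of_real c) / q + 1)"
          by (simp only: A_def F_def)
        also have "(1 - of_real c) / q + 1 = - of_nat (Suc k) / q"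
          using q unfolding e by (simp add: field_simps)
        also have "(- w) ^ Suc k / fact (Suc k) * (- of_nat (Suc k) / q) = w * ((- w) ^ k / (fact k * q))"
          using q of_nat_neq_0[of k, where 'a = complex]
          by (simp add: fact_Suc divide_simps del: of_nat_Suc)
        finally show ?thesis unfolding e .
      qed
      have "(\<lambda>k. g (Suc k)) sums (w * (incomplete_gamma_term (c - 1) w -
          Gamma (1 - of_real (c - 1)) * w powr (of_real (c - 1) - 1)))"
        unfolding gSuc using IH by (rule sums_mult)
      then have "g sums (w * (incomplete_gamma_term (c - 1) w -
          Gamma (1 - of_real (c - 1)) * w powr (of_real (c - 1) - 1)))"
        by (simp add: sums_Suc_iff g0)
      from sums_diff[OF this exp_converges[of "- w"]]
      have "(\<lambda>k. (1 - of_real c) * ((- w) ^ k / (fact k * (of_real c - 1 - of_nat k)))) sums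
          (w * (incomplete_gamma_term (c - 1) w -
            Gamma (1 - of_real (c - 1)) * w powr (of_real (c - 1) - 1)) - exp (- w))"
        by (simp add: g_def)
      also have "w * (incomplete_gamma_term (c - 1) w -
            Gamma (1 - of_real (c - 1)) * w powr (of_real (c - 1) - 1)) - exp (- w) =
          (1 - of_real c) * (incomplete_gamma_term c w - Gamma (1 - of_real c) * w powr (of_real c - 1))"
      proof -
        have "1 - of_real c \<notin> (\<int>\<^sub>\<le>\<^sub>0 :: complex set)"
        proof
          assume "1 - of_real c \<in> (\<int>\<^sub>\<le>\<^sub>0 :: complex set)"
          then obtain m where "1 - of_real c = - (of_nat m :: complex)" by (auto elim: nonpos_Ints_cases')
          then have "of_real c - 1 - of_nat m = (0::complex)" by (simp add: algebra_simps)
          with nz[of m] show False by simp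
        qed
        then have "Gamma (1 - of_real (c - 1)) = (1 - of_real c) * Gamma (1 - of_real c :: complex)"
          using Gamma_plus1[of "1 - of_real c :: complex"] by (simp add: algebra_simps)
        moreover have "w \<noteq> 0" using w by auto
        then have "w * w powr (of_real (c - 1) - 1) = w powr (of_real c - 1)"
          using powr_add[of w 1 "of_real (c - 1) - 1"] by (simp add: algebra_simps)
        moreover note incomplete_gamma_term_recurrence[OF c1 w]
        moreover have "w * (k - g * v) - e = (w * k - e) - g * (w * v)" for k g v e :: complex
          by (simp add: algebra_simps)
        ultimately show ?thesis
          by (simp only: right_diff_distrib mult.assoc mult.left_commute[of w "Gamma _"])
      qed
      finally have "(\<lambda>k. (1 - of_real c) * ((- w) ^ k / (fact k * (of_real c - 1 - of_nat k)))) sums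
          ((1 - of_real c) * (incomplete_gamma_term c w - Gamma (1 - of_real c) * w powr (of_real c - 1)))" .
      moreover have "1 - of_real c \<noteq> (0::complex)" using nz[of 0] by simp
      ultimately show ?thesis by (subst (asm) sums_mult_iff)
    qed
  qed simp
  moreover obtain n where "c < real n" using reals_Archimedean2 by blast
  ultimately show ?thesis using c by blast
qed

text \<open>For \<open>c \<le> s\<^sub>k \<le> c + 1\<close> the powers \<open>x\<^sup>s\<close> with \<open>s = s\<^sub>k - 1\<close> are dominated by
\<open>x\<^sup>c\<^sup>-\<^sup>1 + x\<^sup>c\<close>.\<close>
lemma incomplete_gamma_term_tendsto:
  assumes c: "c > 0" and w: "w \<notin> \<real>\<^sub>\<le>\<^sub>0" and s: "\<And>k. c \<le> s k" "\<And>k. s k \<le> c + 1" "s \<longlonglongrightarrow> c"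
  shows "(\<lambda>k. incomplete_gamma_term (s k) w) \<longlonglongrightarrow> incomplete_gamma_term c w"
proof -
  obtain d where d: "d > 0" "\<And>x::real. x \<ge> 0 \<Longrightarrow> d \<le> norm (of_real x + w)"
    using dist_pos_reals[OF w] by blast
  have "(\<lambda>k. stieltjes (s k) w) \<longlonglongrightarrow> stieltjes c w"
    unfolding stieltjes_def set_lebesgue_integral_def
  proof (rule integral_dominated_convergence[where w =
      "\<lambda>x. indicator {0<..} x *\<^sub>R ((x powr (c - 1) * exp (- x) + x powr (c + 1 - 1) * exp (- x)) / d)"])
    have "set_integrable lborel {0<..} (\<lambda>x. (x powr (c - 1) * exp (- x) + x powr (c + 1 - 1) * exp (- x)) / d)"
      using c by (intro set_integrable_divide set_integral_add(1) set_integral_Gamma(1)) auto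
    then show "integrable lborel (\<lambda>x. indicator {0<..} x *\<^sub>R ((x powr (c - 1) * exp (- x) + x powr (c + 1 - 1) * exp (- x)) / d))"
      by (simp add: set_integrable_def)
    show "AE x in lborel. (\<lambda>k. indicator {0<..} x *\<^sub>R (of_real (x powr (s k - 1) * exp (- x)) / (of_real x + w)))
       \<longlonglongrightarrow> indicator {0<..} x *\<^sub>R (of_real (x powr (c - 1) * exp (- x)) / (of_real x + w))"
    proof (intro AE_I2)
      fix x :: real
      show "(\<lambda>k. indicator {0<..} x *\<^sub>R (of_real (x powr (s k - 1) * exp (- x)) / (of_real x + w)))
       \<longlonglongrightarrow> indicator {0<..} x *\<^sub>R (of_real (x powr (c - 1) * exp (- x)) / (of_real x + w))"
      proof (cases "x > 0")
        case True
        moreover have "of_real x + w \<noteq> 0" using d(2)[of x] d(1) True by auto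
        ultimately show ?thesis using s(3) by (auto intro!: tendsto_intros)
      qed simp
    qed
    show "AE x in lborel. norm (indicator {0<..} x *\<^sub>R (of_real (x powr (s k - 1) * exp (- x)) / (of_real x + w)))
       \<le> indicator {0<..} x *\<^sub>R ((x powr (c - 1) * exp (- x) + x powr (c + 1 - 1) * exp (- x)) / d)" for k
    proof (intro AE_I2)
      fix x :: real
      show "norm (indicator {0<..} x *\<^sub>R (of_real (x powr (s k - 1) * exp (- x)) / (of_real x + w)))
       \<le> indicator {0<..} x *\<^sub>R ((x powr (c - 1) * exp (- x) + x powr (c + 1 - 1) * exp (- x)) / d)"
      proof (cases "x > 0")
        case True
        have "x powr (s k - 1) \<le> x powr (c - 1) + x powr (c + 1 - 1)"
        proof (cases "x \<ge> 1")
          case True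
          then have "x powr (s k - 1) \<le> x powr (c + 1 - 1)" using s(2)[of k] by (intro powr_mono) auto
          then show ?thesis by (simp add: add_increasing)
        next
          case False
          then have "x powr (s k - 1) \<le> x powr (c - 1)" using s(1)[of k] \<open>x > 0\<close> by (intro powr_mono') auto
          then show ?thesis by (simp add: add_increasing2)
        qed
        then have "x powr (s k - 1) * exp (- x) \<le> (x powr (c - 1) + x powr (c + 1 - 1)) * exp (- x)"
          by (rule mult_right_mono) simp
        then have "x powr (s k - 1) * exp (- x) \<le> x powr (c - 1) * exp (- x) + x powr (c + 1 - 1) * exp (- x)"
          by (simp only: distrib_right)
        then have "(x powr (s k - 1) * exp (- x)) / norm (of_real x + w) \<le>
            (x powr (c - 1) * exp (- x) + x powr (c + 1 - 1) * exp (- x)) / d"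
          using d True by (intro frac_le) auto
        then show ?thesis using True by (simp add: norm_divide norm_mult)
      qed simp
    qed
  qed measurable
  moreover have "(\<lambda>k. complex_of_real (Gamma (s k))) \<longlonglongrightarrow> of_real (Gamma c)"
    using c s(3) by (intro tendsto_of_real tendsto_Gamma) (auto simp: nonpos_Ints_def)
  moreover have "complex_of_real (Gamma c) \<noteq> 0" using Gamma_real_pos[OF c] by simp
  ultimately show ?thesis unfolding incomplete_gamma_term_def
    by (intro tendsto_mult tendsto_divide tendsto_const)
qed

section \<open>The loop integral as a Stieltjes integral\<close>

text \<open>The simplest core: the cut-off loop is the boundary of a rectangle, so its winding numbers are known.\<close>
definition hankel_contour :: "real \<Rightarrow> real \<Rightarrow> complex" where
  "hankel_contour \<sigma> = linepath (Complex \<sigma> (- 1)) (Complex \<sigma> 1)"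

lemma hankel_loop_hankel_contour [simp]: "hankel_loop (hankel_contour \<sigma>)"
  by (simp add: hankel_loop_def hankel_contour_def)

lemma loop_image_hankel_contour:
  assumes "u \<in> loop_image (hankel_contour \<sigma>)"
  shows "Re u \<le> \<sigma>" "\<bar>Im u\<bar> \<le> 1" "\<bar>Im u\<bar> = 1 \<or> Re u = \<sigma>"
  using assms
  by (auto simp: loop_image_def hankel_contour_def left_ray_def closed_segment_same_Re closed_segment_eq_real_ivl)

lemma closed_loop_hankel_contour:
  "closed_loop (hankel_contour \<sigma>) R = rectpath (Complex (- R) (- 1)) (Complex \<sigma> 1)"
  by (simp add: closed_loop_def hankel_contour_def rectpath_def Let_def)

lemma hankel_contour_winding:
  assumes "Im p = 0" "Re p \<noteq> \<sigma>"
  shows "p \<notin> loop_image (hankel_contour \<sigma>)"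
    and "\<forall>\<^sub>F R in at_top. winding_number (closed_loop (hankel_contour \<sigma>) R) p = (if Re p < \<sigma> then 1 else 0)"
proof -
  show "p \<notin> loop_image (hankel_contour \<sigma>)" using loop_image_hankel_contour(3)[of p \<sigma>] assms by auto
  show "\<forall>\<^sub>F R in at_top. winding_number (closed_loop (hankel_contour \<sigma>) R) p = (if Re p < \<sigma> then 1 else 0)"
    using eventually_gt_at_top[of "max (- Re p) (- \<sigma>)"]
  proof eventually_elim
    case (elim R)
    show ?case
    proof (cases "Re p < \<sigma>")
      case True
      then show ?thesis using elim assms unfolding closed_loop_hankel_contour
        by (subst winding_number_rectpath) (auto simp: in_box_complex_iff)
    next
      case False
      then show ?thesis using elim assms unfolding closed_loop_hankel_contour
        by (subst winding_number_rectpath_outside) (auto simp: in_cbox_complex_iff)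
    qed
  qed
qed

lemma encircles_hankel_contour:
  assumes "\<And>p. p \<in> P \<Longrightarrow> Im p = 0 \<and> Re p < \<sigma>"
  shows "encircles (hankel_contour \<sigma>) P"
  unfolding encircles_def
proof (intro ballI conjI)
  fix p assume "p \<in> P"
  then have p: "Im p = 0" "Re p < \<sigma>" using assms by auto
  show "p \<notin> loop_image (hankel_contour \<sigma>)" using p by (intro hankel_contour_winding) auto
  show "\<forall>\<^sub>F R in at_top. winding_number (closed_loop (hankel_contour \<sigma>) R) p = 1"
    using hankel_contour_winding(2)[of p \<sigma>] p by simp
qed

lemma kernel_poles_bound:
  assumes "p \<in> kernel_poles c"
  shows "Im p = 0" "Re p \<le> max 0 (1 - c)"
  using assms by (auto simp: kernel_poles_def elim!: nonpos_Ints_cases')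

lemma loop_integral_hankel_contour_diff_bound:
  assumes f: "loop_integrable (hankel_contour \<sigma>) f" "loop_integrable (hankel_contour \<sigma>) h" and E: "E \<ge> 0"
    and bd: "\<And>u. u \<in> loop_image (hankel_contour \<sigma>) \<Longrightarrow> norm (f u - h u) \<le> E * exp (Re u)"
  shows "norm (loop_integral (hankel_contour \<sigma>) f - loop_integral (hankel_contour \<sigma>) h) \<le>
    E * (exp \<sigma> * (2 * (LINT t:{0..}|lborel. exp (- t)) + 2))"
proof -
  define A where "A = Complex \<sigma> (- 1)"
  define B where "B = Complex \<sigma> 1"
  define I where "I = (LINT t:{0::real..}|lborel. exp (- t))"
  have ends: "pathstart (hankel_contour \<sigma>) = A" "pathfinish (hankel_contour \<sigma>) = B"
    by (simp_all add: hankel_contour_def A_def B_def)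
  have core: "hankel_contour \<sigma> = linepath A B" by (simp add: hankel_contour_def A_def B_def)
  have ray: "norm ((LINT t:{0..}|lborel. f (a - complex_of_real t)) - (LINT t:{0..}|lborel. h (a - complex_of_real t))) \<le> E * exp \<sigma> * I"
    if a: "set_integrable lborel {0..} (\<lambda>t. f (a - complex_of_real t))"
      "set_integrable lborel {0..} (\<lambda>t. h (a - complex_of_real t))"
      "left_ray a \<subseteq> loop_image (hankel_contour \<sigma>)" "Re a = \<sigma>" for a
  proof -
    have "norm ((LINT t:{0..}|lborel. f (a - complex_of_real t)) - (LINT t:{0..}|lborel. h (a - complex_of_real t))) =
        norm (LINT t:{0..}|lborel. f (a - complex_of_real t) - h (a - complex_of_real t))"
      using set_integral_diff(2)[OF a(1,2)] by simp
    also have "\<dots> \<le> (LINT t:{0..}|lborel. norm (f (a - complex_of_real t) - h (a - complex_of_real t)))"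
      by (intro set_integral_norm_bound set_integral_diff(1) a)
    also have "\<dots> \<le> (LINT t:{0..}|lborel. E * exp \<sigma> * exp (- t))"
    proof (rule set_integral_mono)
      show "set_integrable lborel {0..} (\<lambda>t. norm (f (a - complex_of_real t) - h (a - complex_of_real t)))"
        by (intro set_integrable_norm set_integral_diff(1) a)
      show "set_integrable lborel {0..} (\<lambda>t::real. E * exp \<sigma> * exp (- t))"
        by (intro set_integrable_mult_right impI set_integrable_exp_minus)
      fix t :: real assume "t \<in> {0..}"
      then have "a - complex_of_real t \<in> loop_image (hankel_contour \<sigma>)"
        using a(3) by (auto simp: left_ray_def)
      from bd[OF this] show "norm (f (a - complex_of_real t) - h (a - complex_of_real t)) \<le> E * exp \<sigma> * exp (- t)"
        using a(4) by (simp add: exp_diff exp_minus divide_inverse mult_ac)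
    qed
    also have "\<dots> = E * exp \<sigma> * I" unfolding I_def by (rule set_integral_mult_right)
    finally show ?thesis .
  qed
  have mid: "norm (contour_integral (hankel_contour \<sigma>) f - contour_integral (hankel_contour \<sigma>) h) \<le> E * exp \<sigma> * 2"
  proof -
    have int: "f contour_integrable_on hankel_contour \<sigma>" "h contour_integrable_on hankel_contour \<sigma>"
      using f by (auto simp: loop_integrable_def)
    have "contour_integral (hankel_contour \<sigma>) f - contour_integral (hankel_contour \<sigma>) h =
        contour_integral (linepath A B) (\<lambda>u. f u - h u)"
      using int by (simp add: contour_integral_diff core)
    also have "norm \<dots> \<le> E * exp \<sigma> * norm (B - A)"
    proof (rule contour_integral_bound_linepath)
      show "(\<lambda>u. f u - h u) contour_integrable_on linepath A B"
        using contour_integrable_diff[OF int] by (simp add: core)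
      fix u assume u: "u \<in> closed_segment A B"
      then have "u \<in> loop_image (hankel_contour \<sigma>)" by (simp add: loop_image_def core)
      moreover have "Re u = \<sigma>" using u by (auto simp: A_def B_def closed_segment_same_Re)
      ultimately show "norm (f u - h u) \<le> E * exp \<sigma>" using bd by blast
    qed (use E in auto)
    also have "norm (B - A) = 2" by (simp add: A_def B_def norm_complex_def)
    finally show ?thesis .
  qed
  define r1 where "r1 = (\<lambda>f. LINT t:{0..}|lborel. f (A - complex_of_real t) :: complex)"
  define r2 where "r2 = (\<lambda>f. LINT t:{0..}|lborel. f (B - complex_of_real t) :: complex)"
  have "norm (r1 f - r1 h) \<le> E * exp \<sigma> * I" "norm (r2 f - r2 h) \<le> E * exp \<sigma> * I"
    unfolding r1_def r2_def
    by (rule ray; use f in \<open>auto simp: loop_integrable_def ends loop_image_def A_def B_def\<close>)+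
  moreover have "loop_integral (hankel_contour \<sigma>) f - loop_integral (hankel_contour \<sigma>) h =
      (r1 f - r1 h) + (contour_integral (hankel_contour \<sigma>) f - contour_integral (hankel_contour \<sigma>) h) - (r2 f - r2 h)"
    by (simp add: loop_integral_def ends r1_def r2_def)
  moreover have "norm \<dots> \<le> norm (r1 f - r1 h) +
      norm (contour_integral (hankel_contour \<sigma>) f - contour_integral (hankel_contour \<sigma>) h) + norm (r2 f - r2 h)"
    by (metis (no_types, lifting) add_mono_thms_linordered_semiring(3) norm_triangle_ineq norm_triangle_ineq4 order_trans)
  ultimately have "norm (loop_integral (hankel_contour \<sigma>) f - loop_integral (hankel_contour \<sigma>) h) \<le>
      E * exp \<sigma> * I + E * exp \<sigma> * 2 + E * exp \<sigma> * I"
    using mid by (simp only:)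
  then show ?thesis unfolding I_def [symmetric] by (simp add: algebra_simps)
qed

text \<open>The key identity. For integral \<open>c\<close> it is obtained from the nonintegers
\<open>s\<^sub>k = c + 1 / (k + 2)\<close> on the loop through \<open>2\<close>. As \<open>c > 0\<close>, every pole
\<open>1 - s\<^sub>k\<close> has distance at least \<open>1\<close> from that loop, so the integrals depend Lipschitz
continuously on the parameter.\<close>
lemma loop_integral_kernel:
  assumes g: "hankel_loop g" and P: "encircles g (kernel_poles c)" and w: "w \<notin> \<real>\<^sub>\<le>\<^sub>0" and c: "c > 0"
  shows "loop_integral g (kernel w c) = 2 * pi * \<i> * incomplete_gamma_term c w"
proof -
  have w0: "w \<noteq> 0" using w by auto
  have std: "encircles (hankel_contour 2) (kernel_poles c)" if "c > 0" for c
  proof (rule encircles_hankel_contour)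
    fix p assume "p \<in> kernel_poles c"
    from kernel_poles_bound[OF this] that show "Im p = 0 \<and> Re p < 2" by simp
  qed
  \<comment> \<open>Two expansions with the same terms have the same sum.\<close>
  have noninteger: "loop_integral (hankel_contour 2) (kernel w c) = 2 * pi * \<i> * incomplete_gamma_term c w"
    if c: "c > 0" "c \<notin> \<int>" for c
  proof -
    have "loop_integral (hankel_contour 2) (kernel w c) / (2 * pi * \<i>) - Gamma (1 - of_real c) * w powr (of_real c - 1) =
      incomplete_gamma_term c w - Gamma (1 - of_real c) * w powr (of_real c - 1)"
      using kernel_residue_sums[OF hankel_loop_hankel_contour std[OF c(1)] w0 c(2)] series_stieltjes[OF c w]
      by (rule sums_unique2)
    then show ?thesis by (simp add: field_simps)
  qed
  have "loop_integral (hankel_contour 2) (kernel w c) = 2 * pi * \<i> * incomplete_gamma_term c w"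
  proof (cases "c \<in> \<int>")
    case True
    \<comment> \<open>Strictly between two consecutive integers.\<close>
    define s where "s = (\<lambda>k. c + 1 / (real k + 2))"
    have s: "c < s k" "s k < c + 1" for k by (simp_all add: s_def)
    have nonint: "s k \<notin> \<int>" for k
    proof
      assume "s k \<in> \<int>"
      with True have "s k - c \<in> \<int>" by simp
      then obtain m where m: "s k - c = of_int m" by (auto elim: Ints_cases)
      moreover have "0 < s k - c" "s k - c < 1" using s[of k] by simp_all
      ultimately show False by simp
    qed
    have s_lim: "s \<longlonglongrightarrow> c"
    proof -
      have "(\<lambda>k. c + 1 / (real k + 2)) \<longlonglongrightarrow> c + 0"
        by (intro tendsto_add tendsto_const tendsto_divide_0[OF tendsto_const])
          (auto intro!: filterlim_at_top_imp_at_infinity filterlim_tendsto_add_at_top[OF tendsto_const]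
             filterlim_real_sequentially simp: add.commute[of _ 2])
      then show ?thesis by (simp add: s_def)
    qed
    obtain C where C: "C \<ge> 0"
      "\<And>u::complex. Re u \<le> 2 \<Longrightarrow> \<bar>Im u\<bar> \<le> 1 \<Longrightarrow> (\<And>k::nat. 1 \<le> norm (u + of_nat k)) \<Longrightarrow>
          norm (Gamma u * w powr (- u)) \<le> C * exp (Re u)"
      using kernel_decay_left[OF w0, of 1 2 1] by auto
    have integrable: "loop_integrable (hankel_contour 2) (kernel w c)" if "c > 0" for c
    proof -
      obtain N where "c \<le> real N" using real_arch_simple by blast
      then show ?thesis by (rule kernel_loop(1)[OF hankel_loop_hankel_contour std[OF that] w0])
    qed
    define K where "K = C * (exp 2 * (2 * (LINT t:{0::real..}|lborel. exp (- t)) + 2))"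
    have diff: "norm (loop_integral (hankel_contour 2) (kernel w (s k)) - loop_integral (hankel_contour 2) (kernel w c)) \<le> K * (s k - c)" for k
    proof -
      have "norm (loop_integral (hankel_contour 2) (kernel w (s k)) - loop_integral (hankel_contour 2) (kernel w c)) \<le>
        (C * (s k - c)) * (exp 2 * (2 * (LINT t:{0::real..}|lborel. exp (- t)) + 2))"
      proof (rule loop_integral_hankel_contour_diff_bound)
        fix u assume "u \<in> loop_image (hankel_contour 2)"
        note u = loop_image_hankel_contour[OF this]
        have far: "1 \<le> norm (u + of_real x)" if "x \<ge> - 1" for x :: real
          using u(3) that abs_Re_le_cmod[of "u + of_real x"] abs_Im_le_cmod[of "u + of_real x"] by auto
        have f1: "1 \<le> norm (u + of_real (s k) - 1)" "1 \<le> norm (u + of_real c - 1)"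
          using far[of "s k - 1"] far[of "c - 1"] c s(1)[of k] by (simp_all add: add_diff_eq)
        define G where "G = Gamma u * w powr (- u)"
        have "kernel w (s k) u - kernel w c u = G * (of_real (c - s k) / ((u + of_real (s k) - 1) * (u + of_real c - 1)))"
        proof -
          define X where "X = u + of_real (s k) - 1"
          define Y where "Y = u + of_real c - 1"
          have "X \<noteq> 0" "Y \<noteq> 0" using f1 by (auto simp: X_def Y_def)
          then have "G / X - G / Y = G * ((Y - X) / (X * Y))" by (simp add: field_simps)
          moreover have "of_real (c - s k) = Y - X" by (simp add: X_def Y_def)
          ultimately show ?thesis
            unfolding kernel_def G_def [symmetric] X_def [symmetric] Y_def [symmetric] by simp
        qed
        then have "norm (kernel w (s k) u - kernel w c u) = norm G * ((s k - c) / (norm (u + of_real (s k) - 1) * norm (u + of_real c - 1)))"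
          using s(1)[of k] by (simp add: norm_mult norm_divide del: of_real_diff)
        also have "\<dots> \<le> (C * exp (Re u)) * ((s k - c) / (1 * 1))"
          unfolding G_def using u f1 s(1)[of k] C(1) far[of "real _"]
          by (intro mult_mono C(2) frac_le mult_mono) auto
        finally show "norm (kernel w (s k) u - kernel w c u) \<le> C * (s k - c) * exp (Re u)" by (simp add: mult_ac)
      qed (use C(1) c s(1)[of k] in \<open>auto intro!: integrable\<close>)
      then show ?thesis by (simp add: K_def mult_ac)
    qed
    have "(\<lambda>k. loop_integral (hankel_contour 2) (kernel w (s k)) - loop_integral (hankel_contour 2) (kernel w c)) \<longlonglongrightarrow> 0"
    proof (rule Lim_null_comparison[OF always_eventually])
      show "\<forall>k. norm (loop_integral (hankel_contour 2) (kernel w (s k)) - loop_integral (hankel_contour 2) (kernel w c)) \<le> K * (s k - c)"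
        using diff by blast
      have "(\<lambda>k. K * (s k - c)) \<longlonglongrightarrow> K * (c - c)" by (intro tendsto_intros s_lim)
      then show "(\<lambda>k. K * (s k - c)) \<longlonglongrightarrow> 0" by simp
    qed
    then have "(\<lambda>k. loop_integral (hankel_contour 2) (kernel w (s k))) \<longlonglongrightarrow> loop_integral (hankel_contour 2) (kernel w c)"
      by (simp add: LIM_zero_iff)
    moreover have "loop_integral (hankel_contour 2) (kernel w (s k)) = 2 * pi * \<i> * incomplete_gamma_term (s k) w" for k
      using s(1)[of k] c by (intro noninteger nonint) auto
    moreover have "(\<lambda>k. 2 * pi * \<i> * incomplete_gamma_term (s k) w) \<longlonglongrightarrow> 2 * pi * \<i> * incomplete_gamma_term c w"
      using s by (intro tendsto_intros incomplete_gamma_term_tendsto c w s_lim less_imp_le)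
    ultimately show ?thesis by (simp add: LIMSEQ_unique)
  qed (use noninteger c in blast)
  then show ?thesis
    using loop_integral_kernel_cong[OF g P hankel_loop_hankel_contour std[OF c] w0] by simp
qed

section \<open>Partial fractions\<close>

lemma degree_prod_linear_le:
  "degree (\<Prod>j<n. [:c j, - 1 :: 'a :: {comm_ring_1}:]) \<le> n"
  by (rule order_trans[OF degree_prod_sum_le]) (auto intro!: order_trans[OF sum_mono[of _ _ "\<lambda>_. 1"]])

text \<open>The residue of \<open>(\<beta> - x)\<^sub>n / (x)\<^sub>n\<^sub>+\<^sub>1\<close> at \<open>x = - j\<close>; up to normalisation also
the \<open>j\<close>-th coefficient of the Jacobi polynomial of degree \<open>n\<close> on \<open>[0, 1]\<close> with weight
\<open>t\<^sup>\<beta>\<^sup>-\<^sup>1\<close>.\<close>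
definition cauchy_residue :: "'a :: field_char_0 \<Rightarrow> nat \<Rightarrow> nat \<Rightarrow> 'a" where
  "cauchy_residue \<beta> n j = (- 1) ^ j * pochhammer (\<beta> + of_nat j) n / (fact j * fact (n - j))"

lemma prod_diff_fact:
  assumes "j \<le> n"
  shows "(\<Prod>i\<in>{..n} - {j}. of_nat i - of_nat j :: 'a :: field_char_0) = (- 1) ^ j * fact j * fact (n - j)"
proof -
  have eq: "{..n} - {j} = {..<j} \<union> {Suc j..n}" using assms by auto
  have "(\<Prod>i\<in>{..n} - {j}. of_nat i - of_nat j :: 'a) =
        (\<Prod>i<j. of_nat i - of_nat j) * (\<Prod>i=Suc j..n. of_nat i - of_nat j)"
    unfolding eq by (rule prod.union_disjoint) auto
  also have "(\<Prod>i<j. of_nat i - of_nat j :: 'a) = (\<Prod>i<j. - of_nat (Suc i))"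
    by (subst prod.nat_diff_reindex [symmetric]) (auto intro!: prod.cong simp: of_nat_diff)
  also have "\<dots> = (- 1) ^ j * fact j"
    by (induction j) (auto simp: algebra_simps)
  also have "(\<Prod>i=Suc j..n. of_nat i - of_nat j :: 'a) = (\<Prod>i=1..n - j. of_nat i)"
    by (rule prod.reindex_bij_witness[of _ "\<lambda>i. i + j" "\<lambda>i. i - j"])
       (use assms in \<open>auto simp: of_nat_diff\<close>)
  also have "\<dots> = fact (n - j)" by (simp add: fact_prod)
  finally show ?thesis by simp
qed

text \<open>Lagrange interpolation: after multiplication by the denominator both sides are polynomials of degree at
most \<open>n\<close> that agree at the \<open>n + 1\<close> points \<open>0, -1, \<dots>, -n\<close>.\<close>
lemma partial_fractions:
  fixes x \<beta> :: "'a :: field_char_0"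
  assumes x: "\<And>j. j \<le> n \<Longrightarrow> x + of_nat j \<noteq> 0"
  shows "pochhammer (\<beta> - x) n / pochhammer x (Suc n) = (\<Sum>j\<le>n. cauchy_residue \<beta> n j / (x + of_nat j))"
proof -
  define P :: "'a poly" where "P = (\<Prod>k<n. [:\<beta> + of_nat k, - 1:])"
  define Q :: "'a poly" where
    "Q = (\<Sum>j\<le>n. smult (cauchy_residue \<beta> n j) (\<Prod>i\<in>{..n} - {j}. [:of_nat i, 1:]))"
  have P: "poly P y = pochhammer (\<beta> - y) n" for y
    by (simp add: P_def poly_prod pochhammer_prod algebra_simps flip: atLeast0LessThan)
  have Q: "poly Q y = (\<Sum>j\<le>n. cauchy_residue \<beta> n j * (\<Prod>i\<in>{..n} - {j}. of_nat i + y))" for y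
    by (simp add: Q_def poly_sum poly_prod)
  have "P = Q"
  proof (rule poly_eqI_degree)
    fix y assume "y \<in> (\<lambda>j. - of_nat j :: 'a) ` {..n}"
    then obtain j where j: "j \<le> n" "y = - of_nat j" by auto
    have "poly Q y = (\<Sum>k\<in>{j}. cauchy_residue \<beta> n k * (\<Prod>i\<in>{..n} - {k}. of_nat i + y))"
      unfolding Q
    proof (rule sum.mono_neutral_right)
      show "\<forall>k\<in>{..n} - {j}. cauchy_residue \<beta> n k * (\<Prod>i\<in>{..n} - {k}. of_nat i + y) = 0"
        using j by (auto intro!: prod_zero bexI[of _ j])
    qed (use j in auto)
    also have "\<dots> = pochhammer (\<beta> - y) n"
      using j prod_diff_fact[OF j(1), where 'a = 'a]
      by (simp add: cauchy_residue_def field_simps flip: power_add)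
    finally show "poly P y = poly Q y" by (simp add: P)
  next
    have card: "card ((\<lambda>j. - of_nat j :: 'a) ` {..n}) = Suc n"
      by (subst card_image) (auto simp: inj_on_def)
    have "degree P \<le> n" unfolding P_def by (rule degree_prod_linear_le)
    then show "degree P < card ((\<lambda>j. - of_nat j :: 'a) ` {..n})" by (simp add: card)
    have "degree Q \<le> n" unfolding Q_def
    proof (rule degree_sum_le)
      fix j assume "j \<in> {..n}"
      then have "(\<Sum>i\<in>{..n} - {j}. degree [:of_nat i, 1 :: 'a:]) = n" by simp
      then have "degree (\<Prod>i\<in>{..n} - {j}. [:of_nat i, 1 :: 'a:]) \<le> n"
        using degree_prod_sum_le[of "{..n} - {j}" "\<lambda>i. [:of_nat i, 1 :: 'a:]"] by simp
      then show "degree (smult (cauchy_residue \<beta> n j) (\<Prod>i\<in>{..n} - {j}. [:of_nat i, 1:])) \<le> n"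
        using degree_smult_le order_trans by blast
    qed auto
    then show "degree Q < card ((\<lambda>j. - of_nat j :: 'a) ` {..n})" by (simp add: card)
  qed
  then have "pochhammer (\<beta> - x) n = poly Q x" by (simp flip: P)
  also have "\<dots> = (\<Sum>j\<le>n. cauchy_residue \<beta> n j / (x + of_nat j) * pochhammer x (Suc n))"
    unfolding Q
  proof (rule sum.cong[OF refl])
    fix j assume j: "j \<in> {..n}"
    have "pochhammer x (Suc n) = (\<Prod>i\<in>{..n}. of_nat i + x)"
      by (simp only: pochhammer_prod atLeast0LessThan lessThan_Suc_atMost add.commute)
    also have "\<dots> = (x + of_nat j) * (\<Prod>i\<in>{..n} - {j}. of_nat i + x)"
      using j by (subst prod.remove[of _ j]) (auto simp: add.commute)
    finally show "cauchy_residue \<beta> n j * (\<Prod>i\<in>{..n} - {j}. of_nat i + x) =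
        cauchy_residue \<beta> n j / (x + of_nat j) * pochhammer x (Suc n)"
      using x[of j] j by simp
  qed
  also have "\<dots> = (\<Sum>j\<le>n. cauchy_residue \<beta> n j / (x + of_nat j)) * pochhammer x (Suc n)"
    by (simp add: sum_distrib_right)
  finally have eq: "pochhammer (\<beta> - x) n =
      (\<Sum>j\<le>n. cauchy_residue \<beta> n j / (x + of_nat j)) * pochhammer x (Suc n)" .
  have "pochhammer x (Suc n) \<noteq> 0"
    using x by (auto simp: pochhammer_eq_0_iff add_eq_0_iff2 less_Suc_eq_le)
  then show ?thesis using eq by simp
qed

section \<open>The biorthogonal polynomials\<close>

definition bimoment :: "real \<Rightarrow> real \<Rightarrow> nat \<Rightarrow> nat \<Rightarrow> real" where
  "bimoment a b i j = Gamma (a + real i + 1) * Gamma (b + real j + 1) / (a + b + real i + real j + 1)"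

lemma bimoment_swap: "bimoment b a j i = bimoment a b i j"
  by (simp add: bimoment_def add_ac mult_ac)

definition cauchy_weight :: "real \<Rightarrow> real \<Rightarrow> real \<Rightarrow> real \<Rightarrow> real" where
  "cauchy_weight a b x y = x powr a * y powr b * exp (- x - y) / (x + y)"

text \<open>The value comes from the nonnegative computation above. The integrability of the inner and of
the outer integral is recorded as well, since the pairing is an iterated integral and can be expanded into
bimoments only term by term.\<close>
lemma bimoment_integral:
  assumes a: "a > -1" and b: "b > -1" and ab: "a + b > -1"
  shows "\<And>x. x > 0 \<Longrightarrow> set_integrable lborel {0<..} (\<lambda>y. cauchy_weight a b x y * x ^ i * y ^ j)"
    and "set_integrable lborel {0<..} (\<lambda>x. LINT y:{0<..}|lborel. cauchy_weight a b x y * x ^ i * y ^ j)"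
    and "(LINT x:{0<..}|lborel. LINT y:{0<..}|lborel. cauchy_weight a b x y * x ^ i * y ^ j) = bimoment a b i j"
proof -
  define A where "A = a + real i + 1"
  define B where "B = b + real j + 1"
  have A: "A > 0" and B: "B > 0" and AB: "A + B > 1" using assms by (simp_all add: A_def B_def)
  define f where "f = (\<lambda>x y. x powr (A - 1) * y powr (B - 1) * exp (- x - y) / (x + y))"
  have f_eq: "cauchy_weight a b x y * x ^ i * y ^ j = f x y" if "x > 0" "y > 0" for x y
    using that by (simp add: f_def cauchy_weight_def A_def B_def powr_add powr_realpow)
  have f_nonneg: "f x y \<ge> 0" if "x > 0" "y > 0" for x y
    using that by (simp add: f_def)
  have f_meas: "f x \<in> borel_measurable borel" for x unfolding f_def by measurable
  have inner: "set_integrable lborel {0<..} (f x)" if x: "x > 0" for x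
  proof (rule set_integrable_bound)
    show "set_integrable lborel {0<..} (\<lambda>y. (x powr (A - 1) * exp (- x) / x) * (y powr (B - 1) * exp (- y)))"
      by (intro set_integrable_mult_right impI set_integral_Gamma(1) B)
    show "set_borel_measurable lborel {0<..} (f x)"
      using f_meas[of x] unfolding set_borel_measurable_def by measurable
    have "norm (f x y) \<le> norm ((x powr (A - 1) * exp (- x) / x) * (y powr (B - 1) * exp (- y)))" if "y > 0" for y
    proof -
      have "f x y = x powr (A - 1) * exp (- x) * (y powr (B - 1) * exp (- y)) / (x + y)"
        by (simp add: f_def exp_diff exp_minus divide_inverse)
      also have "\<dots> \<le> x powr (A - 1) * exp (- x) * (y powr (B - 1) * exp (- y)) / x"
        using x that by (intro divide_left_mono) auto
      finally show ?thesis using f_nonneg[OF x that] x by simp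
    qed
    then show "AE y in lborel. y \<in> {0<..} \<longrightarrow> norm (f x y) \<le> norm ((x powr (A - 1) * exp (- x) / x) * (y powr (B - 1) * exp (- y)))"
      by auto
  qed
  show "set_integrable lborel {0<..} (\<lambda>y. cauchy_weight a b x y * x ^ i * y ^ j)" if x: "x > 0" for x
    using inner[OF x] by (rule set_integrable_cong[THEN iffD1, rotated -1]) (auto simp: f_eq x)
  define g where "g = (\<lambda>x. LINT y:{0<..}|lborel. f x y)"
  have g_nonneg: "g x \<ge> 0" if "x > 0" for x
    unfolding g_def set_lebesgue_integral_def
    by (intro integral_nonneg_AE AE_I2) (auto simp: indicator_def f_nonneg that)
  have g_meas: "g \<in> borel_measurable borel"
    unfolding g_def set_lebesgue_integral_def f_def by measurable
  have g_nn: "ennreal (g x) = (\<integral>\<^sup>+y. ennreal (f x y) * indicator {0<..} y \<partial>lborel)" if x: "x > 0" for x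
  proof -
    have "(\<integral>\<^sup>+y. ennreal (f x y) * indicator {0<..} y \<partial>lborel) = (\<integral>\<^sup>+y. ennreal (indicator {0<..} y *\<^sub>R f x y) \<partial>lborel)"
      by (intro nn_integral_cong) (auto simp: indicator_def)
    also have "\<dots> = ennreal (g x)"
      unfolding g_def set_lebesgue_integral_def using inner[OF x]
      by (intro nn_integral_eq_integral AE_I2) (auto simp: set_integrable_def indicator_def f_nonneg x)
    finally show ?thesis ..
  qed
  have "(\<integral>\<^sup>+x. ennreal (g x) * indicator {0<..} x \<partial>lborel) =
      (\<integral>\<^sup>+x. (\<integral>\<^sup>+y. ennreal (f x y) * indicator {0<..} y \<partial>lborel) * indicator {0<..} x \<partial>lborel)"
    by (intro nn_integral_cong) (auto simp: indicator_def g_nn split: if_splits)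
  also have "\<dots> = ennreal (Gamma A * Gamma B / (A + B - 1))"
    unfolding f_def by (rule nn_integral_bimoment[OF A B AB])
  finally have nn: "(\<integral>\<^sup>+x. ennreal (g x) * indicator {0<..} x \<partial>lborel) = ennreal (Gamma A * Gamma B / (A + B - 1))" .
  have "Gamma A * Gamma B / (A + B - 1) \<ge> 0" using A B AB by (simp add: Gamma_real_nonneg)
  note g = nonneg_set_integral_eqI[OF g_meas _ _ this nn]
  have inner_eq: "(LINT y:{0<..}|lborel. cauchy_weight a b x y * x ^ i * y ^ j) = g x" if "x > 0" for x
    unfolding g_def using that by (intro set_lebesgue_integral_cong) (auto simp: f_eq)
  show "set_integrable lborel {0<..} (\<lambda>x. LINT y:{0<..}|lborel. cauchy_weight a b x y * x ^ i * y ^ j)"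
    using g(1) g_nonneg by (subst set_integrable_cong[OF refl refl inner_eq]) auto
  have "(LINT x:{0<..}|lborel. LINT y:{0<..}|lborel. cauchy_weight a b x y * x ^ i * y ^ j) = (LINT x:{0<..}|lborel. g x)"
    by (intro set_lebesgue_integral_cong) (auto simp: inner_eq)
  also have "\<dots> = Gamma A * Gamma B / (A + B - 1)" using g(2) g_nonneg by simp
  also have "\<dots> = bimoment a b i j" by (simp add: bimoment_def A_def B_def add_ac)
  finally show "(LINT x:{0<..}|lborel. LINT y:{0<..}|lborel. cauchy_weight a b x y * x ^ i * y ^ j) = bimoment a b i j" .
qed

lemma set_integral_sum_finite:
  fixes f :: "'i \<Rightarrow> real \<Rightarrow> real"
  assumes "finite I" "\<And>i. i \<in> I \<Longrightarrow> set_integrable lborel S (f i)"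
  shows "set_integrable lborel S (\<lambda>x. \<Sum>i\<in>I. f i x)"
    and "(LINT x:S|lborel. \<Sum>i\<in>I. f i x) = (\<Sum>i\<in>I. LINT x:S|lborel. f i x)"
  using assms unfolding set_integrable_def set_lebesgue_integral_def scaleR_sum_right
  by (intro Bochner_Integration.integrable_sum Bochner_Integration.integral_sum; blast)+

lemma cauchy_laguerre_pairing_eq:
  assumes ab: "a > -1" "b > -1" "a + b > -1"
  shows "cauchy_laguerre_pairing a b P Q =
    (\<Sum>i\<le>degree P. \<Sum>j\<le>degree Q. coeff P i * coeff Q j * bimoment a b i j)"
proof -
  define m where "m = (\<lambda>i j x y. cauchy_weight a b x y * x ^ i * y ^ j)"
  have int: "set_integrable lborel {0<..} (m i j x)" if "x > 0" for i j x
    using bimoment_integral(1)[OF ab that] by (simp add: m_def)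
  have expand: "x powr a * y powr b * exp (- x - y) / (x + y) * poly P x * poly Q y =
      (\<Sum>i\<le>degree P. \<Sum>j\<le>degree Q. coeff P i * coeff Q j * m i j x y)" for x y
    by (simp add: poly_altdef m_def cauchy_weight_def sum_distrib_left sum_distrib_right sum_divide_distrib mult_ac)
  have inner: "(LINT y:{0<..}|lborel. x powr a * y powr b * exp (- x - y) / (x + y) * poly P x * poly Q y) =
      (\<Sum>i\<le>degree P. \<Sum>j\<le>degree Q. coeff P i * coeff Q j * (LINT y:{0<..}|lborel. m i j x y))" if "x > 0" for x
  proof -
    have i1: "set_integrable lborel {0<..} (\<lambda>y. coeff P i * coeff Q j * m i j x y)" for i j
      by (intro set_integrable_mult_right impI int that)
    have i2: "set_integrable lborel {0<..} (\<lambda>y. \<Sum>j\<le>degree Q. coeff P i * coeff Q j * m i j x y)" for i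
      by (intro set_integral_sum_finite(1) i1) auto
    show ?thesis
      unfolding expand by (simp only: set_integral_sum_finite(2)[OF finite_atMost i2]
          set_integral_sum_finite(2)[OF finite_atMost i1] set_integral_mult_right)
  qed
  have o1: "set_integrable lborel {0<..} (\<lambda>x. coeff P i * coeff Q j * (LINT y:{0<..}|lborel. m i j x y))" for i j
    using bimoment_integral(2)[OF ab] by (intro set_integrable_mult_right impI) (simp add: m_def)
  have o2: "set_integrable lborel {0<..} (\<lambda>x. \<Sum>j\<le>degree Q. coeff P i * coeff Q j * (LINT y:{0<..}|lborel. m i j x y))" for i
    by (intro set_integral_sum_finite(1) o1) auto
  have val: "(LINT x:{0<..}|lborel. LINT y:{0<..}|lborel. m i j x y) = bimoment a b i j" for i j
    using bimoment_integral(3)[OF ab] by (simp add: m_def)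
  have "cauchy_laguerre_pairing a b P Q = (LINT x:{0<..}|lborel.
      (\<Sum>i\<le>degree P. \<Sum>j\<le>degree Q. coeff P i * coeff Q j * (LINT y:{0<..}|lborel. m i j x y)))"
    unfolding cauchy_laguerre_pairing_def
    by (intro set_lebesgue_integral_cong allI impI inner) simp_all
  also have "\<dots> = (\<Sum>i\<le>degree P. \<Sum>j\<le>degree Q. coeff P i * coeff Q j * bimoment a b i j)"
    by (simp only: set_integral_sum_finite(2)[OF finite_atMost o2]
        set_integral_sum_finite(2)[OF finite_atMost o1] set_integral_mult_right val)
  finally show ?thesis .
qed

lemma cauchy_laguerre_pairing_eq':
  assumes ab: "a > -1" "b > -1" "a + b > -1" and N: "degree P \<le> N" "degree Q \<le> M"
  shows "cauchy_laguerre_pairing a b P Q = (\<Sum>i\<le>N. \<Sum>j\<le>M. coeff P i * coeff Q j * bimoment a b i j)"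
proof -
  have "(\<Sum>i\<le>N. \<Sum>j\<le>M. coeff P i * coeff Q j * bimoment a b i j) =
    (\<Sum>i\<le>degree P. \<Sum>j\<le>M. coeff P i * coeff Q j * bimoment a b i j)"
    using N by (intro sum.mono_neutral_right) (auto simp: coeff_eq_0)
  also have "\<dots> = (\<Sum>i\<le>degree P. \<Sum>j\<le>degree Q. coeff P i * coeff Q j * bimoment a b i j)"
    using N by (intro sum.cong refl sum.mono_neutral_right) (auto simp: coeff_eq_0)
  finally show ?thesis by (simp add: cauchy_laguerre_pairing_eq[OF ab])
qed

lemma cauchy_laguerre_pairing_sum_left:
  assumes ab: "a > -1" "b > -1" "a + b > -1" and I: "finite I"
  shows "cauchy_laguerre_pairing a b (\<Sum>k\<in>I. smult (e k) (P k)) Q = (\<Sum>k\<in>I. e k * cauchy_laguerre_pairing a b (P k) Q)"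
proof -
  define N where "N = Max (insert (degree (\<Sum>k\<in>I. smult (e k) (P k))) ((\<lambda>k. degree (P k)) ` I))"
  have N: "degree (\<Sum>k\<in>I. smult (e k) (P k)) \<le> N" "\<And>k. k \<in> I \<Longrightarrow> degree (P k) \<le> N"
    unfolding N_def using I by (auto intro!: Max_ge)
  have "cauchy_laguerre_pairing a b (\<Sum>k\<in>I. smult (e k) (P k)) Q =
    (\<Sum>i\<le>N. \<Sum>j\<le>degree Q. (\<Sum>k\<in>I. e k * (coeff (P k) i * coeff Q j * bimoment a b i j)))"
    unfolding cauchy_laguerre_pairing_eq'[OF ab N(1) order_refl]
    by (simp add: coeff_sum sum_distrib_left sum_distrib_right mult_ac)
  also have "\<dots> = (\<Sum>i\<le>N. \<Sum>k\<in>I. \<Sum>j\<le>degree Q. e k * (coeff (P k) i * coeff Q j * bimoment a b i j))"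
    by (intro sum.cong refl sum.swap)
  also have "\<dots> = (\<Sum>k\<in>I. \<Sum>i\<le>N. \<Sum>j\<le>degree Q. e k * (coeff (P k) i * coeff Q j * bimoment a b i j))"
    by (rule sum.swap)
  also have "\<dots> = (\<Sum>k\<in>I. e k * cauchy_laguerre_pairing a b (P k) Q)"
    using N(2) by (intro sum.cong refl)
      (simp add: cauchy_laguerre_pairing_eq'[OF ab _ order_refl, of _ N] sum_distrib_left)
  finally show ?thesis .
qed

text \<open>The two iterated integrals agree because the bimoments are symmetric under exchange of both parameters and
indices.\<close>
lemma cauchy_laguerre_pairing_swap:
  assumes "a > -1" "b > -1" "a + b > -1"
  shows "cauchy_laguerre_pairing b a Q P = cauchy_laguerre_pairing a b P Q"
proof -
  have "cauchy_laguerre_pairing b a Q P = (\<Sum>j\<le>degree Q. \<Sum>i\<le>degree P. coeff P i * coeff Q j * bimoment a b i j)"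
    using assms by (subst cauchy_laguerre_pairing_eq) (auto simp: bimoment_swap mult_ac)
  also have "\<dots> = (\<Sum>i\<le>degree P. \<Sum>j\<le>degree Q. coeff P i * coeff Q j * bimoment a b i j)"
    by (rule sum.swap)
  finally show ?thesis using assms by (simp add: cauchy_laguerre_pairing_eq)
qed

lemma cauchy_laguerre_biorthonormal_swap:
  assumes "a > -1" "b > -1" "a + b > -1" "cauchy_laguerre_biorthonormal a b p q"
  shows "cauchy_laguerre_biorthonormal b a q p"
  unfolding cauchy_laguerre_biorthonormal_def
proof (intro conjI allI)
  fix n l m
  show "degree (q n) = n" "degree (p n) = n" "lead_coeff (q n) = lead_coeff (p n)" "lead_coeff (q n) > 0"
    using assms(4) unfolding cauchy_laguerre_biorthonormal_def by metis+
  show "cauchy_laguerre_pairing b a (q l) (p m) = (if l = m then 1 else 0)"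
    unfolding cauchy_laguerre_pairing_swap[OF assms(1-3)]
    using assms(4) unfolding cauchy_laguerre_biorthonormal_def by metis
qed

lemma poly_expansion:
  fixes p :: "nat \<Rightarrow> 'a :: field poly"
  assumes p: "\<And>n. degree (p n) = n" "\<And>n. p n \<noteq> 0" and P: "degree P \<le> n"
  shows "\<exists>e. P = (\<Sum>k\<le>n. smult (e k) (p k))"
  using P
proof (induction n arbitrary: P)
  case 0
  then obtain x where P: "P = [:x:]" by (auto elim: degree_eq_zeroE)
  obtain y where y: "p 0 = [:y:]" using p(1)[of 0] by (auto elim: degree_eq_zeroE)
  with p(2)[of 0] have "y \<noteq> 0" by auto
  then show ?case using P y by (intro exI[of _ "\<lambda>_. x / y"]) simp
next
  case (Suc n)
  define l where "l = coeff P (Suc n) / coeff (p (Suc n)) (Suc n)"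
  have lc: "coeff (p (Suc n)) (Suc n) \<noteq> 0"
    using p(1)[of "Suc n"] p(2)[of "Suc n"] by (metis leading_coeff_neq_0)
  have "degree (P - smult l (p (Suc n))) \<le> n"
  proof (rule degree_le, intro allI impI)
    fix i assume "n < i"
    then consider "i = Suc n" | "i > Suc n" by linarith
    then show "coeff (P - smult l (p (Suc n))) i = 0"
    proof cases
      case 1
      then show ?thesis using lc by (simp add: l_def)
    next
      case 2
      then show ?thesis using Suc.prems p(1)[of "Suc n"] by (simp add: coeff_eq_0)
    qed
  qed
  from Suc.IH[OF this] obtain e where e: "P - smult l (p (Suc n)) = (\<Sum>k\<le>n. smult (e k) (p k))" by blast
  have "P = (\<Sum>k\<le>n. smult (e k) (p k)) + smult l (p (Suc n))" by (simp flip: e)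
  also have "\<dots> = (\<Sum>k\<le>Suc n. smult ((e(Suc n := l)) k) (p k))" by simp
  finally show ?case by blast
qed

text \<open>A Jacobi polynomial on \<open>[0, 1]\<close> with the coefficient of \<open>t\<^sup>j\<close> divided by \<open>\<Gamma>(a + j + 1)\<close>;
the factor cancels the first Gamma factor of the bimoments. It turns out to be \<open>p n\<close>.\<close>
definition cl_poly :: "real \<Rightarrow> real \<Rightarrow> nat \<Rightarrow> real poly" where
  "cl_poly a b n = (\<Sum>j\<le>n. monom ((- 1) ^ n * cl_pi a b n * cauchy_residue (a + b + 1) n j / Gamma (a + real j + 1)) j)"

lemma coeff_cl_poly:
  "coeff (cl_poly a b n) j =
     (if j \<le> n then (- 1) ^ n * cl_pi a b n * cauchy_residue (a + b + 1) n j / Gamma (a + real j + 1) else 0)"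
  by (simp add: cl_poly_def coeff_sum)

lemma degree_cl_poly_le: "degree (cl_poly a b n) \<le> n"
  by (intro degree_le) (simp add: coeff_cl_poly)

text \<open>The partial fraction identity at \<open>x = a + b + m + 1\<close>. The numerator is \<open>(- m)\<^sub>n\<close>, which
vanishes for \<open>m < n\<close>.\<close>
lemma pairing_cl_poly_monom:
  assumes ab: "a > -1" "b > -1" "a + b > -1"
  shows "(\<Sum>i\<le>n. coeff (cl_poly a b n) i * bimoment a b i m) =
    (- 1) ^ n * cl_pi a b n * Gamma (b + real m + 1) * pochhammer (- real m) n / pochhammer (a + b + real m + 1) (Suc n)"
proof -
  have "(\<Sum>i\<le>n. coeff (cl_poly a b n) i * bimoment a b i m) =
     (\<Sum>i\<le>n. (- 1) ^ n * cl_pi a b n * Gamma (b + real m + 1) * (cauchy_residue (a + b + 1) n i / ((a + b + real m + 1) + real i)))"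
  proof (rule sum.cong[OF refl])
    fix i assume i: "i \<in> {..n}"
    have "Gamma (a + real i + 1) > 0" using ab by (intro Gamma_real_pos) simp
    then have "Gamma (a + real i + 1) \<noteq> 0" by linarith
    then show "coeff (cl_poly a b n) i * bimoment a b i m =
      (- 1) ^ n * cl_pi a b n * Gamma (b + real m + 1) * (cauchy_residue (a + b + 1) n i / ((a + b + real m + 1) + real i))"
      using i by (simp add: coeff_cl_poly bimoment_def add_ac)
  qed
  also have "\<dots> = (- 1) ^ n * cl_pi a b n * Gamma (b + real m + 1) *
      (\<Sum>i\<le>n. cauchy_residue (a + b + 1) n i / ((a + b + real m + 1) + of_nat i))"
    by (simp add: sum_distrib_left)
  also have "(\<Sum>i\<le>n. cauchy_residue (a + b + 1) n i / ((a + b + real m + 1) + of_nat i)) =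
      pochhammer (a + b + 1 - (a + b + real m + 1)) n / pochhammer (a + b + real m + 1) (Suc n)"
    using ab by (intro partial_fractions [symmetric]) (simp add: add_eq_0_iff)
  finally show ?thesis by simp
qed

lemma pairing_cl_poly:
  assumes ab: "a > -1" "b > -1" "a + b > -1" and Q: "degree Q \<le> n"
  shows "cauchy_laguerre_pairing a b (cl_poly a b n) Q =
     coeff Q n * cl_pi a b n * Gamma (b + real n + 1) * fact n / pochhammer (a + b + real n + 1) (Suc n)"
proof -
  have "cauchy_laguerre_pairing a b (cl_poly a b n) Q =
    (\<Sum>m\<le>n. coeff Q m * (\<Sum>i\<le>n. coeff (cl_poly a b n) i * bimoment a b i m))"
    unfolding cauchy_laguerre_pairing_eq'[OF ab degree_cl_poly_le Q]
    by (subst sum.swap) (simp add: sum_distrib_left mult_ac)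
  also have "\<dots> = (\<Sum>m\<in>{n}. coeff Q m * (\<Sum>i\<le>n. coeff (cl_poly a b n) i * bimoment a b i m))"
  proof (rule sum.mono_neutral_right)
    show "\<forall>m\<in>{..n} - {n}. coeff Q m * (\<Sum>i\<le>n. coeff (cl_poly a b n) i * bimoment a b i m) = 0"
      unfolding pairing_cl_poly_monom[OF ab] by (auto simp: pochhammer_of_nat_eq_0_iff)
  qed auto
  also have "\<dots> = coeff Q n * cl_pi a b n * Gamma (b + real n + 1) * fact n / pochhammer (a + b + real n + 1) (Suc n)"
    by (simp add: pairing_cl_poly_monom[OF ab] pochhammer_same flip: power_add)
  finally show ?thesis .
qed

text \<open>Written so that the symmetry in \<open>a\<close> and \<open>b\<close> is visible: the two families of explicit polynomials
have equal leading coefficients, as required of \<open>p n\<close> and \<open>q n\<close>.\<close>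
lemma coeff_cl_poly_n:
  assumes ab: "a > -1" "b > -1" "a + b > -1"
  shows "coeff (cl_poly a b n) n = sqrt (2 * real n + (a + b) + 1) * pochhammer (a + b + 1 + real n) n /
      (fact n * sqrt (Gamma (a + real n + 1) * Gamma (b + real n + 1)))"
proof -
  have G: "Gamma (a + real n + 1) > 0" "Gamma (b + real n + 1) > 0"
    using ab by (auto intro!: Gamma_real_pos)
  have "sqrt (Gamma (a + real n + 1) / Gamma (b + real n + 1)) / Gamma (a + real n + 1) =
      1 / sqrt (Gamma (a + real n + 1) * Gamma (b + real n + 1))"
    using G by (simp add: real_sqrt_divide real_sqrt_mult field_simps)
  then have "cl_pi a b n / Gamma (a + real n + 1) =
      sqrt (2 * real n + (a + b) + 1) / sqrt (Gamma (a + real n + 1) * Gamma (b + real n + 1))"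
    unfolding cl_pi_def by (metis mult.right_neutral times_divide_eq_right)
  then have "coeff (cl_poly a b n) n = sqrt (2 * real n + (a + b) + 1) / sqrt (Gamma (a + real n + 1) * Gamma (b + real n + 1)) *
      ((- 1) ^ n * cauchy_residue (a + b + 1) n n)"
    by (simp add: coeff_cl_poly divide_inverse mult_ac)
  also have "(- 1) ^ n * cauchy_residue (a + b + 1) n n = pochhammer (a + b + 1 + real n) n / fact n"
    by (simp add: cauchy_residue_def flip: power_add)
  finally show ?thesis by simp
qed

lemma coeff_cl_poly_n_pos:
  assumes ab: "a > -1" "b > -1" "a + b > -1"
  shows "coeff (cl_poly a b n) n > 0"
  unfolding coeff_cl_poly_n[OF ab] using ab
  by (intro divide_pos_pos mult_pos_pos pochhammer_pos real_sqrt_gt_zero Gamma_real_pos) auto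

text \<open>Expand the explicit polynomial in \<open>p 0, \<dots>, p n\<close>. The coefficient of \<open>p m\<close> is its pairing
with \<open>q m\<close>, which vanishes for \<open>m < n\<close> because \<open>q m\<close> has degree less than \<open>n\<close>.\<close>
lemma cl_poly_multiple:
  assumes ab: "a > -1" "b > -1" "a + b > -1" and pq: "cauchy_laguerre_biorthonormal a b p q"
  shows "cl_poly a b n = smult (coeff (cl_poly a b n) n / lead_coeff (p n)) (p n)"
proof -
  have p: "degree (p k) = k" "lead_coeff (p k) > 0" "degree (q k) = k" for k
    using pq unfolding cauchy_laguerre_biorthonormal_def by blast+
  have nz: "p k \<noteq> 0" for k using p(2)[of k] by auto
  have orth: "cauchy_laguerre_pairing a b (p k) (q m) = (if k = m then 1 else 0)" for k m
    using pq by (simp add: cauchy_laguerre_biorthonormal_def)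
  obtain e where e: "cl_poly a b n = (\<Sum>k\<le>n. smult (e k) (p k))"
    using poly_expansion[OF p(1) nz degree_cl_poly_le[of a b n]] by blast
  have "e m = 0" if m: "m < n" for m
  proof -
    have "cauchy_laguerre_pairing a b (cl_poly a b n) (q m) = (\<Sum>k\<le>n. e k * (if k = m then 1 else 0))"
      unfolding e cauchy_laguerre_pairing_sum_left[OF ab finite_atMost] orth ..
    also have "\<dots> = e m" using m by (subst sum.mono_neutral_right[of _ "{m}"]) auto
    finally show ?thesis using pairing_cl_poly[OF ab, of "q m" n] p(3)[of m] m by (simp add: coeff_eq_0)
  qed
  then have 1: "cl_poly a b n = smult (e n) (p n)"
    unfolding e by (subst sum.mono_neutral_right[of _ "{n}"]) auto
  have ne: "lead_coeff (p n) \<noteq> 0" using p(2)[of n] by linarith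
  have "coeff (cl_poly a b n) n = e n * lead_coeff (p n)"
    unfolding 1 by (simp add: p)
  then have 2: "coeff (cl_poly a b n) n / lead_coeff (p n) = e n"
    using nonzero_mult_div_cancel_right[OF ne, of "e n"] by (rule ssubst)
  show ?thesis unfolding 2 by (rule 1)
qed

text \<open>By the previous lemma and symmetry, the explicit polynomials are \<open>e p n\<close> and \<open>e q n\<close>, with the same
\<open>e > 0\<close> since both pairs have equal leading coefficients. Pairing the first with \<open>q n\<close> gives
\<open>e\<^sup>2 = 1\<close>.\<close>
lemma cl_poly_unique:
  assumes ab: "a > -1" "b > -1" "a + b > -1" and pq: "cauchy_laguerre_biorthonormal a b p q"
  shows "p n = cl_poly a b n"
proof -
  have ba: "b > -1" "a > -1" "b + a > -1" using ab by auto
  note qp = cauchy_laguerre_biorthonormal_swap[OF ab pq]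
  have p: "degree (q n) = n" "lead_coeff (p n) > 0" "lead_coeff (q n) = lead_coeff (p n)" "degree (p n) = n"
    and orth: "cauchy_laguerre_pairing a b (p n) (q n) = 1"
    using pq unfolding cauchy_laguerre_biorthonormal_def by metis+
  define L where "L = coeff (cl_poly a b n) n"
  have L: "L > 0" unfolding L_def by (rule coeff_cl_poly_n_pos[OF ab])
  have L': "coeff (cl_poly b a n) n = L"
    unfolding L_def coeff_cl_poly_n[OF ab] coeff_cl_poly_n[OF ba] by (simp add: add_ac mult_ac)
  define e where "e = L / lead_coeff (p n)"
  have e: "e > 0" using L p(2) by (simp add: e_def)
  have P: "cl_poly a b n = smult e (p n)"
    using cl_poly_multiple[OF ab pq, of n] by (simp only: L_def e_def)
  have Q: "cl_poly b a n = smult e (q n)"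
    using cl_poly_multiple[OF ba qp, of n] by (simp only: L' e_def p(3))
  have "cauchy_laguerre_pairing a b (\<Sum>k\<in>{n}. smult e (p k)) (q n) = (\<Sum>k\<in>{n}. e * cauchy_laguerre_pairing a b (p k) (q n))"
    by (rule cauchy_laguerre_pairing_sum_left[OF ab]) simp
  then have "cauchy_laguerre_pairing a b (cl_poly a b n) (q n) = e" by (simp add: P orth)
  then have eq: "e = coeff (q n) n * cl_pi a b n * Gamma (b + real n + 1) * fact n / pochhammer (a + b + real n + 1) (Suc n)"
    using pairing_cl_poly[OF ab, of "q n" n] p(1) by simp
  have "e * coeff (q n) n = L" using L' by (simp add: Q)
  with arg_cong[OF eq, of "\<lambda>t. e * t"]
  have "e * e = L * (cl_pi a b n * Gamma (b + real n + 1)) * fact n / pochhammer (a + b + real n + 1) (Suc n)"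
    by (simp only: times_divide_eq_right mult.assoc [symmetric])
  also have "\<dots> = 1"
  proof -
    have G: "Gamma (a + real n + 1) > 0" "Gamma (b + real n + 1) > 0"
      using ab by (auto intro!: Gamma_real_pos)
    define s where "s = 2 * real n + (a + b) + 1"
    define T where "T = sqrt (Gamma (a + real n + 1) * Gamma (b + real n + 1))"
    have s: "s > 0" using ab by (simp add: s_def)
    have T: "T > 0" using G by (simp add: T_def)
    have "sqrt (Gamma (a + real n + 1) / Gamma (b + real n + 1)) * Gamma (b + real n + 1) = T"
      unfolding T_def using G by (simp add: real_sqrt_divide real_sqrt_mult field_simps)
    then have 1: "cl_pi a b n * Gamma (b + real n + 1) = sqrt s * T"
      unfolding cl_pi_def s_def by (simp only: mult.assoc)
    have 2: "L = sqrt s * pochhammer (a + b + 1 + real n) n / (fact n * T)"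
      unfolding L_def coeff_cl_poly_n[OF ab] s_def T_def ..
    have 3: "pochhammer (a + b + real n + 1) (Suc n) = pochhammer (a + b + 1 + real n) n * s"
      by (simp add: pochhammer_Suc s_def algebra_simps)
    have 4: "pochhammer (a + b + 1 + real n) n > 0" using ab by (intro pochhammer_pos) auto
    have 5: "sqrt s * sqrt s = s" using s by simp
    have "L * (sqrt s * T) * fact n / (pochhammer (a + b + 1 + real n) n * s) = (sqrt s * sqrt s) / s"
      unfolding 2 using T 4 s by (simp add: field_simps)
    also have "\<dots> = 1" using 5 s by simp
    finally show ?thesis unfolding 1 3 .
  qed
  finally have "e = 1" using e by (simp add: square_eq_1_iff)
  then show ?thesis using P by simp
qed

section \<open>The functions of the first kind\<close>

text \<open>The integrand has to be the linear combination only on the loop itself. At the poles the values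
of the two may differ, by the conventions for division by \<open>0\<close>, but admissible loops avoid the poles.\<close>
lemma loop_integral_sum:
  assumes f: "\<And>j. j \<in> J \<Longrightarrow> loop_integrable g (f j)" and J: "finite J"
    and h: "\<And>u. u \<in> loop_image g \<Longrightarrow> h u = (\<Sum>j\<in>J. r j * f j u)"
  shows "loop_integrable g h" and "loop_integral g h = (\<Sum>j\<in>J. r j * loop_integral g (f j))"
proof -
  have ray: "set_integrable lborel {0..} (\<lambda>t. h (a - complex_of_real t))"
    "(LINT t:{0..}|lborel. h (a - complex_of_real t)) = (\<Sum>j\<in>J. r j * (LINT t:{0..}|lborel. f j (a - complex_of_real t)))"
    if a: "left_ray a \<subseteq> loop_image g" "\<And>j. j \<in> J \<Longrightarrow> set_integrable lborel {0..} (\<lambda>t. f j (a - complex_of_real t))" for a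
  proof -
    have eq: "indicator {0..} t *\<^sub>R h (a - complex_of_real t) = (\<Sum>j\<in>J. r j * (indicator {0..} t *\<^sub>R f j (a - complex_of_real t)))" for t :: real
    proof (cases "t \<ge> 0")
      case True
      then have "a - complex_of_real t \<in> loop_image g" using a(1) by (auto simp: left_ray_def)
      with True show ?thesis by (simp add: h)
    qed simp
    have int: "integrable lborel (\<lambda>t. r j * (indicator {0..} t *\<^sub>R f j (a - complex_of_real t)))" if "j \<in> J" for j
      using a(2)[OF that] unfolding set_integrable_def by (rule integrable_mult_right)
    show "set_integrable lborel {0..} (\<lambda>t. h (a - complex_of_real t))"
      unfolding set_integrable_def eq by (intro Bochner_Integration.integrable_sum int)
    have "(LINT t:{0..}|lborel. h (a - complex_of_real t)) =
        (\<Sum>j\<in>J. integral\<^sup>L lborel (\<lambda>t. r j * (indicator {0..} t *\<^sub>R f j (a - complex_of_real t))))"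
      unfolding set_lebesgue_integral_def eq by (intro Bochner_Integration.integral_sum int)
    also have "\<dots> = (\<Sum>j\<in>J. r j * (LINT t:{0..}|lborel. f j (a - complex_of_real t)))"
      unfolding set_lebesgue_integral_def by (intro sum.cong refl integral_mult_right_zero)
    finally show "(LINT t:{0..}|lborel. h (a - complex_of_real t)) =
        (\<Sum>j\<in>J. r j * (LINT t:{0..}|lborel. f j (a - complex_of_real t)))" .
  qed
  have core: "((\<lambda>u. \<Sum>j\<in>J. r j * f j u) has_contour_integral (\<Sum>j\<in>J. r j * contour_integral g (f j))) g"
    using f J by (intro has_contour_integral_sum has_contour_integral_lmul has_contour_integral_integral)
      (auto simp: loop_integrable_def)
  then have core: "(h has_contour_integral (\<Sum>j\<in>J. r j * contour_integral g (f j))) g"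
    by (rule has_contour_integral_eq) (simp add: h loop_image_def)
  have sub: "left_ray (pathstart g) \<subseteq> loop_image g" "left_ray (pathfinish g) \<subseteq> loop_image g"
    by (auto simp: loop_image_def)
  have f': "\<And>j. j \<in> J \<Longrightarrow> set_integrable lborel {0..} (\<lambda>t. f j (pathstart g - complex_of_real t))"
    "\<And>j. j \<in> J \<Longrightarrow> set_integrable lborel {0..} (\<lambda>t. f j (pathfinish g - complex_of_real t))"
    using f by (auto simp: loop_integrable_def)
  note r1 = ray[OF sub(1) f'(1)] and r2 = ray[OF sub(2) f'(2)]
  show "loop_integrable g h"
    unfolding loop_integrable_def using r1(1) r2(1) core
    by (auto simp: contour_integrable_on_def)
  show "loop_integral g h = (\<Sum>j\<in>J. r j * loop_integral g (f j))"
    using r1(2) r2(2) contour_integral_unique[OF core]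
    by (simp add: loop_integral_def sum.distrib sum_subtractf algebra_simps)
qed

abbreviation (input) upper_params :: "real \<Rightarrow> real \<Rightarrow> nat \<Rightarrow> complex list" where
  "upper_params a b n \<equiv> [- of_nat n - of_real b, of_real a + of_nat n + 1]"

abbreviation (input) lower_params :: "real \<Rightarrow> real \<Rightarrow> complex list" where
  "lower_params a b \<equiv> [0, of_real a, - of_real b]"

lemma nonpos_Int_add_iff: "x + u \<in> \<int>\<^sub>\<le>\<^sub>0 \<longleftrightarrow> (\<exists>k. u = - x - of_nat k)" for u :: complex
proof
  assume "x + u \<in> \<int>\<^sub>\<le>\<^sub>0"
  then obtain k where "x + u = - of_nat k" by (auto elim: nonpos_Ints_cases')
  then have "u = - x - of_nat k" by (simp add: algebra_simps eq_neg_iff_add_eq_0)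
  then show "\<exists>k. u = - x - of_nat k" ..
qed auto

lemma kernel_poles_subset_meijer_b_poles:
  "kernel_poles (a + real j + 1) \<subseteq> meijer_b_poles 2 (lower_params a b)"
proof
  fix p assume "p \<in> kernel_poles (a + real j + 1)"
  then have "p \<in> \<int>\<^sub>\<le>\<^sub>0 \<or> of_real a + p = - of_nat j" by (auto simp: kernel_poles_def)
  then have "p \<in> \<int>\<^sub>\<le>\<^sub>0 \<or> of_real a + p \<in> \<int>\<^sub>\<le>\<^sub>0" by auto
  then show "p \<in> meijer_b_poles 2 (lower_params a b)"
    by (auto simp: meijer_b_poles_def less_2_cases_iff)
qed

text \<open>Off the poles the Gamma quotients are Pochhammer symbols. The quotient with \<open>b\<close> needs a case
distinction: where \<open>\<Gamma>(1 + b - u)\<close> has a pole and \<open>\<Gamma>(1 + n + b - u)\<close> does not, the quotient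
is \<open>0\<close> by the convention for division, and the Pochhammer symbol vanishes too.\<close>
lemma meijer_integrand_eq:
  assumes b: "u \<notin> meijer_b_poles 2 (lower_params a b)" and a: "u \<notin> meijer_a_poles 1 (upper_params a b n)"
  shows "meijer_integrand 2 1 (upper_params a b n) (lower_params a b) w u =
     (\<Sum>j\<le>n. cauchy_residue (of_real (a + b + 1)) n j * kernel w (a + real j + 1) u)"
proof -
  have au: "of_real a + u \<notin> \<int>\<^sub>\<le>\<^sub>0"
    using b by (auto simp: meijer_b_poles_def less_2_cases_iff)
  have bu: "1 + of_nat n + of_real b - u \<notin> \<int>\<^sub>\<le>\<^sub>0"
    using a by (auto simp: meijer_a_poles_def algebra_simps)
  have 1: "Gamma (1 + of_nat n + of_real b - u) / Gamma (1 + of_real b - u) = pochhammer (1 + of_real b - u) n"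
  proof (cases "1 + of_real b - u \<in> \<int>\<^sub>\<le>\<^sub>0")
    case False
    have "1 + of_nat n + of_real b - u = (1 + of_real b - u) + of_nat n" by simp
    then show ?thesis using pochhammer_Gamma[OF False, of n] by (simp only:)
  next
    case True
    then obtain m where m: "1 + of_real b - u = - of_nat m" by (auto elim: nonpos_Ints_cases')
    have "m < n"
    proof (rule ccontr)
      assume "\<not> m < n"
      then have "1 + of_nat n + of_real b - u = - of_nat (m - n)"
        using m by (simp add: of_nat_diff algebra_simps)
      with bu show False by simp
    qed
    then show ?thesis using True by (simp add: m Gamma_eq_zero_iff pochhammer_of_nat_eq_0_iff)
  qed
  have nz: "of_real a + u + of_nat k \<noteq> 0" for k
  proof
    assume "of_real a + u + of_nat k = 0"
    then have "of_real a + u = - of_nat k" by (simp add: add_eq_0_iff2)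
    with au show False by simp
  qed
  have 2: "Gamma (of_real a + u) / Gamma (of_real a + of_nat n + 1 + u) = 1 / pochhammer (of_real a + u) (Suc n)"
  proof -
    have "Gamma (of_real a + of_nat n + 1 + u) = pochhammer (of_real a + u) (Suc n) * Gamma (of_real a + u)"
      using pochhammer_Gamma[OF au, of "Suc n"] Gamma_eq_zero_iff[of "of_real a + u"] au
      by (simp add: add_ac)
    then show ?thesis using Gamma_eq_zero_iff[of "of_real a + u"] au by simp
  qed
  have "meijer_integrand 2 1 (upper_params a b n) (lower_params a b) w u =
    Gamma u * w powr (- u) * (Gamma (of_real a + u) / Gamma (of_real a + of_nat n + 1 + u)) *
      (Gamma (1 + of_nat n + of_real b - u) / Gamma (1 + of_real b - u))"
  proof -
    have e: "1 - (- of_nat n - of_real b) - u = 1 + of_nat n + of_real b - u" by simp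
    show ?thesis by (simp add: meijer_integrand_def numeral_2_eq_2 e add_ac mult_ac)
  qed
  also have "\<dots> = Gamma u * w powr (- u) *
      (pochhammer (of_real (a + b + 1) - (of_real a + u)) n / pochhammer (of_real a + u) (Suc n))"
  proof -
    have e: "of_real (a + b + 1) - (of_real a + u) = 1 + of_real b - u" by simp
    show ?thesis unfolding 1 2 e by simp
  qed
  also have "\<dots> = Gamma u * w powr (- u) *
      (\<Sum>j\<le>n. cauchy_residue (of_real (a + b + 1)) n j / (of_real a + u + of_nat j))"
    by (subst partial_fractions[OF nz]) simp
  also have "\<dots> = (\<Sum>j\<le>n. cauchy_residue (of_real (a + b + 1)) n j * kernel w (a + real j + 1) u)"
    by (simp add: sum_distrib_left kernel_def add_ac mult_ac)
  finally show ?thesis .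
qed

text \<open>The enclosed poles are real and at most \<open>max 0 (- a)\<close>, the excluded ones real and at least
\<open>b + 1\<close>; the loop crosses the axis halfway between the two, which is possible since \<open>b > -1\<close>
and \<open>a + b > -1\<close>.\<close>
lemma meijer_loop_exists:
  assumes "a > -1" "b > -1" "a + b > -1"
  shows "meijer_loop 2 1 (upper_params a b n) (lower_params a b) (hankel_contour (((max 0 (- a)) + (b + 1)) / 2))"
proof -
  define \<sigma> where "\<sigma> = (max 0 (- a) + (b + 1)) / 2"
  have \<sigma>: "0 < \<sigma>" "- a < \<sigma>" "\<sigma> < b + 1" using assms by (auto simp: \<sigma>_def)
  have left: "Im p = 0" "Re p < \<sigma>" if "p \<in> meijer_b_poles 2 (lower_params a b)" for p
  proof -
    from that have "0 + p \<in> \<int>\<^sub>\<le>\<^sub>0 \<or> of_real a + p \<in> \<int>\<^sub>\<le>\<^sub>0"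
      by (auto simp: meijer_b_poles_def less_2_cases_iff)
    then show "Im p = 0" "Re p < \<sigma>" unfolding nonpos_Int_add_iff using \<sigma> by auto
  qed
  have right: "Im p = 0" "Re p > \<sigma>" if "p \<in> meijer_a_poles 1 (upper_params a b n)" for p
  proof -
    from that have "(1 + of_nat n + of_real b) + (- p) \<in> \<int>\<^sub>\<le>\<^sub>0"
      by (auto simp: meijer_a_poles_def algebra_simps)
    then obtain k where "- p = - (1 + of_nat n + of_real b) - of_nat k"
      unfolding nonpos_Int_add_iff by blast
    from arg_cong[OF this, of uminus] have "p = 1 + of_nat n + of_real b + of_nat k" by simp
    then show "Im p = 0" "Re p > \<sigma>" using \<sigma> by auto
  qed
  have "encircles (hankel_contour \<sigma>) (meijer_b_poles 2 (lower_params a b))"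
    using left by (intro encircles_hankel_contour) blast
  moreover have "p \<notin> loop_image (hankel_contour \<sigma>)"
    "\<forall>\<^sub>F R in at_top. winding_number (closed_loop (hankel_contour \<sigma>) R) p = 0"
    if "p \<in> meijer_a_poles 1 (upper_params a b n)" for p
    using hankel_contour_winding[of p \<sigma>] right[OF that] by simp_all
  ultimately have "meijer_loop 2 1 (upper_params a b n) (lower_params a b) (hankel_contour \<sigma>)"
    using hankel_loop_hankel_contour[of \<sigma>]
    unfolding meijer_loop_def hankel_loop_def encircles_def by blast
  then show ?thesis by (simp only: \<sigma>_def)
qed

lemma has_meijer_G_incomplete_gamma_terms:
  assumes ab: "a > -1" "b > -1" "a + b > -1" and w: "w \<notin> \<real>\<^sub>\<le>\<^sub>0"
  shows "has_meijer_G 2 1 (upper_params a b n) (lower_params a b) w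
    (\<Sum>j\<le>n. cauchy_residue (of_real (a + b + 1)) n j * incomplete_gamma_term (a + real j + 1) w)"
  unfolding has_meijer_G_def
proof (intro conjI allI impI)
  show "\<exists>g. meijer_loop 2 1 (upper_params a b n) (lower_params a b) g" using meijer_loop_exists[OF ab] by blast
  fix g assume "meijer_loop 2 1 (upper_params a b n) (lower_params a b) g"
  then have g: "hankel_loop g" "encircles g (meijer_b_poles 2 (lower_params a b))"
    and off: "\<And>u. u \<in> loop_image g \<Longrightarrow> u \<notin> meijer_b_poles 2 (lower_params a b)"
      "\<And>u. u \<in> loop_image g \<Longrightarrow> u \<notin> meijer_a_poles 1 (upper_params a b n)"
    by (auto simp: meijer_loop_def hankel_loop_def encircles_def)
  have w0: "w \<noteq> 0" using w by auto
  have enc: "encircles g (kernel_poles (a + real j + 1))" for j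
    using g(2) kernel_poles_subset_meijer_b_poles[of a j b] by (auto simp: encircles_def)
  have int: "loop_integrable g (kernel w (a + real j + 1))" for j
  proof -
    obtain N where "a + real j + 1 \<le> real N" using real_arch_simple by blast
    then show ?thesis by (rule kernel_loop(1)[OF g(1) enc w0])
  qed
  have val: "loop_integral g (kernel w (a + real j + 1)) = 2 * pi * \<i> * incomplete_gamma_term (a + real j + 1) w" for j
    using ab by (intro loop_integral_kernel[OF g(1) enc w]) simp
  note eq = meijer_integrand_eq[OF off]
  note * = loop_integral_sum[where h = "meijer_integrand 2 1 (upper_params a b n) (lower_params a b) w"
      and f = "\<lambda>j. kernel w (a + real j + 1)" and J = "{..n}"
      and r = "cauchy_residue (of_real (a + b + 1)) n", OF int finite_atMost eq]
  show "loop_integrable g (meijer_integrand 2 1 (upper_params a b n) (lower_params a b) w)" by (rule *(1))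
  have sum: "loop_integral g (meijer_integrand 2 1 (upper_params a b n) (lower_params a b) w) =
      (\<Sum>j\<le>n. cauchy_residue (of_real (a + b + 1)) n j * (2 * pi * \<i> * incomplete_gamma_term (a + real j + 1) w))"
    using *(2) by (simp only: val)
  show "loop_integral g (meijer_integrand 2 1 (upper_params a b n) (lower_params a b) w) / (2 * of_real pi * \<i>) =
      (\<Sum>j\<le>n. cauchy_residue (of_real (a + b + 1)) n j * incomplete_gamma_term (a + real j + 1) w)"
  proof -
    have "x * (2 * pi * \<i> * y) / (2 * of_real pi * \<i>) = x * y" for x y by (simp add: field_simps)
    then show ?thesis unfolding sum sum_divide_distrib by (simp only:)
  qed
qed simp_all

text \<open>The factor \<open>e\<^sup>-\<^sup>z\<close> cancels the factor \<open>e\<^sup>-\<^sup>w\<close>, \<open>w = - z\<close>, of the incomplete Gamma terms, and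
the extra sign comes from \<open>1 / (z - x) = - 1 / (x + w)\<close>.\<close>
lemma first_kind_aux_cl_poly:
  assumes ab: "a > -1" "b > -1" "a + b > -1" and z: "- z \<notin> \<real>\<^sub>\<le>\<^sub>0"
  shows "set_integrable lborel {0<..} (first_kind_integrand a (cl_poly a b n) z)"
    and "first_kind_aux a (cl_poly a b n) z =
      exp (- z) * (- 1) ^ (n + 1) * of_real (cl_pi a b n) *
      (\<Sum>j\<le>n. cauchy_residue (of_real (a + b + 1)) n j * incomplete_gamma_term (a + real j + 1) (- z))"
proof -
  define k where "k = (\<lambda>j. (- 1) ^ n * cl_pi a b n * cauchy_residue (a + b + 1) n j / Gamma (a + real j + 1))"
  define s where "s = (\<lambda>j x. of_real (x powr (a + real j + 1 - 1) * exp (- x)) / (of_real x + - z))"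
  have c: "a + real j + 1 > 0" for j using ab by simp
  have int: "set_integrable lborel {0<..} (s j)" for j
    unfolding s_def by (rule stieltjes_integrable[OF c z])
  have eq: "indicator {0<..} x *\<^sub>R first_kind_integrand a (cl_poly a b n) z x =
      (\<Sum>j\<le>n. - of_real (k j) * (indicator {0<..} x *\<^sub>R s j x))" for x
  proof (cases "x > 0")
    case True
    have "poly (cl_poly a b n) x * x powr a * exp (- x) = (\<Sum>j\<le>n. k j * (x powr (a + real j + 1 - 1) * exp (- x)))"
      using True by (simp add: cl_poly_def poly_sum poly_monom k_def sum_distrib_left sum_distrib_right powr_add powr_realpow mult_ac)
    moreover have "y / (z - of_real x) = - y / (of_real x + - z)" for y
      using minus_divide_divide[of y "z - of_real x"] by simp
    ultimately show ?thesis using True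
      by (simp only: first_kind_integrand_def s_def) (simp add: sum_divide_distrib sum_negf sum_distrib_left)
  qed simp
  have int': "integrable lborel (\<lambda>x. - of_real (k j) * (indicator {0<..} x *\<^sub>R s j x))" for j
    using int[of j] unfolding set_integrable_def by (rule integrable_mult_right)
  show "set_integrable lborel {0<..} (first_kind_integrand a (cl_poly a b n) z)"
    unfolding set_integrable_def eq by (intro Bochner_Integration.integrable_sum int')
  have "first_kind_aux a (cl_poly a b n) z = (\<Sum>j\<le>n. integral\<^sup>L lborel (\<lambda>x. - of_real (k j) * (indicator {0<..} x *\<^sub>R s j x)))"
    unfolding first_kind_aux_def set_lebesgue_integral_def eq by (intro Bochner_Integration.integral_sum int')
  also have "\<dots> = (\<Sum>j\<le>n. - of_real (k j) * stieltjes (a + real j + 1) (- z))"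
    unfolding stieltjes_def set_lebesgue_integral_def s_def by (intro sum.cong refl integral_mult_right_zero)
  also have "\<dots> = (\<Sum>j\<le>n. exp (- z) * (- 1) ^ (n + 1) * of_real (cl_pi a b n) *
      (cauchy_residue (of_real (a + b + 1)) n j * incomplete_gamma_term (a + real j + 1) (- z)))"
  proof (intro sum.cong refl)
    fix j
    have "of_real (a + b + 1) + of_nat j = complex_of_real (a + b + 1 + real j)" by simp
    then have res: "cauchy_residue (of_real (a + b + 1)) n j = complex_of_real (cauchy_residue (a + b + 1) n j)"
      unfolding cauchy_residue_def by (simp only: pochhammer_of_real) simp
    have cancel: "e * (- 1) ^ (n + 1) * c * (r * (e' / g * s)) = - ((- 1) ^ n * c * r / g) * s"
      if "e * e' = 1" for e e' c r g s :: complex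
    proof -
      have "e * (- 1) ^ (n + 1) * c * (r * (e' / g * s)) = (e * e') * (- ((- 1) ^ n * c * r / g) * s)"
        by simp
      with that show ?thesis by simp
    qed
    have "exp (- z) * exp (- (- z)) = 1" by (simp flip: exp_add)
    note cancel [OF this, of "of_real (cl_pi a b n)" "of_real (cauchy_residue (a + b + 1) n j)"
      "of_real (Gamma (a + real j + 1))" "stieltjes (a + real j + 1) (- z)"]
    then show "- of_real (k j) * stieltjes (a + real j + 1) (- z) =
      exp (- z) * (- 1) ^ (n + 1) * of_real (cl_pi a b n) *
      (cauchy_residue (of_real (a + b + 1)) n j * incomplete_gamma_term (a + real j + 1) (- z))"
      unfolding res incomplete_gamma_term_def k_def
      by (simp only: of_real_mult of_real_divide of_real_power of_real_minus of_real_1)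
  qed
  finally show "first_kind_aux a (cl_poly a b n) z =
      exp (- z) * (- 1) ^ (n + 1) * of_real (cl_pi a b n) *
      (\<Sum>j\<le>n. cauchy_residue (of_real (a + b + 1)) n j * incomplete_gamma_term (a + real j + 1) (- z))"
    by (simp add: sum_distrib_left)
qed

lemma first_kind_meijer_G:
  assumes ab: "a > -1" "b > -1" "a + b > -1" and pq: "cauchy_laguerre_biorthonormal a b p q"
    and z: "z \<notin> complex_of_real ` {0..}"
  shows "set_integrable lborel {0<..} (first_kind_integrand a (p n) z)"
    and "\<exists>w. has_meijer_G 2 1 (upper_params a b n) (lower_params a b) (- z) w"
    and "first_kind_aux a (p n) z =
      exp (- z) * (- 1) ^ (n + 1) * of_real (cl_pi a b n) * meijer_G 2 1 (upper_params a b n) (lower_params a b) (- z)"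
proof -
  have z': "- z \<notin> \<real>\<^sub>\<le>\<^sub>0"
  proof
    assume "- z \<in> \<real>\<^sub>\<le>\<^sub>0"
    then obtain r where "r \<le> 0" "- z = of_real r" by (auto simp: nonpos_Reals_def)
    then have "z = of_real (- r)" "- r \<in> {0..}" by (simp_all add: minus_equation_iff[of z])
    with z show False by blast
  qed
  note G = has_meijer_G_incomplete_gamma_terms[OF ab z', of n]
  show "set_integrable lborel {0<..} (first_kind_integrand a (p n) z)"
    "\<exists>w. has_meijer_G 2 1 (upper_params a b n) (lower_params a b) (- z) w"
    "first_kind_aux a (p n) z =
      exp (- z) * (- 1) ^ (n + 1) * of_real (cl_pi a b n) * meijer_G 2 1 (upper_params a b n) (lower_params a b) (- z)"
    unfolding cl_poly_unique[OF ab pq] meijer_G_eqI[OF G]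
    using first_kind_aux_cl_poly[OF ab z', of n] G by blast+
qed

theorem theorem5p3:
  fixes a b :: real and p q :: "nat \<Rightarrow> real poly" and n :: nat and z :: complex
  assumes "a > -1" and "b > -1" and "a + b > -1"
    and "cauchy_laguerre_biorthonormal a b p q"
    and "z \<notin> complex_of_real ` {0..}"
  shows "set_integrable lborel {0<..} (first_kind_integrand a (p n) z) \<and>
    (\<exists>w. has_meijer_G 2 1
           [- of_nat n - of_real b, of_real a + of_nat n + 1] [0, of_real a, - of_real b] (- z) w) \<and>
    first_kind_aux a (p n) z =
           exp (- z) * (-1) ^ (n + 1) * of_real (cl_pi a b n) *
           meijer_G 2 1
             [- of_nat n - of_real b, of_real a + of_nat n + 1] [0, of_real a, - of_real b] (- z) \<and>
    set_integrable lborel {0<..} (first_kind_integrand b (q n) z) \<and>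
    (\<exists>w. has_meijer_G 2 1
           [- of_nat n - of_real a, of_real b + of_nat n + 1] [0, of_real b, - of_real a] (- z) w) \<and>
    first_kind_aux b (q n) z =
           exp (- z) * (-1) ^ (n + 1) * of_real (cl_eta a b n) *
           meijer_G 2 1
             [- of_nat n - of_real a, of_real b + of_nat n + 1] [0, of_real b, - of_real a] (- z)"
proof -
  have ba: "b > -1" "a > -1" "b + a > -1" using assms by auto
  have eta: "cl_eta a b n = cl_pi b a n" by (simp add: cl_eta_def cl_pi_def add.commute)
  note P = first_kind_meijer_G[OF assms(1-5), of n]
  note Q = first_kind_meijer_G[OF ba cauchy_laguerre_biorthonormal_swap[OF assms(1-4)] assms(5), of n]
  show ?thesis
    unfolding eta by (intro conjI P Q)
qed

end
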